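(* Let $(\Omega,\sigma,\mathbb{R})$ be a minimal continuous flow on a compact metric space, let $A$ be a diagonal $m\times m$ matrix with negative diagonal entries, and let $F\colon\Omega\times BC\to\mathbb{R}^m$ satisfy the following hypotheses. (1) $F$ is continuous on $\Omega\times BC$ when $BC$ carries the norm $\|\cdot\|_\infty$, and for each $r>0$ it is Lipschitz continuous in its second variable on $\Omega\times B_r$. (2) For each $r>0$, the restriction $F\colon\Omega\times B_r\to\mathbb{R}^m$ is continuous when $B_r$ carries the compact-open topology. (3) If $x,y\in BC$ and $x\leq_A y$, then $F(\omega,y)-F(\omega,x)\geq A\,(y(0)-x(0))$ componentwise for each $\omega\in\Omega$. (4) If $(\omega,x),(\omega,y)\in\Omega\times BC$ admit a backward orbit extension, $x\leq_A y$, and there is a subset $J\subset\{1,\ldots,m\}$ such that $x_i=y_i$ for each $i\notin J$ and $x_i(s)<y_i(s)$ for each $i\in J$ and $s\leq 0$, then $F_i(\omega,y)-F_i(\omega,x)-(A\,(y(0)-x(0)))_i>0$ for each $i\in J$. (5) For each $k\in\mathbb{N}$, $B_k$ is uniformly stable for the order $\leq_A$. Let $(\omega_0,x_0)\in\Omega\times BC$ be such that each component of $x_0$ is of bounded variation on $[-k,-k+1]$ for all $k\in\mathbb{N}$, $k\ge 1$, with $$\sup\{V_{[-k,-k+1]}((x_0)_i)\mid i\in\{1,\ldots,m\},\ k\geq 1\}<\infty ,$$ and such that the solution $z(\cdot,\omega_0,x_0)$ of $z'(t)=F(\omega_0\cdot t,z_t)$ with initial value $x_0$ is bounded. Then there is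 a map $c\colon\Omega\to BU$, continuous for the compact-open topology on $BU$, which is an equilibrium, i.e. $u(t,\omega,c(\omega))=c(\omega\cdot t)$ for each $\omega\in\Omega$ and $t\geq 0$, such that the omega-limit set satisfies $$\mathcal{O}(\omega_0,x_0)=\{(\omega,c(\omega))\mid\omega\in\Omega\}$$ and $$\lim_{t\to\infty}\mathsf{d}(u(t,\omega_0,x_0),c(\omega_0\cdot t))=0 .$$
   Context: $(\Omega,d)$ is a compact metric space with a continuous flow $\sigma\colon\mathbb{R}\times\Omega\to\Omega$, written $\omega\cdot t=\sigma(t,\omega)$; the flow is minimal, i.e. every orbit is dense. $\|\cdot\|$ is the maximum norm on $\mathbb{R}^m$ and $X=C((-\infty,0],\mathbb{R}^m)$ carries the compact-open topology, metrized by $\mathsf{d}(x,y)=\sum_{n=1}^\infty 2^{-n}\frac{\|x-y\|_n}{1+\|x-y\|_n}$ with $\|x\|_n=\sup_{s\in[-n,0]}\|x(s)\|$. $BC\subset X$ is the set of bounded functions, with $\|x\|_\infty=\sup_{s\le 0}\|x(s)\|$; $BU\subset BC$ is the set of bounded uniformly continuous functions; $B_r=\{x\in BC\mid\|x\|_\infty\leq r\}$. For a continuous function $x$ defined on an interval containing $(-\infty,t]$, $x_t\in X$ is $x_t(s)=x(t+s)$, $s\leq 0$. $V_{[a,b]}(f)$ is the total variation of a scalar function $f$ on $[a,b]$. A solution of $z'(t)=F(\omega\cdot t,z_t)$, $t\ge0$, with initial value $x\in BC$ is a continuous function $z\colon(-\infty,T)\to\mathbb{R}^m$ ($0<T\le\infty$)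 with $z=x$ on $(-\infty,0]$ that satisfies the equation on $[0,T)$ (one-sided derivative at $0$). Under (1)-(2) solutions exist locally and are unique; $z(\cdot,\omega,x)$ denotes the maximal solution and $u(t,\omega,x)=z_t(\omega,x)$, i.e. $u(t,\omega,x)(s)=z(t+s,\omega,x)$ for $s\leq 0$. Bounded solutions are defined for all $t\geq 0$. Write $\tau(t,\omega,x)=(\omega\cdot t,u(t,\omega,x))$. Order: $x\leq_A y$ if and only if $x\leq y$ (componentwise, pointwise) and $y(t)-x(t)\geq e^{A(t-s)}(y(s)-x(s))$ for all $-\infty<s\leq t\leq 0$. A point $(\omega,x)\in\Omega\times BC$ admits a backward orbit extension if there is a continuous map $\psi\colon(-\infty,0]\to\Omega\times BC$ ($BC$ with the metric $\mathsf{d}$) with $\psi(0)=(\omega,x)$ and $\tau(t,\psi(s))=\psi(s+t)$ whenever $s\leq 0$ and $0\leq t\leq -s$. A subset $K\subset BC$ is uniformly stable for the order $\leq_A$ if for every $\varepsilon>0$ there is $\delta>0$ such that, if $x,y\in K$ satisfy $\mathsf{d}(x,y)<\delta$ and $x\leq_A y$ or $y\leq_A x$, then $\mathsf{d}(u(t,\omega,x),u(t,\omega,y))<\varepsilon$ for each $t\geq 0$ and each $\omega\in\Omega$ (in particular both terms are defined for all $t\ge 0$). The omega-limit set is $\mathcal{O}(\omega_0,x_0)=\{(\omega,x)\mid\exists\,t_n\uparrow\infty\text{ with }\omega_0\cdot t_n\to\omega,\ \mathsf{d}(u(t_n,\omega_0,x_0),x)\to 0\}$. *)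

theory Defs
  imports "HOL-Analysis.Analysis"
begin

section \<open>The space of histories\<close>

text \<open>The norm on \<open>\<real>\<^sup>m\<close> is the maximum norm \<^const>\<open>infnorm\<close>; the type variable \<open>'m\<close> is the index
  set \<open>{1,\<dots>,m}\<close>, and \<open>\<le>\<close> on \<open>real ^ 'm\<close> is the componentwise order.\<close>

text \<open>\<open>'m hist\<close> is \<open>X = C((-\<infinity>,0], \<real>\<^sup>m)\<close>. Its elements are represented by functions on the whole real
  line with the conventional value \<^const>\<open>undefined\<close> on \<open>(0,\<infinity>)\<close>, so that equality in the type is
  equality on \<open>(-\<infinity>,0]\<close>.\<close>

typedef 'm hist = "{x :: real \<Rightarrow> real ^ 'm. continuous_on {..0} x \<and> x \<in> extensional {..0}}"
  morphisms hist_fun Hist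
proof (intro exI CollectI conjI)
  show "continuous_on {..0 :: real} (restrict (\<lambda>_. 0 :: real ^ 'm) {..0})"
    by (rule continuous_on_eq[of _ "\<lambda>_. 0"]) auto
qed auto

definition seminorm_on :: "nat \<Rightarrow> (real \<Rightarrow> real ^ 'm) \<Rightarrow> real" where
  "seminorm_on n f = (SUP s\<in>{- real n..0}. infnorm (f s))"

definition supnorm :: "(real \<Rightarrow> real ^ 'm) \<Rightarrow> real" where
  "supnorm f = (SUP s\<in>{..0}. infnorm (f s))"

definition hist_diff :: "'m hist \<Rightarrow> 'm hist \<Rightarrow> real \<Rightarrow> real ^ 'm" where
  "hist_diff x y = (\<lambda>s. hist_fun x s - hist_fun y s)"

lemma continuous_hist_fun: "continuous_on {..0} (hist_fun x)"
  using hist_fun[of x] by auto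

lemma hist_eqI: "(\<And>s. s \<le> 0 \<Longrightarrow> hist_fun x s = hist_fun y s) \<Longrightarrow> x = y"
  using hist_fun[of x] hist_fun[of y]
  by (intro hist_fun_inject[THEN iffD1] extensionalityI[of _ "{..0}"]) auto

lemma seminorm_on_bdd: "bdd_above ((\<lambda>s. infnorm (hist_diff x y s)) ` {- real n..0})"
proof -
  have "continuous_on {- real n..0} (\<lambda>s. infnorm (hist_diff x y s))"
    unfolding hist_diff_def
    by (intro continuous_intros continuous_on_subset[OF continuous_hist_fun]) auto
  then show ?thesis
    by (intro bounded_imp_bdd_above compact_imp_bounded compact_continuous_image) auto
qed

lemma infnorm_le_seminorm_on:
  "- real n \<le> s \<Longrightarrow> s \<le> 0 \<Longrightarrow> infnorm (hist_diff x y s) \<le> seminorm_on n (hist_diff x y)"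
  unfolding seminorm_on_def by (rule cSUP_upper[OF _ seminorm_on_bdd]) auto

lemma seminorm_on_nonneg: "0 \<le> seminorm_on n (hist_diff x y)"
  using infnorm_le_seminorm_on[of n 0 x y] infnorm_pos_le[of "hist_diff x y 0"] by linarith

lemma seminorm_on_triangle:
  "seminorm_on n (hist_diff x y) \<le> seminorm_on n (hist_diff x z) + seminorm_on n (hist_diff y z)"
proof -
  have "infnorm (hist_diff x y s) \<le> seminorm_on n (hist_diff x z) + seminorm_on n (hist_diff y z)"
    if "s \<in> {- real n..0}" for s
  proof -
    have "infnorm (hist_diff x y s) = infnorm (hist_diff x z s + hist_diff z y s)"
      by (simp add: hist_diff_def)
    also have "\<dots> \<le> infnorm (hist_diff x z s) + infnorm (hist_diff z y s)"
      by (rule infnorm_triangle)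
    also have "infnorm (hist_diff z y s) = infnorm (hist_diff y z s)"
      unfolding hist_diff_def by (rule infnorm_sub)
    finally show ?thesis
      using infnorm_le_seminorm_on[of n s x z] infnorm_le_seminorm_on[of n s y z] that by auto
  qed
  then show ?thesis
    unfolding seminorm_on_def[of n "hist_diff x y"] by (intro cSUP_least) auto
qed

instantiation hist :: (finite) metric_space
begin

text \<open>The sum over \<open>n \<ge> 1\<close> is shifted to start at \<open>0\<close>. This metric induces the compact-open
  topology.\<close>

definition dist_hist :: "'a hist \<Rightarrow> 'a hist \<Rightarrow> real" where
  "dist_hist x y = (\<Sum>n. (1 / 2) ^ Suc n *
     (seminorm_on (Suc n) (hist_diff x y) / (1 + seminorm_on (Suc n) (hist_diff x y))))"

definition uniformity_hist :: "('a hist \<times> 'a hist) filter" where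
  "uniformity_hist = (INF e\<in>{0 <..}. principal {(x, y). dist x y < e})"

definition open_hist :: "'a hist set \<Rightarrow> bool" where
  "open_hist S = (\<forall>x\<in>S. \<forall>\<^sub>F (x', y) in uniformity. x' = x \<longrightarrow> y \<in> S)"

lemma summable_dist_hist:
  fixes x y :: "'a hist"
  shows "summable (\<lambda>n. (1 / 2) ^ Suc n *
     (seminorm_on (Suc n) (hist_diff x y) / (1 + seminorm_on (Suc n) (hist_diff x y))))"
proof (rule summable_comparison_test')
  show "summable (\<lambda>n. (1 / 2 :: real) ^ Suc n)"
    by (simp add: summable_geometric)
  fix n :: nat
  let ?q = "seminorm_on (Suc n) (hist_diff x y) / (1 + seminorm_on (Suc n) (hist_diff x y))"
  have q: "0 \<le> ?q" "?q \<le> 1"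
    using seminorm_on_nonneg[of "Suc n" x y] by (simp_all add: divide_le_eq)
  have "norm ((1 / 2) ^ Suc n * ?q) = (1 / 2) ^ Suc n * ?q"
    unfolding real_norm_def using q by (intro abs_of_nonneg mult_nonneg_nonneg) auto
  also have "\<dots> \<le> (1 / 2) ^ Suc n"
    using q by (intro mult_left_le) auto
  finally show "norm ((1 / 2) ^ Suc n * ?q) \<le> (1 / 2) ^ Suc n" .
qed

instance
proof
  fix x y z :: "'a hist"
  let ?q = "\<lambda>x y n. seminorm_on (Suc n) (hist_diff x y) / (1 + seminorm_on (Suc n) (hist_diff x y))"
  have q0: "0 \<le> ?q x y n" for x y :: "'a hist" and n
    using seminorm_on_nonneg[of "Suc n" x y] by simp
  show "dist x y = 0 \<longleftrightarrow> x = y"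
  proof
    assume "x = y"
    then show "dist x y = 0"
      by (simp add: dist_hist_def hist_diff_def seminorm_on_def infnorm_0)
  next
    assume "dist x y = 0"
    moreover have "0 \<le> (1 / 2) ^ Suc n * ?q x y n" for n
      by (intro mult_nonneg_nonneg q0) simp
    ultimately have *: "(1 / 2) ^ Suc n * ?q x y n = 0" for n
      using suminf_eq_zero_iff[OF summable_dist_hist[of x y]] unfolding dist_hist_def by blast
    have z: "seminorm_on (Suc n) (hist_diff x y) = 0" for n
      using *[of n] seminorm_on_nonneg[of "Suc n" x y] by auto
    show "x = y"
    proof (rule hist_eqI)
      fix s :: real assume s: "s \<le> 0"
      obtain n where "- s \<le> real n" using real_arch_simple by blast
      then have "infnorm (hist_diff x y s) \<le> 0"
        using infnorm_le_seminorm_on[of "Suc n" s x y] s z[of n] by simp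
      then show "hist_fun x s = hist_fun y s"
        using infnorm_pos_lt[of "hist_diff x y s"] by (auto simp: hist_diff_def)
    qed
  qed
  have tri: "?q x y n \<le> ?q x z n + ?q y z n" for n
  proof -
    let ?a = "seminorm_on (Suc n) (hist_diff x y)"
    let ?b = "seminorm_on (Suc n) (hist_diff x z)"
    let ?c = "seminorm_on (Suc n) (hist_diff y z)"
    have nn: "0 \<le> ?a" "0 \<le> ?b" "0 \<le> ?c" by (rule seminorm_on_nonneg)+
    have le: "?a \<le> ?b + ?c" by (rule seminorm_on_triangle)
    have "?a / (1 + ?a) \<le> (?b + ?c) / (1 + (?b + ?c))"
      using nn le by (simp add: field_simps)
    also have "\<dots> = ?b / (1 + (?b + ?c)) + ?c / (1 + (?b + ?c))"
      by (rule add_divide_distrib)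
    also have "\<dots> \<le> ?b / (1 + ?b) + ?c / (1 + ?c)"
      using nn by (intro add_mono divide_left_mono mult_pos_pos) auto
    finally show ?thesis .
  qed
  have "dist x y \<le> (\<Sum>n. (1 / 2) ^ Suc n * ?q x z n + (1 / 2) ^ Suc n * ?q y z n)"
    unfolding dist_hist_def
  proof (intro suminf_le summable_dist_hist summable_add)
    fix n
    show "(1 / 2) ^ Suc n * ?q x y n \<le> (1 / 2) ^ Suc n * ?q x z n + (1 / 2) ^ Suc n * ?q y z n"
      using mult_left_mono[OF tri[of n], of "(1 / 2) ^ Suc n"] by (simp add: distrib_left)
  qed
  also have "\<dots> = dist x z + dist y z"
    unfolding dist_hist_def by (rule suminf_add[symmetric]) (rule summable_dist_hist)+
  finally show "dist x y \<le> dist x z + dist y z" .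
qed (rule open_hist_def uniformity_hist_def)+

end

definition BC :: "'m::finite hist set" where
  "BC = {x. bounded (hist_fun x ` {..0})}"

definition BU :: "'m::finite hist set" where
  "BU = {x \<in> BC. uniformly_continuous_on {..0} (hist_fun x)}"

definition B :: "real \<Rightarrow> 'm::finite hist set" where
  "B r = {x \<in> BC. supnorm (hist_fun x) \<le> r}"

text \<open>The history segment \<open>z\<^sub>t\<close>; it is meaningful when \<open>z\<close> is continuous on \<open>(-\<infinity>,t]\<close>.\<close>

definition seg :: "real \<Rightarrow> (real \<Rightarrow> real ^ 'm) \<Rightarrow> 'm hist" where
  "seg t z = Hist (restrict (\<lambda>s. z (t + s)) {..0})"

lemma hist_fun_seg:
  assumes "continuous_on {..t} z" "s \<le> 0"
  shows "hist_fun (seg t z) s = z (t + s)"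
proof -
  have "continuous_on {..0} (\<lambda>s. z (t + s))"
    by (rule continuous_on_compose2[OF assms(1)]) (auto intro!: continuous_intros)
  then have "continuous_on {..0} (restrict (\<lambda>s. z (t + s)) {..0})"
    by (rule continuous_on_eq) simp
  then show ?thesis
    using assms(2) by (simp add: seg_def Hist_inverse)
qed


section \<open>The order\<close>

definition mat_exp :: "real ^ 'm ^ 'm \<Rightarrow> real ^ 'm ^ 'm" where
  "mat_exp M = (\<Sum>k. (1 / fact k) *\<^sub>R (((**) M ^^ k) (mat 1)))"

lemma mat_exp_diagonal:
  fixes M :: "real ^ 'm ^ 'm"
  assumes "\<And>i j. i \<noteq> j \<Longrightarrow> M $ i $ j = 0"
  shows "mat_exp M = (\<chi> i j. if i = j then exp (M $ i $ i) else 0)"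
proof -
  have pow: "((**) M ^^ k) (mat 1) = (\<chi> i j. if i = j then (M $ i $ i) ^ k else 0)" for k
  proof (induction k)
    case (Suc k)
    have "(\<Sum>l\<in>UNIV. M $ i $ l * (if l = j then M $ l $ l ^ k else 0)) =
        (if i = j then M $ i $ i ^ Suc k else 0)" for i j
    proof -
      have "(\<Sum>l\<in>UNIV. M $ i $ l * (if l = j then M $ l $ l ^ k else 0)) =
          (\<Sum>l\<in>UNIV. if l = j then M $ i $ j * M $ j $ j ^ k else 0)"
        by (intro sum.cong) auto
      also have "\<dots> = M $ i $ j * M $ j $ j ^ k" by simp
      finally show ?thesis using assms by auto
    qed
    with Suc show ?case by (simp add: matrix_matrix_mult_def vec_eq_iff)
  qed (simp add: mat_def vec_eq_iff)
  have "(\<lambda>k. (1 / fact k) *\<^sub>R (((**) M ^^ k) (mat 1))) sums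
      (\<chi> i j. if i = j then exp (M $ i $ i) else 0)"
    unfolding sums_def
  proof (intro vec_tendstoI)
    fix i j
    have "(\<lambda>k. (M $ i $ i) ^ k /\<^sub>R fact k) sums exp (M $ i $ i)"
      by (rule exp_converges)
    then show "(\<lambda>n. (\<Sum>k<n. (1 / fact k) *\<^sub>R (((**) M ^^ k) (mat 1))) $ i $ j) \<longlonglongrightarrow>
        (\<chi> i j. if i = j then exp (M $ i $ i) else 0) $ i $ j"
      by (cases "i = j") (auto simp: pow sums_def divide_inverse mult.commute)
  qed
  then show ?thesis by (simp add: mat_exp_def sums_iff)
qed

definition le_A :: "real ^ 'm ^ 'm \<Rightarrow> 'm hist \<Rightarrow> 'm hist \<Rightarrow> bool" where
  "le_A A x y \<longleftrightarrow> (\<forall>s\<le>0. hist_fun x s \<le> hist_fun y s) \<and>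
     (\<forall>s t. s \<le> t \<and> t \<le> 0 \<longrightarrow>
        hist_fun y t - hist_fun x t \<ge> mat_exp ((t - s) *\<^sub>R A) *v (hist_fun y s - hist_fun x s))"


section \<open>Minimal flows\<close>

definition continuous_flow :: "(real \<Rightarrow> 'o::metric_space \<Rightarrow> 'o) \<Rightarrow> bool" where
  "continuous_flow \<sigma> \<longleftrightarrow> continuous_on UNIV (\<lambda>(t, \<omega>). \<sigma> t \<omega>) \<and>
     (\<forall>\<omega>. \<sigma> 0 \<omega> = \<omega>) \<and> (\<forall>s t \<omega>. \<sigma> (s + t) \<omega> = \<sigma> s (\<sigma> t \<omega>))"

definition minimal_flow :: "(real \<Rightarrow> 'o::metric_space \<Rightarrow> 'o) \<Rightarrow> bool" where
  "minimal_flow \<sigma> \<longleftrightarrow> continuous_flow \<sigma> \<and> (\<forall>\<omega>. closure (range (\<lambda>t. \<sigma> t \<omega>)) = UNIV)"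


section \<open>Solutions and the induced semiflow\<close>

text \<open>\<open>F\<close> is a total function on \<open>\<Omega> \<times> X\<close>, but only its values on \<open>\<Omega> \<times> BC\<close> matter: all segments of a
  solution with initial value in \<open>BC\<close> are in \<open>BC\<close>. The values of \<open>z\<close> on \<open>[T,\<infinity>)\<close> are irrelevant, and at
  \<open>t = 0\<close> the derivative is the right one.\<close>

definition is_solution ::
  "(real \<Rightarrow> 'o \<Rightarrow> 'o) \<Rightarrow> ('o \<Rightarrow> 'm hist \<Rightarrow> real ^ 'm) \<Rightarrow> 'o \<Rightarrow> 'm hist \<Rightarrow> ereal \<Rightarrow> (real \<Rightarrow> real ^ 'm) \<Rightarrow> bool"
  where
  "is_solution \<sigma> F \<omega> x T z \<longleftrightarrow> 0 < T \<and> continuous_on {t. ereal t < T} z \<and>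
     (\<forall>s\<le>0. z s = hist_fun x s) \<and>
     (\<forall>t\<ge>0. ereal t < T \<longrightarrow>
        (z has_vector_derivative F (\<sigma> t \<omega>) (seg t z)) (at t within {0..}))"

text \<open>The maximal solution \<open>z(\<cdot>,\<omega>,x)\<close> lives on \<open>(-\<infinity>, lifetime)\<close>; it is well defined there because
  solutions are unique.\<close>

definition lifetime ::
  "(real \<Rightarrow> 'o \<Rightarrow> 'o) \<Rightarrow> ('o \<Rightarrow> 'm hist \<Rightarrow> real ^ 'm) \<Rightarrow> 'o \<Rightarrow> 'm hist \<Rightarrow> ereal" where
  "lifetime \<sigma> F \<omega> x = Sup {T. \<exists>z. is_solution \<sigma> F \<omega> x T z}"

definition solution ::
  "(real \<Rightarrow> 'o \<Rightarrow> 'o) \<Rightarrow> ('o \<Rightarrow> 'm hist \<Rightarrow> real ^ 'm) \<Rightarrow> 'o \<Rightarrow> 'm hist \<Rightarrow> real \<Rightarrow> real ^ 'm" where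
  "solution \<sigma> F \<omega> x t = (THE v. \<exists>T z. is_solution \<sigma> F \<omega> x T z \<and> ereal t < T \<and> v = z t)"

definition u ::
  "(real \<Rightarrow> 'o \<Rightarrow> 'o) \<Rightarrow> ('o \<Rightarrow> 'm hist \<Rightarrow> real ^ 'm) \<Rightarrow> real \<Rightarrow> 'o \<Rightarrow> 'm hist \<Rightarrow> 'm hist" where
  "u \<sigma> F t \<omega> x = seg t (solution \<sigma> F \<omega> x)"

definition \<tau> ::
  "(real \<Rightarrow> 'o \<Rightarrow> 'o) \<Rightarrow> ('o \<Rightarrow> 'm hist \<Rightarrow> real ^ 'm) \<Rightarrow> real \<Rightarrow> 'o \<times> 'm hist \<Rightarrow> 'o \<times> 'm hist" where
  "\<tau> \<sigma> F t p = (\<sigma> t (fst p), u \<sigma> F t (fst p) (snd p))"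

text \<open>An assertion about \<open>u(t,\<omega>,x)\<close> includes that it is defined, i.e. that \<open>t\<close> is smaller than the
  lifetime.\<close>

definition backward_extension ::
  "(real \<Rightarrow> 'o::metric_space \<Rightarrow> 'o) \<Rightarrow> ('o \<Rightarrow> 'm hist \<Rightarrow> real ^ 'm) \<Rightarrow> 'o \<Rightarrow> 'm hist \<Rightarrow> bool" where
  "backward_extension \<sigma> F \<omega> x \<longleftrightarrow>
     (\<exists>\<psi> :: real \<Rightarrow> 'o \<times> 'm hist. continuous_on {..0} \<psi> \<and> (\<forall>s\<le>0. \<psi> s \<in> UNIV \<times> BC) \<and> \<psi> 0 = (\<omega>, x) \<and>
        (\<forall>s\<le>0. \<forall>t. 0 \<le> t \<and> t \<le> - s \<longrightarrow>
           ereal t < lifetime \<sigma> F (fst (\<psi> s)) (snd (\<psi> s)) \<and> \<tau> \<sigma> F t (\<psi> s) = \<psi> (s + t)))"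

definition uniformly_stable ::
  "(real \<Rightarrow> 'o \<Rightarrow> 'o) \<Rightarrow> ('o \<Rightarrow> 'm hist \<Rightarrow> real ^ 'm) \<Rightarrow> real ^ 'm ^ 'm \<Rightarrow> 'm hist set \<Rightarrow> bool" where
  "uniformly_stable \<sigma> F A K \<longleftrightarrow>
     (\<forall>\<epsilon>>0. \<exists>\<delta>>0. \<forall>x\<in>K. \<forall>y\<in>K. dist x y < \<delta> \<and> (le_A A x y \<or> le_A A y x) \<longrightarrow>
        (\<forall>t\<ge>0. \<forall>\<omega>. ereal t < lifetime \<sigma> F \<omega> x \<and> ereal t < lifetime \<sigma> F \<omega> y \<and>
           dist (u \<sigma> F t \<omega> x) (u \<sigma> F t \<omega> y) < \<epsilon>))"

definition omega_limit ::
  "(real \<Rightarrow> 'o::metric_space \<Rightarrow> 'o) \<Rightarrow> ('o \<Rightarrow> 'm hist \<Rightarrow> real ^ 'm) \<Rightarrow> 'o \<Rightarrow> 'm hist \<Rightarrow> ('o \<times> 'm hist) set" where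
  "omega_limit \<sigma> F \<omega>\<^sub>0 x\<^sub>0 = {(\<omega>, x). \<exists>t :: nat \<Rightarrow> real.
     (\<forall>n. 0 \<le> t n \<and> ereal (t n) < lifetime \<sigma> F \<omega>\<^sub>0 x\<^sub>0) \<and> incseq t \<and> filterlim t at_top sequentially \<and>
     (\<lambda>n. \<sigma> (t n) \<omega>\<^sub>0) \<longlonglongrightarrow> \<omega> \<and> (\<lambda>n. dist (u \<sigma> F (t n) \<omega>\<^sub>0 x\<^sub>0) x) \<longlonglongrightarrow> 0}"

definition equilibrium ::
  "(real \<Rightarrow> 'o \<Rightarrow> 'o) \<Rightarrow> ('o \<Rightarrow> 'm hist \<Rightarrow> real ^ 'm) \<Rightarrow> ('o \<Rightarrow> 'm hist) \<Rightarrow> bool" where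
  "equilibrium \<sigma> F c \<longleftrightarrow>
     (\<forall>\<omega>. \<forall>t\<ge>0. ereal t < lifetime \<sigma> F \<omega> (c \<omega>) \<and> u \<sigma> F t \<omega> (c \<omega>) = c (\<sigma> t \<omega>))"


section \<open>Regularity of the vector field and of the initial value\<close>

definition norm_continuous :: "('o::metric_space \<Rightarrow> 'm hist \<Rightarrow> real ^ 'm) \<Rightarrow> bool" where
  "norm_continuous F \<longleftrightarrow>
     (\<forall>\<omega>. \<forall>x\<in>BC. \<forall>\<epsilon>>0. \<exists>\<delta>>0. \<forall>\<omega>'. \<forall>x'\<in>BC.
        dist \<omega>' \<omega> < \<delta> \<and> supnorm (hist_diff x' x) < \<delta> \<longrightarrow> infnorm (F \<omega>' x' - F \<omega> x) < \<epsilon>)"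

text \<open>The Lipschitz constant on \<open>\<Omega> \<times> B\<^sub>r\<close> is uniform in \<open>\<omega>\<close> and refers to the supremum norm.\<close>

definition locally_lipschitz :: "('o \<Rightarrow> 'm hist \<Rightarrow> real ^ 'm) \<Rightarrow> bool" where
  "locally_lipschitz F \<longleftrightarrow>
     (\<forall>r>0. \<exists>L\<ge>0. \<forall>\<omega>. \<forall>x\<in>B r. \<forall>y\<in>B r. infnorm (F \<omega> x - F \<omega> y) \<le> L * supnorm (hist_diff x y))"

text \<open>The total variation is taken in the extended reals, so that it is finite exactly for functions of
  bounded variation.\<close>

definition total_variation :: "(real \<Rightarrow> real) \<Rightarrow> real \<Rightarrow> real \<Rightarrow> ereal" where
  "total_variation f a b =
     (SUP (n, p) \<in> {(n :: nat, p :: nat \<Rightarrow> real). p 0 = a \<and> p n = b \<and> (\<forall>i<n. p i \<le> p (Suc i))}.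
        ereal (\<Sum>i<n. \<bar>f (p (Suc i)) - f (p i)\<bar>))"

end

theory Submission
  imports Defs "HOL-Complex_Analysis.Great_Picard" "HOL-Real_Asymp.Real_Asymp"
begin

text \<open>Write \<open>D x = x' - A x\<close>; for bounded differentiable histories \<open>x \<le>\<^sub>A y\<close> means \<open>D x \<le> D y\<close>, so
  that infima and suprema for \<open>\<le>\<^sub>A\<close> are obtained by solving \<open>w' = A w + min (D x) (D y)\<close>. On entire
  bounded solutions \<open>D\<close> is continuous for the compact-open topology. Hence two close entire
  solutions have a common lower bound close to both, and the stability of ordered pairs becomes
  stability of all pairs. Bounded variation of the initial value provides such a lower bound also
  for the given trajectory: before time \<open>0\<close> it only has to exist, because its influence decays
  exponentially.

  A fibre-stable flow over a minimal base has fibres that depend lower semicontinuously on the base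
  point, and each of its points belongs to its own alpha-limit set. Let \<open>K\<close> be the alpha-limit set of
  a point of the omega-limit set. Its greatest lower bound \<open>c\<close> among the entire solutions is therefore
  a continuous equilibrium, and each component of \<open>x - c(\<omega>)\<close> either vanishes on all of \<open>K\<close> or is
  positive on all of \<open>K\<close>. In the second case the strict monotonicity of \<open>F\<close> gives a uniform gap between
  \<open>D x\<close> and \<open>D c\<close>, so entire solutions above \<open>c\<close> and close to it stay below \<open>K\<close> and equal \<open>c\<close>.
  Moving from \<open>c\<close> to a point of \<open>K\<close> in small steps, and starting the solutions ever earlier, shows that
  \<open>K\<close> is the graph of \<open>c\<close>. Stability then makes the trajectory converge to \<open>c\<close>.\<close>

section \<open>The metric space of histories\<close>

text \<open>The obstacle is that hypothesis (5) speaks of ordered pairs only, while the infimum or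
  supremum of two solutions is in general no solution and the balls \<open>B r\<close> are not
  compact. The way out is to use such histories only as initial values: a solution is started from
  one of them at time -n (or run forward to time n), and n tends to infinity. \<open>F\<close> is
  bounded on \<open>B r\<close>, so bounded solutions have bounded derivatives and Ascoli's theorem
  yields a limit that solves the equation on the whole line, while the order survives. The bounded
  entire solutions of a given size form a compact set on which time can be reversed, and all
  recurrence arguments take place there. The size is enlarged once, from R to R', because a lower
  bound of K found in this way may leave the original ball; (5), applied along a chain of small
  ordered steps, keeps it bounded. Stability acts forward in time only, which is why alpha-limit
  sets appear: one goes back to a time of closeness and returns with a small error.\<close>

lemma infnorm_le_iff: "infnorm (x :: real ^ 'm) \<le> c \<longleftrightarrow> (\<forall>i. \<bar>x $ i\<bar> \<le> c)"
proof
  assume "infnorm x \<le> c"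
  then show "\<forall>i. \<bar>x $ i\<bar> \<le> c"
    using component_le_infnorm_cart[of x] order_trans by blast
next
  assume "\<forall>i. \<bar>x $ i\<bar> \<le> c"
  then show "infnorm x \<le> c"
    unfolding infnorm_cart by (intro cSup_least) auto
qed

lemma norm_le_of_components:
  fixes x :: "real ^ 'm"
  assumes "\<And>i. \<bar>x $ i\<bar> \<le> c"
  shows "norm x \<le> real CARD('m) * c"
proof -
  have "norm x \<le> (\<Sum>i\<in>UNIV. \<bar>x $ i\<bar>)"
    by (rule norm_le_l1_cart)
  also have "\<dots> \<le> (\<Sum>i\<in>(UNIV :: 'm set). c)"
    by (intro sum_mono assms)
  finally show ?thesis
    by simp
qed

lemma seminorm_on_le_iff:
  "seminorm_on n (hist_diff x y) \<le> c \<longleftrightarrow>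
     (\<forall>s i. - real n \<le> s \<longrightarrow> s \<le> 0 \<longrightarrow> \<bar>hist_fun x s $ i - hist_fun y s $ i\<bar> \<le> c)"
proof -
  have "seminorm_on n (hist_diff x y) \<le> c \<longleftrightarrow> (\<forall>s\<in>{- real n..0}. infnorm (hist_diff x y s) \<le> c)"
    unfolding seminorm_on_def by (subst cSUP_le_iff[OF _ seminorm_on_bdd]) auto
  then show ?thesis
    by (auto simp: infnorm_le_iff hist_diff_def)
qed

lemma dist_hist_le:
  assumes "\<And>s i. s \<le> 0 \<Longrightarrow> \<bar>hist_fun x s $ i - hist_fun y s $ i\<bar> \<le> e"
  shows "dist x y \<le> e"
proof -
  have q: "seminorm_on (Suc n) (hist_diff x y) / (1 + seminorm_on (Suc n) (hist_diff x y)) \<le> e" for n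
  proof -
    let ?q = "seminorm_on (Suc n) (hist_diff x y)"
    have "?q \<le> e"
      unfolding seminorm_on_le_iff using assms by auto
    moreover have "?q / (1 + ?q) \<le> ?q"
      using seminorm_on_nonneg[of "Suc n" x y] by (simp add: divide_le_eq algebra_simps)
    ultimately show ?thesis by simp
  qed
  have s: "(\<lambda>n. (1 / 2) ^ Suc n * e) sums (1 * e)"
    using sums_mult2[OF power_half_series, of e] by simp
  have "dist x y \<le> (\<Sum>n. (1 / 2) ^ Suc n * e)"
    unfolding dist_hist_def
    by (intro suminf_le summable_dist_hist mult_left_mono q sums_summable[OF s]) auto
  then show ?thesis
    using sums_unique[OF s] by simp
qed

text \<open>The terms of index n and higher add up to at most \<open>(1 / 2) ^ n\<close> whatever
  the histories are, so a window [-N,0] chosen from e alone decides.\<close>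

lemma dist_hist_lessI:
  assumes "e > 0"
  shows "\<exists>N>0. \<exists>\<eta>>0. \<forall>x y :: 'm::finite hist.
    (\<forall>s i. - N \<le> s \<longrightarrow> s \<le> 0 \<longrightarrow> \<bar>hist_fun x s $ i - hist_fun y s $ i\<bar> \<le> \<eta>) \<longrightarrow> dist x y < e"
proof -
  obtain n where n: "(1 / 2 :: real) ^ n < e / 2"
    using real_arch_pow_inv[of "e / 2" "1 / 2"] assms by auto
  have "dist x y < e"
    if *: "\<forall>s i. - (real n + 1) \<le> s \<longrightarrow> s \<le> 0 \<longrightarrow> \<bar>hist_fun x s $ i - hist_fun y s $ i\<bar> \<le> e / 2"
    for x y :: "'m hist"
  proof -
    let ?q = "\<lambda>k. seminorm_on (Suc k) (hist_diff x y) / (1 + seminorm_on (Suc k) (hist_diff x y))"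
    let ?t = "\<lambda>k. (1 / 2) ^ Suc k * ?q k"
    have q0: "0 \<le> ?q k" "?q k \<le> 1" for k
      using seminorm_on_nonneg[of "Suc k" x y] by (auto simp: divide_le_eq)
    have q1: "?q k \<le> e / 2" if "k < n" for k
    proof -
      have "seminorm_on (Suc k) (hist_diff x y) \<le> e / 2"
        unfolding seminorm_on_le_iff using * that by auto
      moreover have "?q k \<le> seminorm_on (Suc k) (hist_diff x y)"
        using seminorm_on_nonneg[of "Suc k" x y] by (simp add: divide_le_eq algebra_simps)
      ultimately show ?thesis by (rule order_trans[rotated])
    qed
    have tail: "(\<lambda>k. (1 / 2 :: real) ^ Suc (k + n)) sums ((1 / 2) ^ n)"
      using sums_mult2[OF power_half_series, of "(1 / 2) ^ n"]
      unfolding power_add[symmetric] add_Suc mult_1 .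
    have "dist x y = (\<Sum>k. ?t (k + n)) + (\<Sum>k<n. ?t k)"
      unfolding dist_hist_def by (rule suminf_split_initial_segment[OF summable_dist_hist])
    also have "(\<Sum>k. ?t (k + n)) \<le> (\<Sum>k. (1 / 2) ^ Suc (k + n))"
    proof (intro suminf_le sums_summable[OF tail])
      show "summable (\<lambda>k. ?t (k + n))"
        using summable_dist_hist[of x y] by (rule summable_ignore_initial_segment)
      show "?t (k + n) \<le> (1 / 2) ^ Suc (k + n)" for k
        using q0[of "k + n"] by (intro mult_left_le) auto
    qed
    also have "\<dots> = (1 / 2) ^ n"
      using sums_unique[OF tail] by simp
    also have "(\<Sum>k<n. ?t k) \<le> (\<Sum>k<n. (1 / 2) ^ Suc k * (e / 2))"
      by (intro sum_mono mult_left_mono q1) auto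
    also have "\<dots> \<le> e / 2"
    proof -
      have "(\<Sum>k<n. (1 / 2 :: real) ^ Suc k) \<le> 1"
        using sum_le_suminf[OF sums_summable[OF power_half_series], of "{..<n}"]
          sums_unique[OF power_half_series] by simp
      then have "(\<Sum>k<n. (1 / 2 :: real) ^ Suc k) * (e / 2) \<le> 1 * (e / 2)"
        by (rule mult_right_mono) (use assms in auto)
      then show ?thesis
        by (simp only: sum_distrib_right mult_1)
    qed
    finally show ?thesis
      using n by simp
  qed
  then show ?thesis
    using assms by (intro exI[of _ "real n + 1"] exI[of _ "e / 2"] conjI) auto
qed

text \<open>A single term of the series suffices, because q / (1 + q) is increasing in q.\<close>

lemma close_of_dist_hist:
  assumes "e > 0"
  shows "\<exists>d>0. \<forall>x y :: 'm::finite hist. dist x y < d \<longrightarrow>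
    (\<forall>s i. - N \<le> s \<longrightarrow> s \<le> 0 \<longrightarrow> \<bar>hist_fun x s $ i - hist_fun y s $ i\<bar> < e)"
proof -
  obtain n where n: "N \<le> real n"
    using real_arch_simple by blast
  define d where "d = (1 / 2) ^ Suc n * (e / (1 + e))"
  have "\<bar>hist_fun x s $ i - hist_fun y s $ i\<bar> < e"
    if d: "dist x y < d" and s: "- N \<le> s" "s \<le> 0" for x y :: "'m hist" and s i
  proof -
    let ?q = "seminorm_on (Suc n) (hist_diff x y)"
    have nn: "0 \<le> ?q" by (rule seminorm_on_nonneg)
    have "(1 / 2) ^ Suc n * (?q / (1 + ?q)) \<le> dist x y"
      unfolding dist_hist_def
      using sum_le_suminf[OF summable_dist_hist[of x y], of "{n}"] seminorm_on_nonneg[of _ x y]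
      by (simp add: add_nonneg_nonneg)
    with d have "?q / (1 + ?q) < e / (1 + e)"
      unfolding d_def by (smt (verit) mult_less_cancel_left_pos zero_less_power half_gt_zero_iff)
    then have "?q < e"
      using nn assms by (simp add: field_simps)
    moreover have "\<bar>hist_fun x s $ i - hist_fun y s $ i\<bar> \<le> ?q"
      using seminorm_on_le_iff[of "Suc n" x y ?q] s n by auto
    ultimately show ?thesis by simp
  qed
  moreover have "d > 0" using assms by (simp add: d_def)
  ultimately show ?thesis by blast
qed

lemma tendsto_hist_iff:
  "(f \<longlongrightarrow> (x :: 'm::finite hist)) G \<longleftrightarrow>
     (\<forall>N e. e > 0 \<longrightarrow> (\<forall>\<^sub>F n in G. \<forall>s i. - N \<le> s \<longrightarrow> s \<le> 0 \<longrightarrow>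
        \<bar>hist_fun (f n) s $ i - hist_fun x s $ i\<bar> \<le> e))"
proof (intro iffI allI impI)
  fix N e :: real assume "(f \<longlongrightarrow> x) G" "e > 0"
  obtain d where "d > 0" and d: "\<And>x y :: 'm hist. dist x y < d \<longrightarrow>
    (\<forall>s i. - N \<le> s \<longrightarrow> s \<le> 0 \<longrightarrow> \<bar>hist_fun x s $ i - hist_fun y s $ i\<bar> < e)"
    using close_of_dist_hist[OF \<open>e > 0\<close>] by blast
  show "\<forall>\<^sub>F n in G. \<forall>s i. - N \<le> s \<longrightarrow> s \<le> 0 \<longrightarrow> \<bar>hist_fun (f n) s $ i - hist_fun x s $ i\<bar> \<le> e"
    using tendstoD[OF \<open>(f \<longlongrightarrow> x) G\<close> \<open>d > 0\<close>]
    by eventually_elim (use d less_imp_le in blast)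
next
  assume *: "\<forall>N e. e > 0 \<longrightarrow> (\<forall>\<^sub>F n in G. \<forall>s i. - N \<le> s \<longrightarrow> s \<le> 0 \<longrightarrow>
        \<bar>hist_fun (f n) s $ i - hist_fun x s $ i\<bar> \<le> e)"
  show "(f \<longlongrightarrow> x) G"
  proof (rule tendstoI)
    fix e :: real assume "e > 0"
    from dist_hist_lessI[OF this, where 'm = 'm] obtain N \<eta> where "N > 0" "\<eta> > 0" and
      N: "\<And>x y :: 'm hist. (\<forall>s i. - N \<le> s \<longrightarrow> s \<le> 0 \<longrightarrow>
        \<bar>hist_fun x s $ i - hist_fun y s $ i\<bar> \<le> \<eta>) \<longrightarrow> dist x y < e"
      by blast
    have "\<forall>\<^sub>F n in G. \<forall>s i. - N \<le> s \<longrightarrow> s \<le> 0 \<longrightarrow>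
        \<bar>hist_fun (f n) s $ i - hist_fun x s $ i\<bar> \<le> \<eta>"
      using * \<open>\<eta> > 0\<close> by blast
    then show "\<forall>\<^sub>F n in G. dist (f n) x < e"
      by eventually_elim (use N in blast)
  qed
qed

lemma tendsto_hist_component:
  assumes "(f \<longlongrightarrow> (x :: 'm::finite hist)) G" "s \<le> 0"
  shows "((\<lambda>n. hist_fun (f n) s $ i) \<longlongrightarrow> hist_fun x s $ i) G"
proof (rule tendstoI)
  fix e :: real assume "e > 0"
  then have "\<forall>\<^sub>F n in G. \<forall>s' i. s \<le> s' \<longrightarrow> s' \<le> 0 \<longrightarrow>
        \<bar>hist_fun (f n) s' $ i - hist_fun x s' $ i\<bar> \<le> e / 2"
    using assms(1)[unfolded tendsto_hist_iff, rule_format, of "e / 2" "- s"] by simp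
  then show "\<forall>\<^sub>F n in G. dist (hist_fun (f n) s $ i) (hist_fun x s $ i) < e"
  proof eventually_elim
    case (elim n)
    then have "\<bar>hist_fun (f n) s $ i - hist_fun x s $ i\<bar> \<le> e / 2"
      using \<open>s \<le> 0\<close> by blast
    then show ?case
      using \<open>e > 0\<close> unfolding dist_real_def by linarith
  qed
qed

lemma B_iff: "x \<in> B r \<longleftrightarrow> (\<forall>s i. s \<le> 0 \<longrightarrow> \<bar>hist_fun x s $ i\<bar> \<le> r)"
proof
  assume x: "x \<in> B r"
  then obtain b where b: "\<And>s. s \<le> 0 \<Longrightarrow> norm (hist_fun x s) \<le> b"
    by (auto simp: B_def BC_def bounded_iff)
  have "bdd_above ((\<lambda>s. infnorm (hist_fun x s)) ` {..0})"
    using b by (auto intro!: bdd_aboveI2[where M = b] order_trans[OF infnorm_le_norm])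
  then have "infnorm (hist_fun x s) \<le> r" if "s \<le> 0" for s
    using x that cSUP_upper[of s "{..0}" "\<lambda>s. infnorm (hist_fun x s)"]
    by (auto simp: B_def supnorm_def)
  then show "\<forall>s i. s \<le> 0 \<longrightarrow> \<bar>hist_fun x s $ i\<bar> \<le> r"
    by (auto simp: infnorm_le_iff)
next
  assume *: "\<forall>s i. s \<le> 0 \<longrightarrow> \<bar>hist_fun x s $ i\<bar> \<le> r"
  then have "bounded (hist_fun x ` {..0})"
    unfolding bounded_iff using norm_le_of_components[of "hist_fun x _" r] by blast
  moreover have "supnorm (hist_fun x) \<le> r"
    unfolding supnorm_def using * by (intro cSUP_least) (auto simp: infnorm_le_iff)
  ultimately show "x \<in> B r"
    by (simp add: B_def BC_def)
qed

lemma BC_iff: "x \<in> BC \<longleftrightarrow> (\<exists>r. x \<in> B r)"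
  by (auto simp: B_def)

lemma supnorm_diff_le:
  assumes "\<And>s i. s \<le> 0 \<Longrightarrow> \<bar>hist_fun x s $ i - hist_fun y s $ i\<bar> \<le> e"
  shows "supnorm (hist_diff x y) \<le> e"
  unfolding supnorm_def using assms
  by (intro cSUP_least) (auto simp: infnorm_le_iff hist_diff_def)

lemma Hist_inverse_restrict:
  assumes "continuous_on {..0} f" "s \<le> 0"
  shows "hist_fun (Hist (restrict f {..0})) s = f s"
proof -
  have "continuous_on {..0} (restrict f {..0})"
    using assms(1) by (rule continuous_on_eq) simp
  then show ?thesis
    using assms(2) by (simp add: Hist_inverse)
qed

lemma seg_cong: "(\<And>s. s \<le> t \<Longrightarrow> z s = z' s) \<Longrightarrow> seg t z = seg t z'"
  unfolding seg_def by (intro arg_cong[of _ _ Hist] restrict_ext) auto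

lemma seg_shift: "seg t (\<lambda>s. z (r + s)) = seg (r + t) z"
  unfolding seg_def by (simp add: add.assoc)

lemma seg_0_eq: "(\<And>s. s \<le> 0 \<Longrightarrow> z s = hist_fun x s) \<Longrightarrow> seg 0 z = x"
proof (rule hist_eqI)
  fix s :: real assume *: "\<And>s. s \<le> 0 \<Longrightarrow> z s = hist_fun x s" and "s \<le> 0"
  have "continuous_on {..0} z"
    using continuous_hist_fun by (rule continuous_on_eq) (simp add: *)
  then show "hist_fun (seg 0 z) s = hist_fun x s"
    using \<open>s \<le> 0\<close> * by (simp add: hist_fun_seg)
qed

lemma continuous_on_seg:
  fixes z :: "real \<Rightarrow> real ^ 'm"
  assumes z: "continuous_on UNIV z"
  shows "continuous_on UNIV (\<lambda>t. seg t z)"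
  unfolding continuous_on_def
proof (intro ballI)
  fix t :: real
  show "((\<lambda>t. seg t z) \<longlongrightarrow> seg t z) (at t within UNIV)"
    unfolding tendsto_hist_iff
  proof (intro allI impI)
    fix N e :: real assume e: "e > 0"
    have "uniformly_continuous_on {t - \<bar>N\<bar> - 1..t + 1} z"
      by (rule compact_uniformly_continuous[OF continuous_on_subset[OF z]]) auto
    then obtain d where d: "d > 0" "\<And>a b. a \<in> {t - \<bar>N\<bar> - 1..t + 1} \<Longrightarrow> b \<in> {t - \<bar>N\<bar> - 1..t + 1} \<Longrightarrow>
        dist a b < d \<Longrightarrow> dist (z a) (z b) < e"
      unfolding uniformly_continuous_on_def using e by metis
    have "\<forall>\<^sub>F r in at t within UNIV. dist r t < min d 1"
      using d(1) tendstoD[OF tendsto_ident_at, of "min d 1" t UNIV] by simp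
    then show "\<forall>\<^sub>F r in at t within UNIV. \<forall>s i. - N \<le> s \<longrightarrow> s \<le> 0 \<longrightarrow>
        \<bar>hist_fun (seg r z) s $ i - hist_fun (seg t z) s $ i\<bar> \<le> e"
    proof eventually_elim
      case (elim r)
      show ?case
      proof (intro allI impI)
        fix s i assume s: "- N \<le> s" "s \<le> (0 :: real)"
        have "dist (z (r + s)) (z (t + s)) < e"
          using elim s by (intro d(2)) (auto simp: dist_real_def)
        then have "norm (z (r + s) - z (t + s)) < e"
          by (simp add: dist_norm)
        then have "\<bar>(z (r + s) - z (t + s)) $ i\<bar> < e"
          using component_le_norm_cart[of "z (r + s) - z (t + s)" i] by linarith
        moreover have "hist_fun (seg r' z) s = z (r' + s)" for r'
          using s continuous_on_subset[OF z] by (simp add: hist_fun_seg)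
        ultimately show "\<bar>hist_fun (seg r z) s $ i - hist_fun (seg t z) s $ i\<bar> \<le> e"
          by simp
      qed
    qed
  qed
qed

section \<open>Scalar differential inequalities\<close>

text \<open>Integrating factor: \<open>exp (- a * r) * v r\<close> is nondecreasing in r.\<close>

lemma exp_growth:
  fixes v :: "real \<Rightarrow> real"
  assumes "s \<le> t" and v: "continuous_on {s..t} v"
    and d: "\<And>r. s < r \<Longrightarrow> r < t \<Longrightarrow> \<exists>D. (v has_real_derivative D) (at r) \<and> a * v r \<le> D"
  shows "exp (a * (t - s)) * v s \<le> v t"
proof -
  have "exp (- a * s) * v s \<le> exp (- a * t) * v t"
  proof (rule DERIV_nonneg_imp_increasing_open[OF \<open>s \<le> t\<close>])
    show "continuous_on {s..t} (\<lambda>r. exp (- a * r) * v r)"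
      by (intro continuous_intros v)
    fix r assume "s < r" "r < t"
    then obtain D where D: "(v has_real_derivative D) (at r)" "a * v r \<le> D"
      using d by blast
    have "((\<lambda>r. exp (- a * r) * v r) has_real_derivative
        exp (- a * r) * D + - a * exp (- a * r) * v r) (at r)"
      by (auto intro!: derivative_eq_intros D(1))
    moreover have "0 \<le> exp (- a * r) * (D - a * v r)"
      using D(2) by simp
    ultimately show "\<exists>y. ((\<lambda>r. exp (- a * r) * v r) has_real_derivative y) (at r) \<and> 0 \<le> y"
      by (intro exI conjI) (assumption, simp add: algebra_simps)
  qed
  then have "exp (a * t) * (exp (- a * s) * v s) \<le> exp (a * t) * (exp (- a * t) * v t)"
    by (rule mult_left_mono) simp
  moreover have "exp (a * t) * exp (- a * s) = exp (a * (t - s))" "exp (a * t) * exp (- a * t) = 1"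
    by (simp_all add: exp_add[symmetric] algebra_simps)
  ultimately show ?thesis
    by (simp only: mult.assoc[symmetric] mult_1)
qed

text \<open>Both w and - w are compared with \<open>C / k * exp (k * r)\<close>, a primitive of the
  bound on the derivative. The gain 1 / k is what makes the halving argument below contract for
  large k.\<close>

lemma exp_derivative_bound:
  fixes w :: "real \<Rightarrow> real"
  assumes k: "k > 0" and "b \<le> T" and w: "continuous_on {b..T} w" "w b = 0" and "C \<ge> 0"
    and d: "\<And>r. b < r \<Longrightarrow> r < T \<Longrightarrow> \<exists>D. (w has_real_derivative D) (at r) \<and> \<bar>D\<bar> \<le> C * exp (k * r)"
    and s: "b \<le> s" "s \<le> T"
  shows "\<bar>w s\<bar> \<le> C / k * exp (k * s)"
proof -
  have bound: "\<epsilon> * w s \<le> C / k * exp (k * s)" if e: "\<bar>\<epsilon>\<bar> = 1" for \<epsilon> :: real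
  proof -
    have "C / k * exp (k * b) - \<epsilon> * w b \<le> C / k * exp (k * s) - \<epsilon> * w s"
    proof (rule DERIV_nonneg_imp_increasing_open[OF s(1)])
      show "continuous_on {b..s} (\<lambda>r. C / k * exp (k * r) - \<epsilon> * w r)"
        using s by (intro continuous_intros continuous_on_subset[OF w(1)]) auto
      fix r assume r: "b < r" "r < s"
      then obtain D where D: "(w has_real_derivative D) (at r)" "\<bar>D\<bar> \<le> C * exp (k * r)"
        using d[of r] s by auto
      have "((\<lambda>r. C / k * exp (k * r) - \<epsilon> * w r) has_real_derivative
          C / k * (k * exp (k * r)) - \<epsilon> * D) (at r)"
        by (auto intro!: derivative_eq_intros D(1))
      moreover have "\<epsilon> * D \<le> C * exp (k * r)"
        using abs_le_D1[of "\<epsilon> * D"] D(2) e by (simp add: abs_mult)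
      ultimately show "\<exists>y. ((\<lambda>r. C / k * exp (k * r) - \<epsilon> * w r) has_real_derivative y) (at r) \<and> 0 \<le> y"
        using k by (intro exI conjI) (assumption, simp)
    qed
    moreover have "0 \<le> C / k * exp (k * b)"
      using k \<open>C \<ge> 0\<close> by simp
    ultimately show ?thesis
      using w(2) by simp
  qed
  show ?thesis
    using bound[of 1] bound[of "-1"] by (auto simp: abs_le_iff)
qed

text \<open>Replaces Gronwall's inequality: for large \<open>k\<close> an integral inequality halves the constant
  in an exponential bound, so that the constant can be taken to be zero.\<close>

lemma zero_by_halving:
  fixes w :: "real \<Rightarrow> 'i::finite \<Rightarrow> real"
  assumes c: "\<And>i. continuous_on {b..T} (\<lambda>s. w s i)"
    and step: "\<And>M. M \<ge> 0 \<Longrightarrow> (\<And>s i. b \<le> s \<Longrightarrow> s \<le> T \<Longrightarrow> \<bar>w s i\<bar> \<le> M * exp (k * s)) \<Longrightarrow>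
      (\<And>s i. b \<le> s \<Longrightarrow> s \<le> T \<Longrightarrow> \<bar>w s i\<bar> \<le> M / 2 * exp (k * s))"
    and s: "b \<le> s" "s \<le> T"
  shows "w s i = 0"
proof -
  have "\<exists>M. \<forall>s\<in>{b..T}. \<bar>w s i * exp (- (k * s))\<bar> \<le> M" for i
  proof -
    have "bounded ((\<lambda>s. w s i * exp (- (k * s))) ` {b..T})"
      by (intro compact_imp_bounded compact_continuous_image continuous_intros c) auto
    then show ?thesis
      by (auto simp: bounded_iff)
  qed
  then obtain M where M: "\<And>i s. s \<in> {b..T} \<Longrightarrow> \<bar>w s i * exp (- (k * s))\<bar> \<le> M i"
    by metis
  define M0 where "M0 = (\<Sum>i\<in>UNIV. \<bar>M i\<bar>)"
  have M0: "\<bar>w s i\<bar> \<le> M0 * exp (k * s)" if "b \<le> s" "s \<le> T" for s i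
  proof -
    have "\<bar>w s i * exp (- (k * s))\<bar> \<le> \<bar>M i\<bar>"
      using M[of s i] that by auto
    also have "\<dots> \<le> M0"
      unfolding M0_def by (rule member_le_sum) auto
    finally show ?thesis
      by (simp add: abs_mult exp_minus field_simps)
  qed
  have "0 \<le> M0 / 2 ^ n \<and> (\<forall>s i. b \<le> s \<longrightarrow> s \<le> T \<longrightarrow> \<bar>w s i\<bar> \<le> M0 / 2 ^ n * exp (k * s))" for n
  proof (induction n)
    case 0
    then show ?case
      using M0 by (auto simp: M0_def sum_nonneg)
  next
    case (Suc n)
    then show ?case
      using step[of "M0 / 2 ^ n"] by (auto simp: field_simps)
  qed
  then have "\<bar>w s i\<bar> \<le> M0 / 2 ^ n * exp (k * s)" for n
    using s by blast
  moreover have "(\<lambda>n. M0 / 2 ^ n * exp (k * s)) \<longlonglongrightarrow> 0"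
    by real_asymp
  ultimately have "\<bar>w s i\<bar> \<le> 0"
    by (intro LIMSEQ_le_const) auto
  then show ?thesis by simp
qed

section \<open>The exponential order for a diagonal matrix\<close>

locale diagonal_matrix =
  fixes A :: "real ^ 'm ^ 'm"
  assumes A_diagonal: "\<And>i j. i \<noteq> j \<Longrightarrow> A $ i $ j = 0"
    and A_negative: "\<And>i. A $ i $ i < 0"
begin

lemma A_mult_component: "(A *v v) $ i = A $ i $ i * v $ i"
proof -
  have "(\<Sum>j\<in>UNIV. A $ i $ j * v $ j) = (\<Sum>j\<in>UNIV. if j = i then A $ i $ i * v $ i else 0)"
    using A_diagonal by (intro sum.cong) auto
  then show ?thesis
    by (simp add: matrix_vector_mult_def)
qed

lemma mat_exp_mult_component: "(mat_exp (t *\<^sub>R A) *v v) $ i = exp (t * A $ i $ i) * v $ i"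
proof -
  have "(\<Sum>j\<in>UNIV. (if i = j then exp (t * A $ i $ i) else 0) * v $ j) =
      (\<Sum>j\<in>UNIV. if j = i then exp (t * A $ i $ i) * v $ i else 0)"
    by (intro sum.cong) auto
  then show ?thesis
    using A_diagonal by (subst mat_exp_diagonal) (simp_all add: matrix_vector_mult_def cong: if_cong)
qed

lemma le_A_iff:
  "le_A A x y \<longleftrightarrow> (\<forall>i. (\<forall>s\<le>0. hist_fun x s $ i \<le> hist_fun y s $ i) \<and>
     (\<forall>s t. s \<le> t \<longrightarrow> t \<le> 0 \<longrightarrow>
        exp (A $ i $ i * (t - s)) * (hist_fun y s $ i - hist_fun x s $ i) \<le>
        hist_fun y t $ i - hist_fun x t $ i))"
  unfolding le_A_def
  by (auto simp: less_eq_vec_def mat_exp_mult_component mult.commute)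

lemma le_A_ge: "le_A A x y \<Longrightarrow> s \<le> 0 \<Longrightarrow> hist_fun x s $ i \<le> hist_fun y s $ i"
  by (simp add: le_A_iff)

lemma le_A_exp: "le_A A x y \<Longrightarrow> s \<le> t \<Longrightarrow> t \<le> 0 \<Longrightarrow>
    exp (A $ i $ i * (t - s)) * (hist_fun y s $ i - hist_fun x s $ i) \<le>
      hist_fun y t $ i - hist_fun x t $ i"
  by (simp add: le_A_iff)

lemma le_A_refl: "le_A A x x"
  by (simp add: le_A_iff)

lemma le_A_trans: "le_A A x y \<Longrightarrow> le_A A y z \<Longrightarrow> le_A A x z"
  unfolding le_A_iff
proof (intro allI conjI impI)
  fix i and s :: real
  assume *: "\<forall>i. (\<forall>s\<le>0. hist_fun x s $ i \<le> hist_fun y s $ i) \<and>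
     (\<forall>s t. s \<le> t \<longrightarrow> t \<le> 0 \<longrightarrow>
        exp (A $ i $ i * (t - s)) * (hist_fun y s $ i - hist_fun x s $ i) \<le>
        hist_fun y t $ i - hist_fun x t $ i)"
    "\<forall>i. (\<forall>s\<le>0. hist_fun y s $ i \<le> hist_fun z s $ i) \<and>
     (\<forall>s t. s \<le> t \<longrightarrow> t \<le> 0 \<longrightarrow>
        exp (A $ i $ i * (t - s)) * (hist_fun z s $ i - hist_fun y s $ i) \<le>
        hist_fun z t $ i - hist_fun y t $ i)"
  show "hist_fun x s $ i \<le> hist_fun z s $ i" if "s \<le> 0"
    using * that order_trans by blast
  show "exp (A $ i $ i * (t - s)) * (hist_fun z s $ i - hist_fun x s $ i) \<le>
        hist_fun z t $ i - hist_fun x t $ i" if "s \<le> t" "t \<le> 0" for t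
    using *(1)[rule_format, of i, THEN conjunct2, rule_format, OF that]
      *(2)[rule_format, of i, THEN conjunct2, rule_format, OF that]
    by (simp add: algebra_simps)
qed

text \<open>For bounded histories the pointwise inequality follows from the exponential one, since
  \<open>exp (A $ i $ i * (t - s))\<close> tends to \<open>0\<close> as \<open>s\<close> tends to \<open>-\<infinity>\<close>.\<close>

lemma le_A_I:
  assumes "x \<in> B r" "y \<in> B r'"
    and e: "\<And>i s t. s \<le> t \<Longrightarrow> t \<le> 0 \<Longrightarrow>
      exp (A $ i $ i * (t - s)) * (hist_fun y s $ i - hist_fun x s $ i) \<le>
        hist_fun y t $ i - hist_fun x t $ i"
  shows "le_A A x y"
proof -
  have "hist_fun x t $ i \<le> hist_fun y t $ i" if t: "t \<le> 0" for t i
  proof -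
    have "(\<lambda>n. exp (A $ i $ i * (t - (t - real n))) * (- r - r')) \<longlonglongrightarrow> 0"
      using A_negative[of i] by real_asymp
    moreover have "exp (A $ i $ i * (t - (t - real n))) * (- r - r') \<le> hist_fun y t $ i - hist_fun x t $ i" for n
    proof -
      have "exp (A $ i $ i * (t - (t - real n))) * (- r - r') \<le>
          exp (A $ i $ i * (t - (t - real n))) * (hist_fun y (t - real n) $ i - hist_fun x (t - real n) $ i)"
        using assms(1,2)[unfolded B_iff, rule_format, of "t - real n" i] t
        by (intro mult_left_mono) auto
      also have "\<dots> \<le> hist_fun y t $ i - hist_fun x t $ i"
        using t by (intro e) auto
      finally show ?thesis .
    qed
    ultimately have "0 \<le> hist_fun y t $ i - hist_fun x t $ i"
      by (intro LIMSEQ_le_const2) auto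
    then show ?thesis by simp
  qed
  with e show ?thesis
    by (simp add: le_A_iff)
qed

text \<open>Each inequality in the order involves values at no more than two times, so the order is
  closed under convergence on compact intervals.\<close>

lemma le_A_limit:
  assumes f: "(f \<longlongrightarrow> x) G" and g: "(g \<longlongrightarrow> y) G" and "G \<noteq> bot"
    and le: "\<forall>\<^sub>F n in G. le_A A (f n) (g n)"
  shows "le_A A x y"
  unfolding le_A_iff
proof (intro allI conjI impI)
  fix i and s :: real
  show "hist_fun x s $ i \<le> hist_fun y s $ i" if "s \<le> 0"
    using \<open>G \<noteq> bot\<close> tendsto_hist_component[OF g that] tendsto_hist_component[OF f that]
    by (rule tendsto_le) (use le in eventually_elim, use that in \<open>simp add: le_A_iff\<close>)
  fix t assume st: "s \<le> t" "t \<le> 0"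
  then have "s \<le> 0" by simp
  show "exp (A $ i $ i * (t - s)) * (hist_fun y s $ i - hist_fun x s $ i) \<le>
        hist_fun y t $ i - hist_fun x t $ i"
  proof (rule tendsto_le[OF \<open>G \<noteq> bot\<close>])
    show "((\<lambda>n. hist_fun (g n) t $ i - hist_fun (f n) t $ i) \<longlongrightarrow> hist_fun y t $ i - hist_fun x t $ i) G"
      by (intro tendsto_intros tendsto_hist_component[OF g] tendsto_hist_component[OF f] st)
    show "((\<lambda>n. exp (A $ i $ i * (t - s)) * (hist_fun (g n) s $ i - hist_fun (f n) s $ i)) \<longlongrightarrow>
        exp (A $ i $ i * (t - s)) * (hist_fun y s $ i - hist_fun x s $ i)) G"
      by (intro tendsto_intros tendsto_hist_component[OF g] tendsto_hist_component[OF f] \<open>s \<le> 0\<close>)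
    show "\<forall>\<^sub>F n in G. exp (A $ i $ i * (t - s)) * (hist_fun (g n) s $ i - hist_fun (f n) s $ i) \<le>
        hist_fun (g n) t $ i - hist_fun (f n) t $ i"
      using le by eventually_elim (use st in \<open>simp add: le_A_iff\<close>)
  qed
qed

end

section \<open>Solutions of the delay equation\<close>

lemma has_vector_derivative_component:
  fixes z :: "real \<Rightarrow> real ^ 'n"
  shows "(z has_vector_derivative D) (at t) \<Longrightarrow> ((\<lambda>t. z t $ i) has_real_derivative D $ i) (at t)"
  unfolding has_real_derivative_iff_has_vector_derivative
  by (rule bounded_linear.has_vector_derivative[OF bounded_linear_vec_nth])

definition const_hist :: "real \<Rightarrow> 'm::finite hist" where
  "const_hist c = Hist (restrict (\<lambda>_. \<chi> i. c) {..0})"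

lemma hist_fun_const_hist [simp]: "s \<le> 0 \<Longrightarrow> hist_fun (const_hist c) s = (\<chi> i. c)"
  unfolding const_hist_def by (rule Hist_inverse_restrict) auto

lemma const_hist_in_B: "\<bar>c\<bar> \<le> r \<Longrightarrow> const_hist c \<in> B r"
  by (simp add: B_iff)

lemma in_BC_E:
  assumes "x \<in> BC" obtains r where "x \<in> B r"
  using assms BC_iff by metis

lemma B_imp_BC: "x \<in> B r \<Longrightarrow> x \<in> BC"
  using BC_iff by metis

lemma B_mono: "x \<in> B r \<Longrightarrow> r \<le> r' \<Longrightarrow> x \<in> B r'"
  unfolding B_iff by (meson order_trans)

lemma seg_in_B:
  assumes "continuous_on {..t} z" "\<And>s i. s \<le> t \<Longrightarrow> \<bar>z s $ i\<bar> \<le> r"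
  shows "seg t z \<in> B r"
  using assms by (auto simp: B_iff hist_fun_seg)

locale delay_system = diagonal_matrix A for A :: "real ^ 'm ^ 'm" +
  fixes \<sigma> :: "real \<Rightarrow> 'o::metric_space \<Rightarrow> 'o"
    and F :: "'o \<Rightarrow> 'm hist \<Rightarrow> real ^ 'm"
  assumes compact_base: "compact (UNIV :: 'o set)"
    and minimal: "minimal_flow \<sigma>"
    and lipschitz: "locally_lipschitz F"
    and F_continuous: "\<And>r. r > 0 \<Longrightarrow> continuous_on (UNIV \<times> B r) (\<lambda>(\<omega>, x). F \<omega> x)"
    and F_monotone: "\<And>\<omega> x y. x \<in> BC \<Longrightarrow> y \<in> BC \<Longrightarrow> le_A A x y \<Longrightarrow>
          F \<omega> y - F \<omega> x \<ge> A *v (hist_fun y 0 - hist_fun x 0)"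
    and F_strict: "\<And>\<omega> x y J. x \<in> BC \<Longrightarrow> y \<in> BC \<Longrightarrow>
          backward_extension \<sigma> F \<omega> x \<Longrightarrow> backward_extension \<sigma> F \<omega> y \<Longrightarrow> le_A A x y \<Longrightarrow>
          (\<forall>i. i \<notin> J \<longrightarrow> (\<forall>s\<le>0. hist_fun x s $ i = hist_fun y s $ i)) \<Longrightarrow>
          (\<forall>i\<in>J. \<forall>s\<le>0. hist_fun x s $ i < hist_fun y s $ i) \<Longrightarrow>
          (\<forall>i\<in>J. F \<omega> y $ i - F \<omega> x $ i - (A *v (hist_fun y 0 - hist_fun x 0)) $ i > 0)"
    and stable: "\<And>k :: nat. uniformly_stable \<sigma> F A (B (real k))"
begin

abbreviation "sol \<equiv> solution \<sigma> F"

lemma flow_0 [simp]: "\<sigma> 0 \<omega> = \<omega>"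
  and flow_add: "\<sigma> (s + t) \<omega> = \<sigma> s (\<sigma> t \<omega>)"
  and flow_continuous: "continuous_on UNIV (\<lambda>(t, \<omega>). \<sigma> t \<omega>)"
  using minimal by (auto simp: minimal_flow_def continuous_flow_def)

lemma flow_tendsto [tendsto_intros]:
  assumes "(f \<longlongrightarrow> t) G" "(g \<longlongrightarrow> \<omega>) G"
  shows "((\<lambda>n. \<sigma> (f n) (g n)) \<longlongrightarrow> \<sigma> t \<omega>) G"
  using continuous_on_tendsto_compose[OF flow_continuous tendsto_Pair[OF assms]] by simp

lemma flow_cancel [simp]: "\<sigma> (- t) (\<sigma> t \<omega>) = \<omega>" "\<sigma> t (\<sigma> (- t) \<omega>) = \<omega>"
  using flow_add[of "- t" t \<omega>] flow_add[of t "- t" \<omega>] by auto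

lemma F_lipschitz:
  assumes "r > 0"
  obtains L where "L \<ge> 0" "\<And>\<omega> x y e i. x \<in> B r \<Longrightarrow> y \<in> B r \<Longrightarrow>
    (\<And>s i. s \<le> 0 \<Longrightarrow> \<bar>hist_fun x s $ i - hist_fun y s $ i\<bar> \<le> e) \<Longrightarrow> \<bar>F \<omega> x $ i - F \<omega> y $ i\<bar> \<le> L * e"
proof -
  obtain L where L: "L \<ge> 0" "\<And>\<omega> x y. x \<in> B r \<Longrightarrow> y \<in> B r \<Longrightarrow>
      infnorm (F \<omega> x - F \<omega> y) \<le> L * supnorm (hist_diff x y)"
    using lipschitz[unfolded locally_lipschitz_def, rule_format, OF assms] by metis
  have "\<bar>F \<omega> x $ i - F \<omega> y $ i\<bar> \<le> L * e"
    if "x \<in> B r" "y \<in> B r" "\<And>s i. s \<le> 0 \<Longrightarrow> \<bar>hist_fun x s $ i - hist_fun y s $ i\<bar> \<le> e" for \<omega> x y e i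
  proof -
    have "\<bar>(F \<omega> x - F \<omega> y) $ i\<bar> \<le> L * supnorm (hist_diff x y)"
      using L(2)[OF that(1,2)] unfolding infnorm_le_iff by blast
    also have "\<dots> \<le> L * e"
      using L(1) supnorm_diff_le[OF that(3)] by (intro mult_left_mono) auto
    finally show ?thesis by simp
  qed
  with L(1) that show ?thesis by blast
qed

lemma F_tendsto:
  assumes "r > 0" "(g \<longlongrightarrow> \<omega>) G" "(f \<longlongrightarrow> x) G" "x \<in> B r" "\<forall>\<^sub>F n in G. f n \<in> B r"
  shows "((\<lambda>n. F (g n) (f n)) \<longlongrightarrow> F \<omega> x) G"
  using continuous_on_tendsto_compose[OF F_continuous[OF assms(1)] tendsto_Pair[OF assms(2,3)]] assms(4,5)
  by simp

text \<open>Compactness of the base bounds F at the zero history; the Lipschitz estimate carries the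
  bound over \<open>B r\<close>, which itself is not compact.\<close>

lemma F_bounded:
  assumes "r > 0"
  obtains M where "M > 0" "\<And>\<omega> x i. x \<in> B r \<Longrightarrow> \<bar>F \<omega> x $ i\<bar> \<le> M"
proof -
  obtain L where L: "L \<ge> 0" "\<And>\<omega> x y e i. x \<in> B r \<Longrightarrow> y \<in> B r \<Longrightarrow>
    (\<And>s i. s \<le> 0 \<Longrightarrow> \<bar>hist_fun x s $ i - hist_fun y s $ i\<bar> \<le> e) \<Longrightarrow> \<bar>F \<omega> x $ i - F \<omega> y $ i\<bar> \<le> L * e"
    by (rule F_lipschitz[OF assms]) blast
  have z: "const_hist 0 \<in> B r"
    using assms by (intro const_hist_in_B) auto
  have "continuous_on UNIV (\<lambda>\<omega>. F \<omega> (const_hist 0))"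
    unfolding continuous_on_def by (intro ballI F_tendsto[OF assms] tendsto_intros z) (simp add: z)
  then have "bounded ((\<lambda>\<omega>. F \<omega> (const_hist 0)) ` UNIV)"
    by (intro compact_imp_bounded compact_continuous_image compact_base)
  then obtain b where b: "norm (F \<omega> (const_hist 0)) \<le> b" for \<omega>
    by (auto simp: bounded_iff)
  have "\<bar>F \<omega> x $ i\<bar> \<le> L * r + \<bar>b\<bar> + 1" if "x \<in> B r" for \<omega> x i
  proof -
    have "\<bar>F \<omega> x $ i - F \<omega> (const_hist 0) $ i\<bar> \<le> L * r"
      using that by (intro L(2) z) (auto simp: B_iff)
    moreover have "\<bar>F \<omega> (const_hist 0) $ i\<bar> \<le> b"
      using component_le_norm_cart[of "F \<omega> (const_hist 0)" i] b[of \<omega>] by linarith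
    ultimately show ?thesis by linarith
  qed
  moreover have "L * r + \<bar>b\<bar> + 1 > 0"
    using L(1) assms by (intro add_nonneg_pos add_nonneg_nonneg) auto
  ultimately show ?thesis using that by blast
qed

text \<open>For \<open>b = 0\<close> continuity of \<open>z\<close> replaces the one-sided derivative at \<open>0\<close>.\<close>

definition evolves :: "real \<Rightarrow> 'o \<Rightarrow> (real \<Rightarrow> real ^ 'm) \<Rightarrow> bool" where
  "evolves b \<omega> z \<longleftrightarrow> continuous_on UNIV z \<and>
     (\<forall>t>b. (z has_vector_derivative F (\<sigma> t \<omega>) (seg t z)) (at t))"

lemma evolves_continuous: "evolves b \<omega> z \<Longrightarrow> continuous_on S z"
  unfolding evolves_def by (blast intro: continuous_on_subset)

lemma hist_fun_seg_evolves [simp]: "evolves b \<omega> z \<Longrightarrow> s \<le> 0 \<Longrightarrow> hist_fun (seg t z) s = z (t + s)"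
  by (intro hist_fun_seg evolves_continuous)

lemma evolves_derivative:
  "evolves b \<omega> z \<Longrightarrow> t > b \<Longrightarrow> ((\<lambda>t. z t $ i) has_real_derivative F (\<sigma> t \<omega>) (seg t z) $ i) (at t)"
  unfolding evolves_def by (blast intro: has_vector_derivative_component)

lemma evolves_shift:
  assumes "evolves b \<omega> z"
  shows "evolves (b - s) (\<sigma> s \<omega>) (\<lambda>t. z (s + t))"
  unfolding evolves_def
proof (intro conjI allI impI)
  show "continuous_on UNIV (\<lambda>t. z (s + t))"
    using assms by (intro continuous_on_compose2[OF evolves_continuous[OF assms, of UNIV]] continuous_intros) auto
  fix t assume "b - s < t"
  then have "(z has_vector_derivative F (\<sigma> (s + t) \<omega>) (seg (s + t) z)) (at (s + t))"
    using assms by (simp add: evolves_def)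
  moreover have "((\<lambda>t. s + t) has_real_derivative 1) (at t)"
    by (auto intro!: derivative_eq_intros)
  ultimately have "(z \<circ> (\<lambda>t. s + t) has_vector_derivative 1 *\<^sub>R F (\<sigma> (s + t) \<omega>) (seg (s + t) z)) (at t)"
    by (intro vector_diff_chain_at) (auto simp: has_real_derivative_iff_has_vector_derivative)
  then show "((\<lambda>t. z (s + t)) has_vector_derivative F (\<sigma> t (\<sigma> s \<omega>)) (seg t (\<lambda>t. z (s + t)))) (at t)"
    by (simp add: o_def seg_shift flow_add[symmetric] add.commute[of t s])
qed

lemma evolves_mono: "evolves b \<omega> z \<Longrightarrow> b \<le> b' \<Longrightarrow> evolves b' \<omega> z"
  unfolding evolves_def by auto

lemma bounded_upto:
  fixes z :: "real \<Rightarrow> real ^ 'm"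
  assumes c: "continuous_on {..T} z" and r: "\<And>s i. s \<le> b \<Longrightarrow> \<bar>z s $ i\<bar> \<le> r"
  shows "\<exists>r'. \<forall>s i. s \<le> T \<longrightarrow> \<bar>z s $ i\<bar> \<le> r'"
proof -
  have "bounded (z ` {b..T})"
    by (intro compact_imp_bounded compact_continuous_image continuous_on_subset[OF c]) auto
  then obtain r1 where r1: "\<And>s. s \<in> {b..T} \<Longrightarrow> norm (z s) \<le> r1"
    unfolding bounded_iff by (metis imageI)
  have "\<bar>z s $ i\<bar> \<le> \<bar>r1\<bar> + \<bar>r\<bar>" if "s \<le> T" for s i
  proof (cases "s \<le> b")
    case True
    then show ?thesis using r[of s i] by linarith
  next
    case False
    then show ?thesis
      using r1[of s] component_le_norm_cart[of "z s" i] that by auto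
  qed
  then show ?thesis by blast
qed

lemma unique_upto:
  fixes z z' :: "real \<Rightarrow> real ^ 'm"
  assumes c: "continuous_on {..T} z" "continuous_on {..T} z'"
    and eq: "\<And>s. s \<le> b \<Longrightarrow> z s = z' s"
    and bd: "\<And>s i. s \<le> b \<Longrightarrow> \<bar>z s $ i\<bar> \<le> r"
    and d: "\<And>t. b < t \<Longrightarrow> t < T \<Longrightarrow> (z has_vector_derivative F (\<sigma> t \<omega>) (seg t z)) (at t)"
    and d': "\<And>t. b < t \<Longrightarrow> t < T \<Longrightarrow> (z' has_vector_derivative F (\<sigma> t \<omega>) (seg t z')) (at t)"
    and t: "t \<le> T"
  shows "z t = z' t"
proof (cases "t \<le> b")
  case False
  obtain r1 where r1: "\<And>s i. s \<le> T \<Longrightarrow> \<bar>z s $ i\<bar> \<le> r1"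
    using bounded_upto[OF c(1) bd] by blast
  obtain r2 where r2: "\<And>s i. s \<le> T \<Longrightarrow> \<bar>z' s $ i\<bar> \<le> r2"
    using bounded_upto[OF c(2), of b r] bd eq by metis
  define R where "R = \<bar>r1\<bar> + \<bar>r2\<bar> + 1"
  have R: "seg s z \<in> B R" "seg s z' \<in> B R" if "s \<le> T" for s
  proof -
    have "\<bar>z s' $ i\<bar> \<le> R" "\<bar>z' s' $ i\<bar> \<le> R" if "s' \<le> s" for s' i
      using r1[of s' i] r2[of s' i] \<open>s \<le> T\<close> that unfolding R_def by linarith+
    then show "seg s z \<in> B R" "seg s z' \<in> B R"
      using that by (auto intro!: seg_in_B continuous_on_subset[OF c(1)] continuous_on_subset[OF c(2)])
  qed
  have "R > 0" by (simp add: R_def)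
  obtain L where L: "L \<ge> 0" "\<And>\<omega> x y e i. x \<in> B R \<Longrightarrow> y \<in> B R \<Longrightarrow>
    (\<And>s i. s \<le> 0 \<Longrightarrow> \<bar>hist_fun x s $ i - hist_fun y s $ i\<bar> \<le> e) \<Longrightarrow> \<bar>F \<omega> x $ i - F \<omega> y $ i\<bar> \<le> L * e"
    by (rule F_lipschitz[OF \<open>R > 0\<close>]) blast
  \<comment> \<open>With this k, integrating the Lipschitz estimate multiplies the constant by L / k
    \<le> 1 / 2, as \<open>zero_by_halving\<close> requires.\<close>
  define k where "k = 2 * L + 1"
  define w where "w = (\<lambda>s i. z s $ i - z' s $ i)"
  have k: "k > 0" "L / k \<le> 1 / 2"
    using L(1) by (auto simp: k_def field_simps)
  have cw: "continuous_on {b..T} (\<lambda>s. w s i)" for i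
    unfolding w_def
    by (intro continuous_intros continuous_on_subset[OF c(1)] continuous_on_subset[OF c(2)]) auto
  have "w t i = 0" for i
  proof (rule zero_by_halving[of b T w k])
    fix M s i assume M: "M \<ge> 0" and s: "b \<le> s" "s \<le> T"
      and bound: "\<And>s i. b \<le> s \<Longrightarrow> s \<le> T \<Longrightarrow> \<bar>w s i\<bar> \<le> M * exp (k * s)"
    have "\<bar>w s i\<bar> \<le> L * M / k * exp (k * s)"
    proof (rule exp_derivative_bound[OF k(1) _ cw])
      show "b \<le> T" "w b i = 0" "0 \<le> L * M" "b \<le> s" "s \<le> T"
        using s eq M L(1) by (auto simp: w_def)
      fix r assume r: "b < r" "r < T"
      have "((\<lambda>s. w s i) has_real_derivative
          F (\<sigma> r \<omega>) (seg r z) $ i - F (\<sigma> r \<omega>) (seg r z') $ i) (at r)"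
        unfolding w_def
        by (intro DERIV_diff has_vector_derivative_component d d' r)
      moreover have "\<bar>F (\<sigma> r \<omega>) (seg r z) $ i - F (\<sigma> r \<omega>) (seg r z') $ i\<bar> \<le> L * (M * exp (k * r))"
      proof (rule L(2))
        fix s i assume "s \<le> (0 :: real)"
        have "hist_fun (seg r z) s = z (r + s)" "hist_fun (seg r z') s = z' (r + s)"
          using r \<open>s \<le> 0\<close> by (auto intro!: hist_fun_seg continuous_on_subset[OF c(1)] continuous_on_subset[OF c(2)])
        \<comment> \<open>The weight increases with time, so its value at the current time bounds
          the difference over the whole past.\<close>
        moreover have "\<bar>w (r + s) i\<bar> \<le> M * exp (k * r)"
        proof (cases "r + s \<le> b")
          case True
          then show ?thesis using M eq by (simp add: w_def)
        next
          case False
          then have "\<bar>w (r + s) i\<bar> \<le> M * exp (k * (r + s))"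
            using bound r \<open>s \<le> 0\<close> by simp
          also have "\<dots> \<le> M * exp (k * r)"
            using M k \<open>s \<le> 0\<close> by (intro mult_left_mono) auto
          finally show ?thesis .
        qed
        ultimately show "\<bar>hist_fun (seg r z) s $ i - hist_fun (seg r z') s $ i\<bar> \<le> M * exp (k * r)"
          by (simp add: w_def)
      qed (use R r in auto)
      ultimately show "\<exists>D. ((\<lambda>s. w s i) has_real_derivative D) (at r) \<and> \<bar>D\<bar> \<le> L * M * exp (k * r)"
        by (auto simp: mult.assoc)
    qed
    also have "L * M / k * exp (k * s) = L / k * (M * exp (k * s))"
      by simp
    also have "\<dots> \<le> 1 / 2 * (M * exp (k * s))"
      using M by (intro mult_right_mono k) auto
    finally show "\<bar>w s i\<bar> \<le> M / 2 * exp (k * s)"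
      by simp
  qed (use cw False t in auto)
  then show ?thesis
    by (simp add: w_def vec_eq_iff)
qed (use eq in auto)

lemma evolves_unique:
  assumes "evolves b \<omega> z" "evolves b \<omega> z'" "\<And>s. s \<le> b \<Longrightarrow> z s = z' s"
    and "\<And>s i. s \<le> b \<Longrightarrow> \<bar>z s $ i\<bar> \<le> r"
  shows "z = z'"
proof
  fix t
  show "z t = z' t"
    by (rule unique_upto[of t z z' b r \<omega>])
      (use assms evolves_continuous[OF assms(1)] evolves_continuous[OF assms(2)] in \<open>auto simp: evolves_def\<close>)
qed

section \<open>Global existence, uniqueness and the cocycle property\<close>

lemma is_solution_unique:
  assumes "x \<in> BC" "is_solution \<sigma> F \<omega> x T z" "is_solution \<sigma> F \<omega> x T' z'" "ereal t < T" "ereal t < T'"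
  shows "z t = z' t"
proof -
  obtain r where r: "x \<in> B r"
    by (rule in_BC_E[OF assms(1)])
  have le: "ereal s < T''" if "s \<le> t" "ereal t < T''" for s T''
    by (rule le_less_trans[OF _ that(2)]) (simp add: that(1))
  have d: "(z has_vector_derivative F (\<sigma> s \<omega>) (seg s z)) (at s)"
    if "is_solution \<sigma> F \<omega> x T z" "ereal t < T" "0 < s" "s < t" for z T s
  proof -
    have "(z has_vector_derivative F (\<sigma> s \<omega>) (seg s z)) (at s within {0..})"
      using that le[of s T] by (auto simp: is_solution_def)
    then show ?thesis
      using that by (subst (asm) at_within_interior) auto
  qed
  show ?thesis
  proof (rule unique_upto[of t z z' 0 r \<omega> t])
    show "continuous_on {..t} z"
      using assms(2) le[OF _ assms(4)] by (auto simp: is_solution_def intro: continuous_on_subset)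
    show "continuous_on {..t} z'"
      using assms(3) le[OF _ assms(5)] by (auto simp: is_solution_def intro: continuous_on_subset)
  qed (use assms r d in \<open>auto simp: is_solution_def B_iff\<close>)
qed

text \<open>Global existence is contained in (5): stability of the ordered pair (x,x) asserts that
  the solution is defined for all t \<ge> 0.\<close>

lemma lifetime_infinite:
  assumes "x \<in> BC" "t \<ge> 0"
  shows "ereal t < lifetime \<sigma> F \<omega> x"
proof -
  obtain r where "x \<in> B r"
    by (rule in_BC_E[OF assms(1)])
  moreover obtain k :: nat where "r \<le> real k"
    using real_arch_simple by blast
  ultimately have "x \<in> B (real k)"
    by (rule B_mono)
  moreover obtain d where "d > 0" and d: "\<And>x y t \<omega>. x \<in> B (real k) \<Longrightarrow> y \<in> B (real k) \<Longrightarrow>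
      dist x y < d \<and> (le_A A x y \<or> le_A A y x) \<Longrightarrow> t \<ge> 0 \<Longrightarrow> ereal t < lifetime \<sigma> F \<omega> x"
    using stable[of k, unfolded uniformly_stable_def, rule_format, of 1] by (metis zero_less_one)
  ultimately show ?thesis
    using d[of x x t \<omega>] assms le_A_refl by simp
qed

lemma ex_solution:
  assumes "x \<in> BC"
  obtains T z where "is_solution \<sigma> F \<omega> x T z" "ereal t < T"
proof -
  have "ereal (max t 0) < lifetime \<sigma> F \<omega> x"
    using assms by (intro lifetime_infinite) auto
  then obtain T z where *: "is_solution \<sigma> F \<omega> x T z" "ereal (max t 0) < T"
    unfolding lifetime_def less_Sup_iff by blast
  have "ereal t < T"
    using *(2) by (rule le_less_trans[rotated]) auto
  with * that show ?thesis by blast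
qed

lemma sol_eq:
  assumes "x \<in> BC" "is_solution \<sigma> F \<omega> x T z" "ereal t < T"
  shows "sol \<omega> x t = z t"
  unfolding solution_def
proof (rule the_equality)
  show "\<exists>T z'. is_solution \<sigma> F \<omega> x T z' \<and> ereal t < T \<and> z t = z' t"
    using assms by blast
  show "v = z t" if "\<exists>T z. is_solution \<sigma> F \<omega> x T z \<and> ereal t < T \<and> v = z t" for v
    using that is_solution_unique[OF assms(1) _ assms(2) _ assms(3)] by blast
qed

lemma sol_init:
  assumes "x \<in> BC" "s \<le> 0"
  shows "sol \<omega> x s = hist_fun x s"
proof -
  obtain T z where z: "is_solution \<sigma> F \<omega> x T z" "ereal s < T"
    by (rule ex_solution[OF assms(1)])
  then have "z s = hist_fun x s"
    using assms(2) by (simp add: is_solution_def)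
  then show ?thesis
    using sol_eq[OF assms(1) z] by simp
qed

text \<open>The lifetime is a supremum, so each time has its own solution reaching beyond it;
  uniqueness glues these solutions together.\<close>

lemma evolves_sol:
  assumes x: "x \<in> BC"
  shows "evolves 0 \<omega> (sol \<omega> x)"
  unfolding evolves_def
proof (intro conjI allI impI)
  have "continuous_on {..< real n} (sol \<omega> x)" for n
  proof -
    obtain T z where z: "is_solution \<sigma> F \<omega> x T z" "ereal (real n) < T"
      by (rule ex_solution[OF x])
    have lt: "ereal s < T" if "s < real n" for s
      by (rule less_trans[OF _ z(2)]) (simp add: that)
    have "continuous_on {..< real n} z"
      using z(1) lt by (auto simp: is_solution_def intro: continuous_on_subset)
    then show ?thesis
      by (rule continuous_on_eq) (use sol_eq[OF x z(1)] lt in auto)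
  qed
  then have "continuous_on (\<Union>n. {..< real n}) (sol \<omega> x)"
    by (intro continuous_on_open_UN) auto
  moreover have "(\<Union>n. {..< real n}) = UNIV"
    using reals_Archimedean2 by auto
  ultimately show "continuous_on UNIV (sol \<omega> x)"
    by simp
next
  fix t :: real assume t: "0 < t"
  obtain T z where z: "is_solution \<sigma> F \<omega> x T z" "ereal (t + 1) < T"
    by (rule ex_solution[OF x])
  have lt: "ereal s < T" if "s < t + 1" for s
    by (rule less_trans[OF _ z(2)]) (simp add: that)
  have "(z has_vector_derivative F (\<sigma> t \<omega>) (seg t z)) (at t within {0..})"
    using z(1) t lt[of t] by (auto simp: is_solution_def)
  then have "(z has_vector_derivative F (\<sigma> t \<omega>) (seg t z)) (at t)"
    using t by (subst (asm) at_within_interior) auto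
  moreover have "seg t (sol \<omega> x) = seg t z"
    using sol_eq[OF x z(1)] lt by (intro seg_cong) auto
  ultimately show "(sol \<omega> x has_vector_derivative F (\<sigma> t \<omega>) (seg t (sol \<omega> x))) (at t)"
    using sol_eq[OF x z(1)] lt
    by (auto intro!: has_vector_derivative_transform_within_open[of z _ t "{..<t + 1}"])
qed

lemma sol_unique:
  assumes "x \<in> BC" "evolves 0 \<omega> z" "\<And>s. s \<le> 0 \<Longrightarrow> z s = hist_fun x s"
  shows "sol \<omega> x = z"
proof -
  obtain r where r: "x \<in> B r"
    by (rule in_BC_E[OF assms(1)])
  show ?thesis
    by (rule evolves_unique[OF evolves_sol[OF assms(1)] assms(2), of r])
      (use assms r in \<open>auto simp: sol_init B_iff\<close>)
qed

text \<open>By uniqueness, restarting from the segment at time s yields the time translate.\<close>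

lemma sol_seg:
  assumes "evolves b \<omega> z" "b \<le> s" "seg s z \<in> BC"
  shows "sol (\<sigma> s \<omega>) (seg s z) = (\<lambda>t. z (s + t))"
proof (rule sol_unique)
  show "evolves 0 (\<sigma> s \<omega>) (\<lambda>t. z (s + t))"
    using evolves_shift[OF assms(1), of s] assms(2) by (auto intro: evolves_mono)
qed (use assms in auto)

lemma u_seg:
  assumes "evolves b \<omega> z" "b \<le> s" "seg s z \<in> BC"
  shows "u \<sigma> F t (\<sigma> s \<omega>) (seg s z) = seg (s + t) z"
  unfolding u_def sol_seg[OF assms] seg_shift ..

lemma seg_0_sol [simp]: "x \<in> BC \<Longrightarrow> seg 0 (sol \<omega> x) = x"
  by (intro seg_0_eq sol_init)

lemma u_0 [simp]: "x \<in> BC \<Longrightarrow> u \<sigma> F 0 \<omega> x = x"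
  by (simp add: u_def)

lemma seg_evolves_in_BC:
  assumes "evolves b \<omega> z" "\<And>s i. s \<le> b \<Longrightarrow> \<bar>z s $ i\<bar> \<le> r"
  shows "seg t z \<in> BC"
proof -
  obtain r' where "\<And>s i. s \<le> t \<Longrightarrow> \<bar>z s $ i\<bar> \<le> r'"
    using bounded_upto[OF evolves_continuous[OF assms(1)], of b r t] assms(2) by metis
  then have "seg t z \<in> B r'"
    by (intro seg_in_B evolves_continuous[OF assms(1)])
  then show ?thesis
    by (rule B_imp_BC)
qed

end

section \<open>Monotonicity of the semiflow\<close>

context delay_system
begin

text \<open>The exponential estimates before b (from the order) and after b (from the integrating
  factor) are joined at b, where their factors multiply; nonnegativity after b follows from that at
  b.\<close>

lemma le_A_segI:
  assumes c: "continuous_on {..t} z" "continuous_on {..t} z'" and "b \<le> t"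
    and le: "le_A A (seg b z) (seg b z')"
    and d: "\<And>i r. b < r \<Longrightarrow> r < t \<Longrightarrow> \<exists>D. ((\<lambda>r. z' r $ i - z r $ i) has_real_derivative D) (at r) \<and>
      A $ i $ i * (z' r $ i - z r $ i) \<le> D"
  shows "le_A A (seg t z) (seg t z')"
proof -
  define v where "v = (\<lambda>i r. z' r $ i - z r $ i)"
  have seg: "hist_fun (seg t' z) s = z (t' + s)" "hist_fun (seg t' z') s = z' (t' + s)"
    if "t' \<le> t" "s \<le> 0" for t' s
    using that by (auto intro!: hist_fun_seg continuous_on_subset[OF c(1)] continuous_on_subset[OF c(2)])
  have pos0: "0 \<le> v i q" if "q \<le> b" for i q
    using le_A_ge[OF le, of "q - b" i] that \<open>b \<le> t\<close> by (simp add: seg v_def)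
  have early: "exp (A $ i $ i * (q - p)) * v i p \<le> v i q" if "p \<le> q" "q \<le> b" for i p q
    using le_A_exp[OF le, of "p - b" "q - b" i] that \<open>b \<le> t\<close> by (simp add: seg v_def)
  have late: "exp (A $ i $ i * (q - p)) * v i p \<le> v i q" if "p \<le> q" "b \<le> p" "q \<le> t" for i p q
  proof (rule exp_growth[OF that(1)])
    show "continuous_on {p..q} (v i)"
      unfolding v_def using that
      by (intro continuous_intros continuous_on_subset[OF c(1)] continuous_on_subset[OF c(2)]) auto
  qed (use d that in \<open>auto simp: v_def\<close>)
  have all: "exp (A $ i $ i * (q - p)) * v i p \<le> v i q" if "p \<le> q" "q \<le> t" for i p q
  proof -
    consider "q \<le> b" | "b \<le> p" | "p < b" "b < q" by linarith
    then show ?thesis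
    proof cases
      case 3
      have "exp (A $ i $ i * (q - p)) * v i p = exp (A $ i $ i * (q - b)) * (exp (A $ i $ i * (b - p)) * v i p)"
        by (simp add: mult.assoc[symmetric] exp_add[symmetric]) (simp add: algebra_simps)
      also have "\<dots> \<le> exp (A $ i $ i * (q - b)) * v i b"
        using 3 by (intro mult_left_mono early) auto
      also have "\<dots> \<le> v i q"
        using 3 that by (intro late) auto
      finally show ?thesis .
    qed (use early late that in auto)
  qed
  have pos: "0 \<le> v i q" if "q \<le> t" for i q
  proof (cases "q \<le> b")
    case False
    have "0 \<le> exp (A $ i $ i * (q - b)) * v i b"
      using pos0[of b] by simp
    also have "\<dots> \<le> v i q"
      using all False that by simp
    finally show ?thesis .
  qed (rule pos0)
  show ?thesis
    unfolding le_A_iff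
  proof (intro allI conjI impI)
    fix i and s s' :: real
    show "hist_fun (seg t z) s $ i \<le> hist_fun (seg t z') s $ i" if "s \<le> 0"
      using that pos[of "t + s" i] by (simp add: seg v_def)
    show "exp (A $ i $ i * (s' - s)) * (hist_fun (seg t z') s $ i - hist_fun (seg t z) s $ i)
        \<le> hist_fun (seg t z') s' $ i - hist_fun (seg t z) s' $ i" if "s \<le> s'" "s' \<le> 0"
      using that all[of "t + s" "t + s'" i] by (simp add: seg v_def)
  qed
qed

lemma continuous_on_F_along:
  assumes z: "continuous_on UNIV z" and r: "\<And>s i. s \<le> b \<Longrightarrow> \<bar>z s $ i\<bar> \<le> r"
  shows "continuous_on UNIV (\<lambda>t. F (\<sigma> t \<omega>) (seg t z))"
  unfolding continuous_on_def
proof (intro ballI)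
  fix t :: real
  obtain r' where "\<And>s i. s \<le> t + 1 \<Longrightarrow> \<bar>z s $ i\<bar> \<le> r'"
    using bounded_upto[OF continuous_on_subset[OF z subset_UNIV], of b r "t + 1"] r by metis
  then have r': "seg s z \<in> B (\<bar>r'\<bar> + 1)" if "s \<le> t + 1" for s
    using that by (intro seg_in_B continuous_on_subset[OF z subset_UNIV]) (meson abs_ge_self add_increasing2 order_trans zero_le_one)
  show "((\<lambda>t. F (\<sigma> t \<omega>) (seg t z)) \<longlongrightarrow> F (\<sigma> t \<omega>) (seg t z)) (at t within UNIV)"
  proof (rule F_tendsto[of "\<bar>r'\<bar> + 1"])
    show "((\<lambda>t. seg t z) \<longlongrightarrow> seg t z) (at t within UNIV)"
      using continuous_on_seg[OF z] by (simp add: continuous_on_def)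
    have "\<forall>\<^sub>F s in at t. s < t + 1"
      by (rule order_tendstoD[OF tendsto_ident_at]) simp
    then show "\<forall>\<^sub>F s in at t within UNIV. seg s z \<in> B (\<bar>r'\<bar> + 1)"
      by eventually_elim (use r' in auto)
  qed (auto intro!: tendsto_intros r')
qed

text \<open>(3) needs an ordered pair, which is just what is to be proved. So z' is raised to
  \<open>q = z' + \<rho>\<close>, where \<rho> integrates the defect \<open>n\<close> in the
  inequality v' \<ge> A v for v = z' - z; then q lies above z by construction. Now (3) for z and q,
  together with the Lipschitz estimate for q and z', bounds the defect by a multiple of the supremum
  of \<rho>, that is, of its own integral, so the defect vanishes.\<close>

lemma le_A_u:
  assumes x: "x \<in> BC" and y: "y \<in> BC" and le: "le_A A x y" and "t \<ge> 0"
  shows "le_A A (u \<sigma> F t \<omega> x) (u \<sigma> F t \<omega> y)"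
proof -
  obtain r1 where r1: "x \<in> B r1" by (rule in_BC_E[OF x])
  obtain r2 where r2: "y \<in> B r2" by (rule in_BC_E[OF y])
  define z where "z = sol \<omega> x"
  define z' where "z' = sol \<omega> y"
  have ev: "evolves 0 \<omega> z" "evolves 0 \<omega> z'"
    using x y by (auto simp: z_def z'_def evolves_sol)
  have b: "\<bar>z s $ i\<bar> \<le> r1" "\<bar>z' s $ i\<bar> \<le> r2" if "s \<le> 0" for s i
    using that r1 r2 x y by (auto simp: z_def z'_def sol_init B_iff)
  obtain r3 where r3: "\<And>s i. s \<le> t \<Longrightarrow> \<bar>z' s $ i\<bar> \<le> r3"
    using bounded_upto[OF evolves_continuous[OF ev(2)], of 0 r2 t] b(2) by metis
  define v where "v = (\<lambda>i s. z' s $ i - z s $ i)"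
  define f where "f = (\<lambda>i s. F (\<sigma> s \<omega>) (seg s z') $ i - F (\<sigma> s \<omega>) (seg s z) $ i)"
  define n where "n = (\<lambda>i s. max 0 (A $ i $ i * v i s - f i s))"
  define \<rho> where "\<rho> = (\<lambda>i s. integral {0..s} (n i))"
  have v_deriv: "(v i has_real_derivative f i s) (at s)" if "s > 0" for i s
    unfolding v_def f_def by (intro DERIV_diff evolves_derivative[OF ev(1) that] evolves_derivative[OF ev(2) that])
  have n_cont: "continuous_on S (n i)" for i S
  proof -
    have "continuous_on UNIV (n i)"
      unfolding n_def v_def f_def
      by (intro continuous_intros continuous_on_F_along[OF evolves_continuous[OF ev(1)] b(1)]
          continuous_on_F_along[OF evolves_continuous[OF ev(2)] b(2)]
          evolves_continuous[OF ev(1)] evolves_continuous[OF ev(2)]) auto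
    then show ?thesis by (rule continuous_on_subset) auto
  qed
  have n0: "0 \<le> n i s" "n i s \<ge> A $ i $ i * v i s - f i s" for i s
    by (auto simp: n_def)
  have \<rho>0: "0 \<le> \<rho> i s" for i s
    unfolding \<rho>_def by (intro integral_nonneg integrable_continuous_interval n_cont n0)
  have \<rho>_neg: "\<rho> i s = 0" if "s \<le> 0" for i s
    using that by (cases "s = 0") (auto simp: \<rho>_def)
  have \<rho>_deriv: "(\<rho> i has_real_derivative n i s) (at s)" if "s > 0" for i s
  proof -
    have "((\<lambda>s. integral {0..s} (n i)) has_real_derivative n i s) (at s within {0..s + 1})"
      using that by (intro integral_has_real_derivative n_cont) auto
    then show ?thesis
      using that unfolding \<rho>_def by (subst (asm) at_within_interior) auto
  qed
  have \<rho>_cont: "continuous_on {..T} (\<rho> i)" for i T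
  proof -
    have "continuous_on ({..0} \<union> {0..\<bar>T\<bar>}) (\<rho> i)"
    proof (rule continuous_on_closed_Un)
      show "continuous_on {..0} (\<rho> i)"
        using \<rho>_neg by (subst continuous_on_cong[where g = "\<lambda>_. 0"]) auto
      show "continuous_on {0..\<bar>T\<bar>} (\<rho> i)"
        unfolding \<rho>_def by (intro indefinite_integral_continuous_1 integrable_continuous_interval n_cont)
    qed auto
    then show ?thesis
      by (rule continuous_on_subset) auto
  qed
  define q where "q = (\<lambda>s. z' s + (\<chi> i. \<rho> i s))"
  have q_cont: "continuous_on {..T} q" for T
    unfolding q_def using \<rho>_cont
    by (intro continuous_intros evolves_continuous[OF ev(2)] continuous_on_vec_lambda) auto
  have q_le: "le_A A (seg s z) (seg s q)" if "s \<ge> 0" for s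
  proof (rule le_A_segI[OF evolves_continuous[OF ev(1)] q_cont that])
    have "seg 0 q = y"
      using y by (intro seg_0_eq) (simp add: q_def \<rho>_neg z'_def sol_init vec_eq_iff)
    then show "le_A A (seg 0 z) (seg 0 q)"
      using le x by (simp add: z_def)
    fix i and r :: real assume "0 < r"
    have "((\<lambda>r. v i r + \<rho> i r) has_real_derivative f i r + n i r) (at r)"
      by (intro DERIV_add v_deriv \<rho>_deriv \<open>0 < r\<close>)
    \<comment> \<open>A is negative and \<rho> nonnegative, so the correction term on the left only
      helps.\<close>
    moreover have "A $ i $ i * (v i r + \<rho> i r) \<le> f i r + n i r"
      using n0(2)[of i r] mult_nonpos_nonneg[of "A $ i $ i" "\<rho> i r"] A_negative[of i] \<rho>0[of i r]
      by (simp add: distrib_left)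
    ultimately show "\<exists>D. ((\<lambda>r. q r $ i - z r $ i) has_real_derivative D) (at r) \<and>
      A $ i $ i * (q r $ i - z r $ i) \<le> D"
      by (intro exI conjI) (auto simp: q_def v_def algebra_simps)
  qed
  have "\<exists>r4. \<forall>i. \<forall>s\<le>t. \<bar>\<rho> i s\<bar> \<le> r4"
  proof -
    have "bounded (\<rho> i ` {0..t})" for i
      by (intro compact_imp_bounded compact_continuous_image continuous_on_subset[OF \<rho>_cont[of t]]) auto
    then obtain g where g: "\<And>i s. s \<in> {0..t} \<Longrightarrow> \<bar>\<rho> i s\<bar> \<le> g i"
      unfolding bounded_iff real_norm_def by (metis imageI)
    have "\<bar>\<rho> i s\<bar> \<le> (\<Sum>i\<in>UNIV. \<bar>g i\<bar>)" if "s \<le> t" for i s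
    proof -
      have "\<bar>\<rho> i s\<bar> \<le> \<bar>g i\<bar>"
        using g[of s i] that \<rho>_neg[of s i] by (cases "s \<le> 0") auto
      also have "\<dots> \<le> (\<Sum>i\<in>UNIV. \<bar>g i\<bar>)"
        by (rule member_le_sum) auto
      finally show ?thesis .
    qed
    then show ?thesis by blast
  qed
  then obtain r4 where r4: "\<And>i s. s \<le> t \<Longrightarrow> \<bar>\<rho> i s\<bar> \<le> r4"
    by blast
  define R where "R = \<bar>r3\<bar> + \<bar>r4\<bar> + 1"
  have R: "seg s z' \<in> B R" "seg s q \<in> B R" if "s \<le> t" for s
  proof -
    have "\<bar>z' p $ i\<bar> \<le> R" "\<bar>q p $ i\<bar> \<le> R" if "p \<le> s" for p i
      using r3[of p i] r4[of p i] \<open>s \<le> t\<close> that unfolding R_def q_def by auto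
    then show "seg s z' \<in> B R" "seg s q \<in> B R"
      by (auto intro!: seg_in_B q_cont evolves_continuous[OF ev(2)])
  qed
  have "R > 0" by (simp add: R_def)
  obtain L where L: "L \<ge> 0" "\<And>\<omega> x y e i. x \<in> B R \<Longrightarrow> y \<in> B R \<Longrightarrow>
    (\<And>s i. s \<le> 0 \<Longrightarrow> \<bar>hist_fun x s $ i - hist_fun y s $ i\<bar> \<le> e) \<Longrightarrow> \<bar>F \<omega> x $ i - F \<omega> y $ i\<bar> \<le> L * e"
    by (rule F_lipschitz[OF \<open>R > 0\<close>]) blast
  \<comment> \<open>The sum makes \<open>(L - A $ i $ i) / k \<le> 1 / 2\<close> for every component
    i at once.\<close>
  define k where "k = 2 * (L + (\<Sum>i\<in>UNIV. \<bar>A $ i $ i\<bar>)) + 1"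
  have k: "k > 0"
    using L(1) by (simp add: k_def add_nonneg_pos sum_nonneg)
  have n_le: "n i s \<le> (L - A $ i $ i) * e"
    if s: "0 \<le> s" "s \<le> t" and e: "\<And>p i. p \<le> s \<Longrightarrow> \<bar>\<rho> i p\<bar> \<le> e" for i s e
  proof -
    have qBC: "seg s q \<in> BC"
      using R(2)[OF s(2)] by (rule B_imp_BC)
    have zBC: "seg s z \<in> BC"
      by (rule seg_evolves_in_BC[OF ev(1) b(1)])
    have "A *v (hist_fun (seg s q) 0 - hist_fun (seg s z) 0) \<le> F (\<sigma> s \<omega>) (seg s q) - F (\<sigma> s \<omega>) (seg s z)"
      by (rule F_monotone[OF zBC qBC q_le[OF s(1)]])
    then have "A $ i $ i * (v i s + \<rho> i s) \<le> F (\<sigma> s \<omega>) (seg s q) $ i - F (\<sigma> s \<omega>) (seg s z) $ i"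
      using ev q_cont[of s]
      by (auto simp: less_eq_vec_def A_mult_component hist_fun_seg q_def v_def algebra_simps dest!: spec[of _ i])
    moreover have "\<bar>F (\<sigma> s \<omega>) (seg s q) $ i - F (\<sigma> s \<omega>) (seg s z') $ i\<bar> \<le> L * e"
      using e s ev(2) q_cont[of s]
      by (intro L(2) R) (auto simp: hist_fun_seg q_def)
    moreover have "A $ i $ i * e \<le> A $ i $ i * \<rho> i s"
      using e[of s i] A_negative[of i] by (intro mult_left_mono_neg) auto
    moreover have "0 \<le> (L - A $ i $ i) * e"
      using L(1) A_negative[of i] e[of s i] by (intro mult_nonneg_nonneg) auto
    ultimately show ?thesis
      unfolding n_def f_def by (auto simp: algebra_simps)
  qed
  have n_zero: "n i s = 0" if "0 \<le> s" "s \<le> t" for i s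
  proof (rule zero_by_halving[of 0 t "\<lambda>s i. n i s" k, OF n_cont _ that])
    fix M s :: real and i assume M: "M \<ge> 0" and s: "0 \<le> s" "s \<le> t"
      and bound: "\<And>s i. 0 \<le> s \<Longrightarrow> s \<le> t \<Longrightarrow> \<bar>n i s\<bar> \<le> M * exp (k * s)"
    have \<rho>_bound: "\<bar>\<rho> i p\<bar> \<le> M / k * exp (k * s)" if "p \<le> s" for i p
    proof (cases "p \<le> 0")
      case False
      have "\<bar>\<rho> i p\<bar> \<le> M / k * exp (k * p)"
      proof (rule exp_derivative_bound[OF k(1), of 0 s])
        show "\<exists>D. (\<rho> i has_real_derivative D) (at r) \<and> \<bar>D\<bar> \<le> M * exp (k * r)"
          if "0 < r" "r < s" for r
          using \<rho>_deriv[OF that(1)] bound[of r i] that s by (intro exI conjI) auto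
      qed (use False that s M \<rho>_neg in \<open>auto intro: continuous_on_subset[OF \<rho>_cont[of s]]\<close>)
      also have "\<dots> \<le> M / k * exp (k * s)"
        using M k that by (intro mult_left_mono) auto
      finally show ?thesis .
    qed (use M k \<rho>_neg in auto)
    have "\<bar>n i s\<bar> \<le> (L - A $ i $ i) * (M / k * exp (k * s))"
      using n_le[OF s \<rho>_bound] n0(1)[of i s] by simp
    also have "\<dots> = (L - A $ i $ i) / k * (M * exp (k * s))"
      by simp
    also have "(L - A $ i $ i) / k \<le> 1 / 2"
    proof -
      have "- A $ i $ i \<le> (\<Sum>i\<in>UNIV. \<bar>A $ i $ i\<bar>)"
        using member_le_sum[of i UNIV "\<lambda>i. \<bar>A $ i $ i\<bar>"] by auto
      then show ?thesis
        using k by (simp add: field_simps k_def)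
    qed
    finally show "\<bar>n i s\<bar> \<le> M / 2 * exp (k * s)"
      using M by (simp add: mult_right_mono)
  qed
  have "le_A A (seg t z) (seg t z')"
  proof (rule le_A_segI[OF evolves_continuous[OF ev(1)] evolves_continuous[OF ev(2)] \<open>t \<ge> 0\<close>])
    show "le_A A (seg 0 z) (seg 0 z')"
      using le x y by (simp add: z_def z'_def)
    fix i and r :: real assume r: "0 < r" "r < t"
    have "A $ i $ i * v i r \<le> f i r"
      using n_zero[of r i] n0(2)[of i r] r by simp
    then show "\<exists>D. ((\<lambda>r. z' r $ i - z r $ i) has_real_derivative D) (at r) \<and>
      A $ i $ i * (z' r $ i - z r $ i) \<le> D"
      using v_deriv[OF r(1), of i] unfolding v_def by blast
  qed
  then show ?thesis
    by (simp add: u_def z_def z'_def)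
qed

end

section \<open>Bounded entire solutions\<close>

text \<open>For use with compactness: it remains to identify the limit of a convergent
  subsequence.\<close>

lemma tendsto_by_subsequences:
  fixes f :: "nat \<Rightarrow> 'a::metric_space"
  assumes "\<And>r. strict_mono (r :: nat \<Rightarrow> nat) \<Longrightarrow> \<exists>r'. strict_mono r' \<and> (\<lambda>n. f (r (r' n))) \<longlonglongrightarrow> l"
  shows "f \<longlonglongrightarrow> l"
proof (rule ccontr)
  assume "\<not> f \<longlonglongrightarrow> l"
  then obtain e where e: "e > 0" "\<not> (\<forall>\<^sub>F n in sequentially. dist (f n) l < e)"
    using tendstoI by blast
  then have "\<forall>N. \<exists>n\<ge>N. dist (f n) l \<ge> e"
    by (auto simp: eventually_sequentially not_less)
  then have "infinite {n. dist (f n) l \<ge> e}"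
    by (auto simp: infinite_nat_iff_unbounded_le)
  then obtain r :: "nat \<Rightarrow> nat" where r: "strict_mono r" "\<And>n. r n \<in> {n. dist (f n) l \<ge> e}"
    using infinite_enumerate by blast
  obtain r' where "strict_mono r'" and lim: "(\<lambda>n. f (r (r' n))) \<longlonglongrightarrow> l"
    using assms[OF r(1)] by blast
  obtain n where "dist (f (r (r' n))) l < e"
    using tendstoD[OF lim e(1)] eventually_sequentially by auto
  moreover have "dist (f (r (r' n))) l \<ge> e"
    using r(2) by blast
  ultimately show False by simp
qed

lemma filterlim_strict_mono_subseq:
  "strict_mono (r :: nat \<Rightarrow> nat) \<Longrightarrow> filterlim f G sequentially \<Longrightarrow> filterlim (\<lambda>n. f (r n)) G sequentially"
  by (rule filterlim_compose[OF _ filterlim_subseq])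

context delay_system
begin

definition entire :: "real \<Rightarrow> 'o \<Rightarrow> (real \<Rightarrow> real ^ 'm) \<Rightarrow> bool" where
  "entire R \<omega> p \<longleftrightarrow> (\<forall>t i. \<bar>p t $ i\<bar> \<le> R) \<and> (\<forall>b. evolves b \<omega> p)"

lemma evolves_lipschitz:
  assumes M: "\<And>\<omega> x i. x \<in> B R \<Longrightarrow> \<bar>F \<omega> x $ i\<bar> \<le> M"
    and z: "evolves b \<omega> z" and R: "\<And>t i. \<bar>z t $ i\<bar> \<le> R" and st: "b < s" "b < t"
  shows "\<bar>z t $ i - z s $ i\<bar> \<le> M * \<bar>t - s\<bar>"
proof -
  have "norm (z t $ i - z s $ i) \<le> M * norm (t - s)"
  proof (rule field_differentiable_bound[of "{b<..}" "\<lambda>t. z t $ i" "\<lambda>t. F (\<sigma> t \<omega>) (seg t z) $ i"])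
    fix r assume "r \<in> {b<..}"
    then show "((\<lambda>t. z t $ i) has_field_derivative F (\<sigma> r \<omega>) (seg r z) $ i) (at r within {b<..})"
      by (intro DERIV_subset[OF evolves_derivative[OF z]]) auto
    show "norm (F (\<sigma> r \<omega>) (seg r z) $ i) \<le> M"
      using M[OF seg_in_B[OF evolves_continuous[OF z] R]] by simp
  qed (use st in auto)
  then show ?thesis by simp
qed

lemma seg_tendsto:
  assumes c: "\<And>n. continuous_on UNIV (f n)" "continuous_on UNIV p"
    and u: "\<And>N e. e > 0 \<Longrightarrow> \<forall>\<^sub>F n in G. \<forall>t i. \<bar>t\<bar> \<le> N \<longrightarrow> \<bar>f n t $ i - p t $ i\<bar> \<le> e"
  shows "((\<lambda>n. seg t (f n)) \<longlongrightarrow> seg t p) G"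
  unfolding tendsto_hist_iff
proof (intro allI impI)
  fix N e :: real assume "e > 0"
  from u[OF this, of "\<bar>t\<bar> + \<bar>N\<bar>"]
  show "\<forall>\<^sub>F n in G. \<forall>s i. - N \<le> s \<longrightarrow> s \<le> 0 \<longrightarrow> \<bar>hist_fun (seg t (f n)) s $ i - hist_fun (seg t p) s $ i\<bar> \<le> e"
  proof eventually_elim
    case (elim n)
    show ?case
    proof (intro allI impI)
      fix s i assume s: "- N \<le> s" "s \<le> (0 :: real)"
      have "\<bar>f n (t + s) $ i - p (t + s) $ i\<bar> \<le> e"
        using s by (intro elim[rule_format]) linarith
      moreover have "hist_fun (seg t (f n)) s = f n (t + s)" "hist_fun (seg t p) s = p (t + s)"
        using s by (auto intro!: hist_fun_seg continuous_on_subset[OF c(1)] continuous_on_subset[OF c(2)])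
      ultimately show "\<bar>hist_fun (seg t (f n)) s $ i - hist_fun (seg t p) s $ i\<bar> \<le> e"
        by simp
    qed
  qed
qed

text \<open>Ascoli's theorem. After the starting times - T n the derivatives are bounded by M, so a
  diagonal subsequence over the rationals converges locally uniformly; since - T n tends to
  -\<infinity>, the histories before the start enter only through the bound R. The limit satisfies
  the integrated equation by dominated convergence, hence the differential equation.\<close>

lemma entire_limit:
  assumes "R > 0" and \<omega>: "\<omega>' \<longlonglongrightarrow> \<omega>" and z: "\<And>n :: nat. evolves (- T n) (\<omega>' n) (z n)"
    and T: "filterlim T at_top sequentially" and R: "\<And>n t i. \<bar>z n t $ i\<bar> \<le> R"
  obtains r p where "strict_mono (r :: nat \<Rightarrow> nat)" "entire R \<omega> p" "\<And>t. (\<lambda>n. seg t (z (r n))) \<longlonglongrightarrow> seg t p"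
proof -
  obtain M where M: "M > 0" "\<And>\<omega> x i. x \<in> B R \<Longrightarrow> \<bar>F \<omega> x $ i\<bar> \<le> M"
    by (rule F_bounded[OF \<open>R > 0\<close>]) blast
  have norm_R: "norm (z n t) \<le> real CARD('m) * R" for n t
    using R by (intro norm_le_of_components) auto
  obtain r where r: "strict_mono (r :: nat \<Rightarrow> nat)" "\<And>q. q \<in> \<rat> \<Longrightarrow> \<exists>l. (\<lambda>n. z (r n) q) \<longlonglongrightarrow> l"
  proof (rule function_convergent_subsequence[of "\<rat> :: real set" z "real CARD('m) * R"])
    show "countable (\<rat> :: real set)" by (rule countable_rat)
  qed (use norm_R in auto)
  have T_r: "\<forall>\<^sub>F n in sequentially. T (r n) > b" for b
    using filterlim_strict_mono_subseq[OF r(1) T] by (simp add: filterlim_at_top_dense)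
  have lip: "\<bar>z n t $ i - z n s $ i\<bar> \<le> M * \<bar>t - s\<bar>" if "- T n < s" "- T n < t" for n s t i
    using evolves_lipschitz[OF M(2) z R that] .
  have "convergent (\<lambda>n. z (r n) t $ i)" for t i
  proof (rule Cauchy_convergent, rule metric_CauchyI)
    fix e :: real assume "e > 0"
    then have "e / (4 * M) > 0" using M(1) by simp
    then obtain q where q: "q \<in> \<rat>" "t < q" "q < t + e / (4 * M)"
      using Rats_dense_in_real[of t "t + e / (4 * M)"] by auto
    obtain l where "(\<lambda>n. z (r n) q) \<longlonglongrightarrow> l" using r(2)[OF q(1)] by blast
    then have "(\<lambda>n. z (r n) q $ i) \<longlonglongrightarrow> l $ i"
      by (rule tendsto_vec_nth)
    then have "Cauchy (\<lambda>n. z (r n) q $ i)"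
      by (rule LIMSEQ_imp_Cauchy)
    then obtain K where K: "\<And>m n. m \<ge> K \<Longrightarrow> n \<ge> K \<Longrightarrow> dist (z (r m) q $ i) (z (r n) q $ i) < e / 2"
      using \<open>e > 0\<close> by (meson half_gt_zero metric_CauchyD)
    obtain K' where K': "\<And>n. n \<ge> K' \<Longrightarrow> T (r n) > - t"
      using T_r eventually_sequentially by meson
    have near: "\<bar>z (r n) t $ i - z (r n) q $ i\<bar> < e / 4" if "n \<ge> K'" for n
    proof -
      have "\<bar>z (r n) t $ i - z (r n) q $ i\<bar> \<le> M * \<bar>t - q\<bar>"
        using K'[OF that] q by (intro lip) auto
      also have "\<dots> < M * (e / (4 * M))"
        using q M(1) by (intro mult_strict_left_mono) auto
      finally show ?thesis using M(1) by simp
    qed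
    show "\<exists>K. \<forall>m\<ge>K. \<forall>n\<ge>K. dist (z (r m) t $ i) (z (r n) t $ i) < e"
    proof (intro exI[of _ "max K K'"] allI impI)
      fix m n assume "m \<ge> max K K'" "n \<ge> max K K'"
      then show "dist (z (r m) t $ i) (z (r n) t $ i) < e"
        using K[of m n] near[of m] near[of n] unfolding dist_real_def by linarith
    qed
  qed
  define p where "p = (\<lambda>t. \<chi> i. lim (\<lambda>n. z (r n) t $ i))"
  have p: "(\<lambda>n. z (r n) t $ i) \<longlonglongrightarrow> p t $ i" for t i
    using \<open>\<And>t i. convergent (\<lambda>n. z (r n) t $ i)\<close> by (simp add: p_def convergent_LIMSEQ_iff)
  have p_R: "\<bar>p t $ i\<bar> \<le> R" for t i
    by (rule LIMSEQ_le_const2[OF tendsto_rabs[OF p]]) (use R in auto)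
  have p_lip: "\<bar>p t $ i - p s $ i\<bar> \<le> M * \<bar>t - s\<bar>" for t s i
  proof (rule tendsto_upperbound[OF tendsto_rabs[OF tendsto_diff[OF p p]]])
    show "\<forall>\<^sub>F n in sequentially. \<bar>z (r n) t $ i - z (r n) s $ i\<bar> \<le> M * \<bar>t - s\<bar>"
      using T_r[of "\<bar>s\<bar> + \<bar>t\<bar>"] by eventually_elim (rule lip, auto)
  qed auto
  have p_cont: "continuous_on UNIV p"
  proof -
    have "M-lipschitz_on UNIV (\<lambda>t. p t $ i)" for i
      using p_lip M(1) by (intro lipschitz_onI) (auto simp: dist_real_def)
    then have "continuous_on UNIV (\<lambda>t. \<chi> i. p t $ i)"
      by (intro continuous_on_vec_lambda lipschitz_on_continuous_on)
    then show ?thesis by simp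
  qed
  have unif: "\<forall>\<^sub>F n in sequentially. \<forall>t i. \<bar>t\<bar> \<le> N \<longrightarrow> \<bar>z (r n) t $ i - p t $ i\<bar> \<le> e" if "e > 0" for N e
  proof -
    have d: "e / (4 * M) > 0" using M(1) that by simp
    have "seq_compact {-N..N}"
      by (intro compact_imp_seq_compact) simp
    then obtain D where D: "finite D" "D \<subseteq> {-N..N}" "{-N..N} \<subseteq> (\<Union>x\<in>D. ball x (e / (4 * M)))"
      using seq_compact_imp_totally_bounded d by metis
    have "\<forall>\<^sub>F n in sequentially. \<forall>s\<in>D. \<forall>i\<in>UNIV. dist (z (r n) s $ i) (p s $ i) < e / 4"
      using that by (intro eventually_ball_finite D(1) ballI tendstoD[OF p]) auto
    with T_r[of N] show ?thesis
    proof eventually_elim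
      case (elim n)
      show ?case
      proof (intro allI impI)
        fix t i assume t: "\<bar>t\<bar> \<le> N"
        then obtain s where s: "s \<in> D" "dist s t < e / (4 * M)"
          using subsetD[OF D(3), of t] by (auto simp: abs_le_iff)
        then have "M * \<bar>t - s\<bar> < M * (e / (4 * M))"
          using M(1) by (intro mult_strict_left_mono) (auto simp: dist_real_def)
        then have "M * \<bar>t - s\<bar> < e / 4"
          using M(1) by simp
        moreover have "\<bar>z (r n) t $ i - z (r n) s $ i\<bar> \<le> M * \<bar>t - s\<bar>"
          using t s(1) D(2) elim(1) by (intro lip) auto
        moreover have "\<bar>z (r n) s $ i - p s $ i\<bar> < e / 4"
          using elim(2) s(1) by (simp add: dist_real_def)
        ultimately show "\<bar>z (r n) t $ i - p t $ i\<bar> \<le> e"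
          using p_lip[of t i s] by linarith
      qed
    qed
  qed
  have seg_lim: "(\<lambda>n. seg t (z (r n))) \<longlonglongrightarrow> seg t p" for t
    by (rule seg_tendsto[OF evolves_continuous[OF z] p_cont unif])
  define G where "G = (\<lambda>t. F (\<sigma> t \<omega>) (seg t p))"
  have G_cont: "continuous_on S G" for S
    using continuous_on_F_along[OF p_cont, of 0 R \<omega>] p_R
    by (auto simp: G_def intro: continuous_on_subset)
  have \<omega>r: "(\<lambda>n. \<omega>' (r n)) \<longlonglongrightarrow> \<omega>"
    using filterlim_strict_mono_subseq[OF r(1) \<omega>] .
  have zB: "seg t (z n) \<in> B R" for t n
    using R by (intro seg_in_B evolves_continuous[OF z])
  have G_lim: "(\<lambda>n. F (\<sigma> t (\<omega>' (r n))) (seg t (z (r n)))) \<longlonglongrightarrow> G t" for t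
    unfolding G_def
    using \<omega>r seg_lim zB p_R
    by (intro F_tendsto[OF \<open>R > 0\<close>] tendsto_intros) (auto intro!: seg_in_B continuous_on_subset[OF p_cont])
  have p_int: "p t - p b = integral {b..t} G" if "b \<le> t" for b t
  proof -
    \<comment> \<open>Dropping the first K members leaves solutions that all evolve on
      [b,t].\<close>
    obtain K where K: "\<And>n. n \<ge> K \<Longrightarrow> T (r n) > \<bar>b\<bar>"
      using T_r eventually_sequentially by meson
    let ?g = "\<lambda>n s. F (\<sigma> s (\<omega>' (r (n + K)))) (seg s (z (r (n + K))))"
    have int: "(?g n has_integral (z (r (n + K)) t - z (r (n + K)) b)) {b..t}" for n
    proof (rule fundamental_theorem_of_calculus[OF that])
      fix s assume "s \<in> {b..t}"
      then have "- T (r (n + K)) < s"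
        using K[of "n + K"] by auto
      then have "(z (r (n + K)) has_vector_derivative ?g n s) (at s)"
        using z by (auto simp: evolves_def)
      then show "(z (r (n + K)) has_vector_derivative ?g n s) (at s within {b..t})"
        by (rule has_vector_derivative_at_within)
    qed
    have "(\<lambda>n. integral {b..t} (?g n)) \<longlonglongrightarrow> integral {b..t} G"
    proof (rule dominated_convergence(2)[of _ _ "\<lambda>_. real CARD('m) * M"])
      show "(\<lambda>n. ?g n s) \<longlonglongrightarrow> G s" for s
        using G_lim[THEN LIMSEQ_ignore_initial_segment, of s K] .
      show "norm (?g n s) \<le> real CARD('m) * M" for n s
        by (intro norm_le_of_components M(2) zB)
    qed (use int in auto)
    then have "(\<lambda>n. z (r (n + K)) t - z (r (n + K)) b) \<longlonglongrightarrow> integral {b..t} G"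
      using integral_unique[OF int] by simp
    moreover have "(\<lambda>n. z (r (n + K)) t - z (r (n + K)) b) \<longlonglongrightarrow> p t - p b"
      using p[THEN LIMSEQ_ignore_initial_segment]
      by (intro tendsto_diff vec_tendstoI) auto
    ultimately show ?thesis
      using LIMSEQ_unique by blast
  qed
  have "(p has_vector_derivative G t) (at t)" for t
  proof -
    have "((\<lambda>s. integral {t - 1..s} G) has_vector_derivative G t) (at t within {t - 1..t + 1})"
      by (intro integral_has_vector_derivative G_cont) auto
    then have "((\<lambda>s. p (t - 1) + integral {t - 1..s} G) has_vector_derivative 0 + G t) (at t within {t - 1..t + 1})"
      by (intro derivative_intros)
    then have "(p has_vector_derivative G t) (at t within {t - 1..t + 1})"
      unfolding add_0
    proof (rule has_vector_derivative_transform[rotated 2])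
      show "p s = p (t - 1) + integral {t - 1..s} G" if "s \<in> {t - 1..t + 1}" for s
        using that by (simp add: p_int[symmetric])
    qed auto
    then show ?thesis
      by (subst (asm) at_within_interior) auto
  qed
  then have "entire R \<omega> p"
    using p_R p_cont by (simp add: entire_def evolves_def G_def)
  with r(1) seg_lim that show ?thesis by blast
qed

end

text \<open>The balls \<open>B R\<close> are not compact, so uniform continuity of F is available
  only near compact subsets; hence one point lies in C and the other anywhere in S.\<close>

lemma compact_continuous_uniform:
  fixes f :: "'a::metric_space \<Rightarrow> 'b::metric_space"
  assumes "compact C" "C \<subseteq> S" "continuous_on S f" "e > 0"
  obtains d where "d > 0" "\<And>c s. c \<in> C \<Longrightarrow> s \<in> S \<Longrightarrow> dist s c < d \<Longrightarrow> dist (f s) (f c) < e"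
proof (rule ccontr)
  assume "\<not> thesis"
  with that have *: "\<exists>c s. c \<in> C \<and> s \<in> S \<and> dist s c < d \<and> \<not> dist (f s) (f c) < e" if "d > 0" for d
    using \<open>d > 0\<close> by metis
  have "\<exists>c s. c \<in> C \<and> s \<in> S \<and> dist s c < inverse (Suc n) \<and> \<not> dist (f s) (f c) < e" for n
    by (rule *) simp
  then obtain c s where cs: "\<And>n. c n \<in> C" "\<And>n. s n \<in> S" "\<And>n. dist (s n) (c n) < inverse (Suc n)"
    "\<And>n. \<not> dist (f (s n)) (f (c n)) < e"
    by metis
  obtain l r where l: "l \<in> C" "strict_mono (r :: nat \<Rightarrow> nat)" "(c \<circ> r) \<longlonglongrightarrow> l"
    using \<open>compact C\<close> cs(1) unfolding compact_def by metis
  have "(\<lambda>n. inverse (real (Suc (r n)))) \<longlonglongrightarrow> 0"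
    using LIMSEQ_subseq_LIMSEQ[OF LIMSEQ_inverse_real_of_nat l(2)] by (simp add: o_def)
  then have "(\<lambda>n. dist (s (r n)) (c (r n))) \<longlonglongrightarrow> 0"
  proof (rule Lim_null_comparison[rotated])
    show "\<forall>\<^sub>F n in sequentially. norm (dist (s (r n)) (c (r n))) \<le> inverse (real (Suc (r n)))"
      using cs(3) by (intro always_eventually allI) (simp add: less_imp_le del: of_nat_Suc)
  qed
  moreover have "(\<lambda>n. dist (c (r n)) l) \<longlonglongrightarrow> 0"
    using l(3) unfolding o_def by (rule iffD1[OF tendsto_dist_iff])
  ultimately have "(\<lambda>n. dist (s (r n)) (c (r n)) + dist (c (r n)) l) \<longlonglongrightarrow> 0"
    by (rule tendsto_add_zero)
  then have "(\<lambda>n. dist (s (r n)) l) \<longlonglongrightarrow> 0"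
  proof (rule Lim_null_comparison[rotated])
    show "\<forall>\<^sub>F n in sequentially. norm (dist (s (r n)) l) \<le> dist (s (r n)) (c (r n)) + dist (c (r n)) l"
      by (intro always_eventually allI) (simp add: dist_triangle)
  qed
  then have s_lim: "(\<lambda>n. s (r n)) \<longlonglongrightarrow> l"
    by (rule iffD2[OF tendsto_dist_iff])
  have "(\<lambda>n. f (s (r n))) \<longlonglongrightarrow> f l" "(\<lambda>n. f (c (r n))) \<longlonglongrightarrow> f l"
    using l cs(1,2) assms(2) s_lim
    by (auto simp: o_def subset_iff intro!: continuous_on_tendsto_compose[OF assms(3)] always_eventually)
  then have "(\<lambda>n. dist (f (s (r n))) (f (c (r n)))) \<longlonglongrightarrow> dist (f l) (f l)"
    by (rule tendsto_dist)
  then obtain n where "dist (f (s (r n))) (f (c (r n))) < e"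
    using order_tendstoD(2)[of _ "dist (f l) (f l)" sequentially e] \<open>e > 0\<close> by (auto simp: eventually_sequentially)
  with cs(4) show False by blast
qed

section \<open>Convex combinations of histories, used to cut a large ordered gap into small ordered
  steps\<close>

definition convex_hist :: "real \<Rightarrow> 'm::finite hist \<Rightarrow> 'm hist \<Rightarrow> 'm hist" where
  "convex_hist c x y = Hist (restrict (\<lambda>s. (1 - c) *\<^sub>R hist_fun x s + c *\<^sub>R hist_fun y s) {..0})"

lemma hist_fun_convex [simp]:
  "s \<le> 0 \<Longrightarrow> hist_fun (convex_hist c x y) s = (1 - c) *\<^sub>R hist_fun x s + c *\<^sub>R hist_fun y s"
  unfolding convex_hist_def
  by (rule Hist_inverse_restrict) (auto intro!: continuous_intros continuous_hist_fun)

lemma convex_hist_0 [simp]: "convex_hist 0 x y = x" and convex_hist_1 [simp]: "convex_hist 1 x y = y"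
  by (auto intro: hist_eqI)

lemma convex_hist_in_B:
  assumes "x \<in> B r" "y \<in> B r" "0 \<le> c" "c \<le> 1"
  shows "convex_hist c x y \<in> B r"
  unfolding B_iff
proof (intro allI impI)
  fix s :: real and i assume s: "s \<le> 0"
  have "\<bar>(1 - c) * hist_fun x s $ i + c * hist_fun y s $ i\<bar> \<le> (1 - c) * r + c * r"
    using assms s unfolding B_iff
    by (intro order_trans[OF abs_triangle_ineq] add_mono) (auto simp: abs_mult intro!: mult_left_mono)
  then show "\<bar>hist_fun (convex_hist c x y) s $ i\<bar> \<le> r"
    using s by (simp add: algebra_simps)
qed

lemma dist_convex_hist:
  assumes "x \<in> B r" "y \<in> B r"
  shows "dist (convex_hist c x y) (convex_hist d x y) \<le> \<bar>c - d\<bar> * (2 * r)"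
proof (rule dist_hist_le)
  fix s :: real and i assume s: "s \<le> 0"
  have "hist_fun (convex_hist c x y) s $ i - hist_fun (convex_hist d x y) s $ i =
      (c - d) * (hist_fun y s $ i - hist_fun x s $ i)"
    using s by (simp add: algebra_simps)
  moreover have "\<bar>hist_fun x s $ i\<bar> \<le> r" "\<bar>hist_fun y s $ i\<bar> \<le> r"
    using assms s unfolding B_iff by blast+
  then have "\<bar>hist_fun y s $ i - hist_fun x s $ i\<bar> \<le> 2 * r"
    by linarith
  ultimately show "\<bar>hist_fun (convex_hist c x y) s $ i - hist_fun (convex_hist d x y) s $ i\<bar> \<le> \<bar>c - d\<bar> * (2 * r)"
    by (simp add: abs_mult mult_left_mono)
qed

lemma (in diagonal_matrix) le_A_convex:
  assumes "le_A A x y" "c \<le> d"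
  shows "le_A A (convex_hist c x y) (convex_hist d x y)"
proof -
  have eq: "hist_fun (convex_hist d x y) s $ i - hist_fun (convex_hist c x y) s $ i =
      (d - c) * (hist_fun y s $ i - hist_fun x s $ i)" if "s \<le> 0" for s i
    using that by (simp add: algebra_simps)
  show ?thesis
    unfolding le_A_iff
  proof (intro allI conjI impI)
    fix i and s t :: real
    show "hist_fun (convex_hist c x y) s $ i \<le> hist_fun (convex_hist d x y) s $ i" if "s \<le> 0"
      using eq[OF that, of i] le_A_ge[OF assms(1) that, of i] assms(2)
        mult_nonneg_nonneg[of "d - c" "hist_fun y s $ i - hist_fun x s $ i"] by linarith
    assume st: "s \<le> t" "t \<le> 0"
    have "(d - c) * (exp (A $ i $ i * (t - s)) * (hist_fun y s $ i - hist_fun x s $ i)) \<le>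
        (d - c) * (hist_fun y t $ i - hist_fun x t $ i)"
      using assms(2) by (intro mult_left_mono le_A_exp[OF assms(1) st]) auto
    then show "exp (A $ i $ i * (t - s)) * (hist_fun (convex_hist d x y) s $ i - hist_fun (convex_hist c x y) s $ i)
        \<le> hist_fun (convex_hist d x y) t $ i - hist_fun (convex_hist c x y) t $ i"
      using st eq by (simp add: mult.left_commute)
  qed
qed

lemma seg_shift': "seg s (\<lambda>r. z (t + r)) = seg (s + t) z"
  by (subst add.commute[of s]) (rule seg_shift)

context delay_system
begin

section \<open>The compact flow on bounded entire solutions\<close>

lemma entire_evolves: "entire R \<omega> p \<Longrightarrow> evolves b \<omega> p"
  by (simp add: entire_def)

lemma entire_bound: "entire R \<omega> p \<Longrightarrow> \<bar>p t $ i\<bar> \<le> R"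
  by (simp add: entire_def)

lemma entire_in_B: "entire R \<omega> p \<Longrightarrow> seg t p \<in> B R"
  using entire_bound by (intro seg_in_B evolves_continuous[OF entire_evolves[of R \<omega> p 0]]) auto

lemma entire_shift: "entire R \<omega> p \<Longrightarrow> entire R (\<sigma> s \<omega>) (\<lambda>t. p (s + t))"
  unfolding entire_def
proof (intro conjI allI)
  fix b assume *: "(\<forall>t i. \<bar>p t $ i\<bar> \<le> R) \<and> (\<forall>b. evolves b \<omega> p)"
  show "evolves b (\<sigma> s \<omega>) (\<lambda>t. p (s + t))"
    using evolves_shift[of "b + s" \<omega> p s] * by simp
qed auto

lemma entire_sol: "entire R \<omega> p \<Longrightarrow> sol (\<sigma> s \<omega>) (seg s p) = (\<lambda>t. p (s + t))"
  by (rule sol_seg[OF entire_evolves[of R \<omega> p s] order_refl B_imp_BC[OF entire_in_B]])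

lemma entire_sol_0: "entire R \<omega> p \<Longrightarrow> sol \<omega> (seg 0 p) = p"
  using entire_sol[of R \<omega> p 0] by simp

text \<open>The solution through x is continued to the left by x itself, so membership says that x
  already solves the equation at negative times. This makes the continuation to negative t canonical
  and \<open>\<tau>\<close> a flow for all real t on \<open>EB R\<close>.\<close>

definition EB :: "real \<Rightarrow> ('o \<times> 'm hist) set" where
  "EB R = {(\<omega>, x). x \<in> BC \<and> entire R \<omega> (sol \<omega> x)}"

lemma EB_entire: "(\<omega>, x) \<in> EB R \<Longrightarrow> entire R \<omega> (sol \<omega> x)"
  by (simp add: EB_def)

lemma EB_in_BC: "(\<omega>, x) \<in> EB R \<Longrightarrow> x \<in> BC"
  by (simp add: EB_def)

lemma EB_in_B: "(\<omega>, x) \<in> EB R \<Longrightarrow> x \<in> B R"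
  using entire_in_B[of R \<omega> "sol \<omega> x" 0] by (simp add: EB_def)

lemma EB_I: "entire R \<omega> p \<Longrightarrow> (\<sigma> s \<omega>, seg s p) \<in> EB R"
  unfolding EB_def by (simp add: entire_sol entire_shift B_imp_BC[OF entire_in_B])

lemma EB_I0: "entire R \<omega> p \<Longrightarrow> (\<omega>, seg 0 p) \<in> EB R"
  using EB_I[of R \<omega> p 0] by simp

lemma entire_mono: "entire R \<omega> p \<Longrightarrow> R \<le> R' \<Longrightarrow> entire R' \<omega> p"
  unfolding entire_def by (meson order_trans)

lemma EB_mono: "R \<le> R' \<Longrightarrow> EB R \<subseteq> EB R'"
  by (auto simp: EB_def entire_mono)

lemma \<tau>_EB: "z \<in> EB R \<Longrightarrow> \<tau> \<sigma> F t z \<in> EB R"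
  by (cases z) (auto simp: \<tau>_def u_def intro!: EB_I EB_entire)

lemma \<tau>_0: "z \<in> EB R \<Longrightarrow> \<tau> \<sigma> F 0 z = z"
  by (cases z) (auto simp: \<tau>_def EB_in_BC)

lemma \<tau>_add: "z \<in> EB R \<Longrightarrow> \<tau> \<sigma> F (s + t) z = \<tau> \<sigma> F s (\<tau> \<sigma> F t z)"
  by (cases z) (auto simp: \<tau>_def u_def flow_add entire_sol[OF EB_entire] seg_shift')

text \<open>Entire solutions evolve from every time, so any starting times tending to -\<infinity>
  can be fed into \<open>entire_limit\<close>. One subsequence serves all t simultaneously.\<close>

lemma EB_limit:
  assumes "R > 0" "\<And>n :: nat. w n \<in> EB R"
  obtains r z where "strict_mono (r :: nat \<Rightarrow> nat)" "z \<in> EB R"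
    "\<And>t. (\<lambda>n. \<tau> \<sigma> F t (w (r n))) \<longlonglongrightarrow> \<tau> \<sigma> F t z"
proof -
  obtain r1 \<omega> where r1: "strict_mono (r1 :: nat \<Rightarrow> nat)" "(\<lambda>n. fst (w (r1 n))) \<longlonglongrightarrow> \<omega>"
    using compact_base[unfolded compact_def, rule_format, of "\<lambda>n. fst (w n)"] by (auto simp: o_def)
  have ent: "entire R (fst (w n)) (sol (fst (w n)) (snd (w n)))" for n
    using EB_entire[of "fst (w n)" "snd (w n)" R] assms(2)[of n] by simp
  obtain r2 p where r2: "strict_mono (r2 :: nat \<Rightarrow> nat)" "entire R \<omega> p"
    "\<And>t. (\<lambda>n. seg t (sol (fst (w (r1 (r2 n)))) (snd (w (r1 (r2 n)))))) \<longlonglongrightarrow> seg t p"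
    by (rule entire_limit[OF \<open>R > 0\<close> r1(2) entire_evolves[OF ent] filterlim_real_sequentially entire_bound[OF ent]]) blast
  have \<omega>: "(\<lambda>n. fst (w (r1 (r2 n)))) \<longlonglongrightarrow> \<omega>"
    using filterlim_strict_mono_subseq[OF r2(1) r1(2)] .
  show ?thesis
  proof (rule that[of "r1 \<circ> r2" "(\<omega>, seg 0 p)"])
    show "strict_mono (r1 \<circ> r2)"
      using r1 r2 by (intro strict_mono_o)
    show "(\<omega>, seg 0 p) \<in> EB R"
      by (rule EB_I0[OF r2(2)])
    show "(\<lambda>n. \<tau> \<sigma> F t (w ((r1 \<circ> r2) n))) \<longlonglongrightarrow> \<tau> \<sigma> F t (\<omega>, seg 0 p)" for t
      using \<omega> r2(3) by (auto simp: \<tau>_def u_def entire_sol_0[OF r2(2)] intro!: tendsto_intros)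
  qed
qed

lemma compact_EB: "R > 0 \<Longrightarrow> compact (EB R)"
  unfolding compact_def
proof (intro allI impI)
  fix w :: "nat \<Rightarrow> 'o \<times> 'm hist" assume "R > 0" and w: "\<forall>n. w n \<in> EB R"
  then obtain r z where r: "strict_mono (r :: nat \<Rightarrow> nat)" "z \<in> EB R"
    "\<And>t. (\<lambda>n. \<tau> \<sigma> F t (w (r n))) \<longlonglongrightarrow> \<tau> \<sigma> F t z"
    using EB_limit[of R w] by blast
  then have "(\<lambda>n. w (r n)) \<longlonglongrightarrow> z"
    using r(3)[of 0] w \<tau>_0[of _ R] by simp
  with r(1,2) show "\<exists>l\<in>EB R. \<exists>r. strict_mono r \<and> (w \<circ> r) \<longlonglongrightarrow> l"
    by (auto simp: o_def)
qed

text \<open>Every subsequence has a further one along which whole orbits converge, and the limit is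
  identified at time 0.\<close>

lemma \<tau>_tendsto:
  assumes "R > 0" "\<And>n :: nat. w n \<in> EB R" "w \<longlonglongrightarrow> z"
  shows "(\<lambda>n. \<tau> \<sigma> F t (w n)) \<longlonglongrightarrow> \<tau> \<sigma> F t z"
proof (rule tendsto_by_subsequences)
  fix r :: "nat \<Rightarrow> nat" assume r: "strict_mono r"
  obtain r' z' where r': "strict_mono r'" "z' \<in> EB R" "\<And>t. (\<lambda>n. \<tau> \<sigma> F t (w (r (r' n)))) \<longlonglongrightarrow> \<tau> \<sigma> F t z'"
    using EB_limit[of R "\<lambda>n. w (r n)"] assms by blast
  have "(\<lambda>n. w (r (r' n))) \<longlonglongrightarrow> z'"
    using r'(3)[of 0] assms(2) r'(2) \<tau>_0[of _ R] by simp
  moreover have "(\<lambda>n. w (r (r' n))) \<longlonglongrightarrow> z"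
    by (intro filterlim_strict_mono_subseq[OF r'(1)] filterlim_strict_mono_subseq[OF r] assms)
  ultimately have "z' = z"
    by (rule LIMSEQ_unique)
  with r' show "\<exists>r'. strict_mono r' \<and> (\<lambda>n. \<tau> \<sigma> F t (w (r (r' n)))) \<longlonglongrightarrow> \<tau> \<sigma> F t z"
    by blast
qed

lemma continuous_on_\<tau>: "R > 0 \<Longrightarrow> continuous_on (EB R) (\<tau> \<sigma> F t)"
  unfolding continuous_on_sequentially by (auto simp: o_def intro: \<tau>_tendsto)

section \<open>Stability of ordered pairs and uniform estimates near entire solutions\<close>

lemma stableD:
  assumes "e > 0"
  obtains d where "d > 0" "\<And>x y t \<omega>. x \<in> B r \<Longrightarrow> y \<in> B r \<Longrightarrow> dist x y < d \<Longrightarrow> le_A A x y \<Longrightarrow> t \<ge> 0 \<Longrightarrow>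
    dist (u \<sigma> F t \<omega> x) (u \<sigma> F t \<omega> y) < e"
proof -
  obtain k :: nat where "r \<le> real k"
    using real_arch_simple by blast
  then have *: "B r \<subseteq> (B (real k) :: 'm hist set)"
    using B_mono by blast
  obtain d where "d > 0" "\<And>x y t \<omega>. x \<in> B (real k) \<Longrightarrow> y \<in> B (real k) \<Longrightarrow> dist x y < d \<and> (le_A A x y \<or> le_A A y x) \<Longrightarrow>
      t \<ge> 0 \<Longrightarrow> dist (u \<sigma> F t \<omega> x) (u \<sigma> F t \<omega> y) < e"
    using stable[of k, unfolded uniformly_stable_def, rule_format, OF assms] by metis
  then show ?thesis
    using that * by (meson subsetD)
qed

text \<open>(5) says nothing directly about histories far apart. The segment from x to y is cut into
  n ordered steps shorter than the stability threshold; each step stays below 1 for all times and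
  all \<omega>, so n bounds the total gap.\<close>

lemma ordered_gap_bounded:
  assumes x: "x \<in> B r" and y: "y \<in> B r" and le: "le_A A x y"
  obtains N where "\<And>t \<omega> i. t \<ge> 0 \<Longrightarrow> \<bar>sol \<omega> x t $ i - sol \<omega> y t $ i\<bar> \<le> N"
proof -
  obtain d0 where d0: "d0 > 0" "\<And>x y :: 'm hist. dist x y < d0 \<Longrightarrow>
      (\<forall>s i. - 0 \<le> s \<longrightarrow> s \<le> 0 \<longrightarrow> \<bar>hist_fun x s $ i - hist_fun y s $ i\<bar> < 1)"
    using close_of_dist_hist[of 1 0] by (metis zero_less_one)
  obtain d where d: "d > 0" "\<And>x y t \<omega>. x \<in> B r \<Longrightarrow> y \<in> B r \<Longrightarrow> dist x y < d \<Longrightarrow> le_A A x y \<Longrightarrow> t \<ge> 0 \<Longrightarrow>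
    dist (u \<sigma> F t \<omega> x) (u \<sigma> F t \<omega> y) < d0"
    by (rule stableD[OF d0(1)]) blast
  \<comment> \<open>Neighbouring interpolants have distance at most \<open>2 * r / real n\<close>,
    which is then smaller than d.\<close>
  obtain n :: nat where n: "2 * r / d < real n" "n > 0"
    using reals_Archimedean2[of "max (2 * r / d) 0"] by auto
  define c where "c = (\<lambda>j. convex_hist (real j / real n) x y)"
  have cB: "c j \<in> B r" if "j \<le> n" for j
    using that n(2) unfolding c_def by (intro convex_hist_in_B x y) (auto simp: field_simps)
  have step: "\<bar>sol \<omega> (c j) t $ i - sol \<omega> (c (Suc j)) t $ i\<bar> < 1" if "j < n" "t \<ge> 0" for j t \<omega> i
  proof -
    have "dist (c j) (c (Suc j)) \<le> \<bar>real j / real n - real (Suc j) / real n\<bar> * (2 * r)"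
      unfolding c_def by (rule dist_convex_hist[OF x y])
    also have "\<bar>real j / real n - real (Suc j) / real n\<bar> = 1 / real n"
      using n(2) by (simp add: field_simps)
    also have "1 / real n * (2 * r) < d"
      using n d(1) by (simp add: field_simps)
    finally have "dist (u \<sigma> F t \<omega> (c j)) (u \<sigma> F t \<omega> (c (Suc j))) < d0"
      using that n(2) unfolding c_def
      by (intro d(2) le_A_convex le cB[unfolded c_def]) (auto simp: divide_right_mono)
    moreover have "evolves 0 \<omega> (sol \<omega> (c j))" "evolves 0 \<omega> (sol \<omega> (c (Suc j)))"
      using that by (auto intro!: evolves_sol B_imp_BC[OF cB])
    ultimately show ?thesis
      using d0(2)[rule_format, of "u \<sigma> F t \<omega> (c j)" "u \<sigma> F t \<omega> (c (Suc j))" 0 i]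
      by (simp add: u_def)
  qed
  have "\<bar>sol \<omega> (c 0) t $ i - sol \<omega> (c j) t $ i\<bar> \<le> real j" if "j \<le> n" "t \<ge> 0" for j t \<omega> i
    using that(1)
  proof (induction j)
    case (Suc j)
    then show ?case
      using step[of j t \<omega> i] that(2) by (simp add: abs_le_iff) linarith
  qed simp
  moreover have "c 0 = x" "c n = y"
    using n(2) by (auto simp: c_def)
  ultimately show ?thesis
    using that by blast
qed

lemma le_A_of_derivatives:
  assumes c: "continuous_on {..0} z" "continuous_on {..0} z'"
    and b: "seg 0 z \<in> B r" "seg 0 z' \<in> B r'"
    and d: "\<And>i s. s < 0 \<Longrightarrow> \<exists>D. ((\<lambda>s. z' s $ i - z s $ i) has_real_derivative D) (at s) \<and>
      A $ i $ i * (z' s $ i - z s $ i) \<le> D"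
  shows "le_A A (seg 0 z) (seg 0 z')"
proof (rule le_A_I[OF b])
  fix i and s t :: real assume st: "s \<le> t" "t \<le> 0"
  have "exp (A $ i $ i * (t - s)) * (z' s $ i - z s $ i) \<le> z' t $ i - z t $ i"
  proof (rule exp_growth[OF st(1)])
    show "continuous_on {s..t} (\<lambda>s. z' s $ i - z s $ i)"
      using st by (intro continuous_intros continuous_on_subset[OF c(1)] continuous_on_subset[OF c(2)]) auto
  qed (use d st in auto)
  then show "exp (A $ i $ i * (t - s)) * (hist_fun (seg 0 z') s $ i - hist_fun (seg 0 z) s $ i)
      \<le> hist_fun (seg 0 z') t $ i - hist_fun (seg 0 z) t $ i"
    using st by (simp add: hist_fun_seg c)
qed

text \<open>A constant history has derivative 0, so for - C the expression x' - A x equals A C. For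
  large C this lies below - M + A R, which bounds the same expression from below along entire
  solutions of size R.\<close>

lemma EB_ge_const:
  assumes "R > 0"
  obtains C where "C > 0" "\<And>\<omega> x. (\<omega>, x) \<in> EB R \<Longrightarrow> le_A A (const_hist (- C)) x"
proof -
  obtain M where M: "M > 0" "\<And>\<omega> x i. x \<in> B R \<Longrightarrow> \<bar>F \<omega> x $ i\<bar> \<le> M"
    by (rule F_bounded[OF assms]) blast
  \<comment> \<open>One nonnegative summand for each component makes C large enough for all of them;
    the additional 1 makes it positive.\<close>
  define C where "C = (\<Sum>i\<in>UNIV. (M - A $ i $ i * R) / (- A $ i $ i)) + 1"
  have pos: "0 \<le> (M - A $ i $ i * R) / (- A $ i $ i)" for i
    using M(1) assms A_negative[of i] mult_nonpos_nonneg[of "A $ i $ i" R] by (intro divide_nonneg_pos) auto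
  have C: "C > 0" "M - A $ i $ i * R \<le> - A $ i $ i * C" for i
  proof -
    show "C > 0"
      unfolding C_def using pos by (intro add_nonneg_pos sum_nonneg) auto
    have "(M - A $ i $ i * R) / (- A $ i $ i) \<le> (\<Sum>i\<in>UNIV. (M - A $ i $ i * R) / (- A $ i $ i))"
      using pos by (intro member_le_sum) auto
    then have "(M - A $ i $ i * R) / (- A $ i $ i) \<le> C"
      by (simp add: C_def)
    then show "M - A $ i $ i * R \<le> - A $ i $ i * C"
      using A_negative[of i] by (subst (asm) pos_divide_le_eq) (auto simp: mult.commute)
  qed
  have "le_A A (const_hist (- C)) x" if "(\<omega>, x) \<in> EB R" for \<omega> x
  proof -
    define p where "p = sol \<omega> x"
    have p: "entire R \<omega> p"
      unfolding p_def by (rule EB_entire[OF that])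
    have seg: "seg 0 p = x" "seg 0 (\<lambda>_. \<chi> i. - C) = (const_hist (- C) :: 'm hist)"
      using EB_in_BC[OF that] by (auto simp: p_def intro!: seg_0_eq)
    have "le_A A (seg 0 (\<lambda>_. \<chi> i. - C)) (seg 0 p)"
    proof (rule le_A_of_derivatives)
      show "continuous_on {..0} p"
        by (rule evolves_continuous[OF entire_evolves[OF p]])
      show "seg 0 (\<lambda>_. \<chi> i. - C) \<in> (B C :: 'm hist set)"
        unfolding seg by (rule const_hist_in_B) (use C in auto)
      show "seg 0 p \<in> B R"
        by (rule entire_in_B[OF p])
      fix i and s :: real
      have "((\<lambda>s. p s $ i - (\<chi> i. - C) $ i) has_real_derivative F (\<sigma> s \<omega>) (seg s p) $ i - 0) (at s)"
        by (intro DERIV_diff evolves_derivative[OF entire_evolves[OF p, of "s - 1"]]) auto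
      moreover have "A $ i $ i * (p s $ i - (\<chi> i. - C) $ i) \<le> F (\<sigma> s \<omega>) (seg s p) $ i - 0"
      proof -
        have "A $ i $ i * p s $ i \<le> - A $ i $ i * R"
          using entire_bound[OF p, of s i] A_negative[of i] mult_left_mono_neg[of "- R" "p s $ i" "A $ i $ i"]
          by (auto simp: abs_le_iff)
        moreover have "\<bar>F (\<sigma> s \<omega>) (seg s p) $ i\<bar> \<le> M"
          by (intro M(2) entire_in_B[OF p])
        ultimately show ?thesis
          using C(2)[of i] by (simp add: algebra_simps abs_le_iff)
      qed
      ultimately show "\<exists>D. ((\<lambda>s. p s $ i - (\<chi> i. - C) $ i) has_real_derivative D) (at s) \<and>
          A $ i $ i * (p s $ i - (\<chi> i. - C) $ i) \<le> D"
        by blast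
    qed auto
    then show ?thesis by (simp only: seg)
  qed
  with C(1) that show ?thesis by blast
qed

text \<open>Only y has to lie on an entire solution: compactness of \<open>EB R\<close> makes the
  modulus uniform in y, while z may have any history in \<open>B R\<close>. A window longer than N
  by \<open>N1\<close> controls the segments at all times in [-N,0].\<close>

lemma F_close:
  assumes "R > 0" "e > 0"
  obtains d where "d > 0" "\<And>\<omega> y z s i. (\<omega>, y) \<in> EB R \<Longrightarrow> continuous_on UNIV z \<Longrightarrow> seg 0 z \<in> B R \<Longrightarrow>
      dist (seg 0 z) y < d \<Longrightarrow> - N \<le> s \<Longrightarrow> s \<le> 0 \<Longrightarrow>
      \<bar>F (\<sigma> s \<omega>) (seg s z) $ i - F (\<sigma> s \<omega>) (seg s (sol \<omega> y)) $ i\<bar> < e \<and> \<bar>z s $ i - sol \<omega> y s $ i\<bar> < e"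
proof -
  obtain d1 where d1: "d1 > 0" "\<And>c s. c \<in> EB R \<Longrightarrow> s \<in> UNIV \<times> B R \<Longrightarrow> dist s c < d1 \<Longrightarrow>
      dist ((\<lambda>(\<omega>, x). F \<omega> x) s) ((\<lambda>(\<omega>, x). F \<omega> x) c) < e"
    by (rule compact_continuous_uniform[OF compact_EB[OF \<open>R > 0\<close>] _ F_continuous[OF \<open>R > 0\<close>] \<open>e > 0\<close>])
      (use EB_in_B in auto)
  from dist_hist_lessI[OF d1(1), where 'm = 'm] obtain N1 \<eta> where N1: "N1 > 0" "\<eta> > 0"
    "\<And>x y :: 'm hist. (\<forall>s i. - N1 \<le> s \<longrightarrow> s \<le> 0 \<longrightarrow>
        \<bar>hist_fun x s $ i - hist_fun y s $ i\<bar> \<le> \<eta>) \<Longrightarrow> dist x y < d1"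
    by blast
  obtain d where d: "d > 0" "\<And>x y :: 'm hist. dist x y < d \<Longrightarrow>
    (\<forall>s i. - (\<bar>N\<bar> + N1) \<le> s \<longrightarrow> s \<le> 0 \<longrightarrow> \<bar>hist_fun x s $ i - hist_fun y s $ i\<bar> < min \<eta> e)"
    using close_of_dist_hist[of "min \<eta> e" "\<bar>N\<bar> + N1", where 'm = 'm] N1(2) \<open>e > 0\<close> by (metis min_less_iff_conj)
  have "\<bar>F (\<sigma> s \<omega>) (seg s z) $ i - F (\<sigma> s \<omega>) (seg s (sol \<omega> y)) $ i\<bar> < e \<and> \<bar>z s $ i - sol \<omega> y s $ i\<bar> < e"
    if y: "(\<omega>, y) \<in> EB R" and z: "continuous_on UNIV z" and zB: "seg 0 z \<in> B R" and
      dist: "dist (seg 0 z) y < d" and s: "- N \<le> s" "s \<le> 0" for \<omega> y z s i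
  proof -
    have yBC: "y \<in> BC" by (rule EB_in_BC[OF y])
    have c: "continuous_on {..t} z" for t
      using z by (rule continuous_on_subset) auto
    have close: "\<bar>z t $ i - sol \<omega> y t $ i\<bar> < min \<eta> e" if "- (\<bar>N\<bar> + N1) \<le> t" "t \<le> 0" for t i
      using d(2)[OF dist, rule_format, OF that, of i] that by (simp add: hist_fun_seg c sol_init yBC)
    have "dist (seg s z) (seg s (sol \<omega> y)) < d1"
    proof (rule N1(3), intro allI impI)
      fix t i assume t: "- N1 \<le> t" "t \<le> 0"
      then show "\<bar>hist_fun (seg s z) t $ i - hist_fun (seg s (sol \<omega> y)) t $ i\<bar> \<le> \<eta>"
        using close[of "s + t" i] s evolves_sol[OF yBC, of \<omega>] by (simp add: hist_fun_seg c)
    qed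
    then have "dist (\<sigma> s \<omega>, seg s z) (\<sigma> s \<omega>, seg s (sol \<omega> y)) < d1"
      by (simp add: dist_Pair_Pair)
    moreover have "seg s z \<in> B R"
      using zB s by (intro seg_in_B c) (auto simp: B_iff hist_fun_seg c)
    ultimately have "dist (F (\<sigma> s \<omega>) (seg s z)) (F (\<sigma> s \<omega>) (seg s (sol \<omega> y))) < e"
      using d1(2)[of "(\<sigma> s \<omega>, seg s (sol \<omega> y))" "(\<sigma> s \<omega>, seg s z)"] EB_I[OF EB_entire[OF y]] by auto
    then have "\<bar>(F (\<sigma> s \<omega>) (seg s z) - F (\<sigma> s \<omega>) (seg s (sol \<omega> y))) $ i\<bar> < e"
      unfolding dist_norm using component_le_norm_cart le_less_trans by blast
    then show ?thesis
      using close[of s i] s N1(1) by auto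
  qed
  with d(1) that show ?thesis by blast
qed

end

section \<open>Stability along entire solutions\<close>

definition shift_hist :: "real \<Rightarrow> 'm::finite hist \<Rightarrow> 'm hist" where
  "shift_hist c x = Hist (restrict (\<lambda>s. hist_fun x s + (\<chi> i. c)) {..0})"

lemma hist_fun_shift [simp]: "s \<le> 0 \<Longrightarrow> hist_fun (shift_hist c x) s = hist_fun x s + (\<chi> i. c)"
  unfolding shift_hist_def
  by (rule Hist_inverse_restrict) (auto intro!: continuous_intros continuous_hist_fun)

context delay_system
begin

text \<open>The difference is the constant - c \<ge> 0, and the factor
  \<open>exp (A $ i $ i * (t - s))\<close> is at most 1 because A is negative.\<close>

lemma le_A_shift:
  assumes "c \<le> 0"
  shows "le_A A (shift_hist c x) x"
  unfolding le_A_iff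
proof (intro allI conjI impI)
  fix i and s t :: real
  show "hist_fun (shift_hist c x) s $ i \<le> hist_fun x s $ i" if "s \<le> 0"
    using that assms by simp
  assume st: "s \<le> t" "t \<le> 0"
  then have "exp (A $ i $ i * (t - s)) \<le> 1"
    using A_negative[of i] by (simp add: mult_nonpos_nonneg)
  then have "exp (A $ i $ i * (t - s)) * (- c) \<le> 1 * (- c)"
    using assms by (intro mult_right_mono) auto
  then show "exp (A $ i $ i * (t - s)) * (hist_fun x s $ i - hist_fun (shift_hist c x) s $ i)
      \<le> hist_fun x t $ i - hist_fun (shift_hist c x) t $ i"
    using st by simp
qed

lemma le_A_shift_const: "le_A A h (const_hist 0) \<Longrightarrow> le_A A (shift_hist c h) (const_hist c)"
  by (simp add: le_A_iff)

lemma decay_rate: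
  obtains \<alpha> where "\<alpha> > 0" "\<And>i. A $ i $ i \<le> - \<alpha>"
proof (rule that)
  define \<alpha> where "\<alpha> = Min (range (\<lambda>i. - A $ i $ i))"
  have "\<alpha> \<in> range (\<lambda>i. - A $ i $ i)"
    unfolding \<alpha>_def by (intro Min_in) auto
  then show "\<alpha> > 0"
    using A_negative by auto
  show "A $ i $ i \<le> - \<alpha>" for i
  proof -
    have "\<alpha> \<le> - A $ i $ i"
      unfolding \<alpha>_def by (intro Min_le) auto
    then show ?thesis by simp
  qed
qed

text \<open>The lower bound \<open>w\<close> continues \<open>h\<close> by \<open>w' = A w + min (z' - A z) (q' - A q)\<close>; it is close to \<open>z\<close>
  and \<open>q\<close> where these functions and their derivatives are close to each other.\<close>

lemma lower_bound_history:
  assumes "N > 0" and z: "evolves (- N) \<omega> z" "seg 0 z \<in> B R" and q: "entire R \<omega> q"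
    and M: "\<And>\<omega> x i. x \<in> B R \<Longrightarrow> \<bar>F \<omega> x $ i\<bar> \<le> M"
    and h: "h \<in> B R'" "le_A A h (seg (- N) z)" "le_A A h (seg (- N) q)"
    and C: "C \<ge> R" "C \<ge> R'" "\<And>i. M - A $ i $ i * R \<le> - A $ i $ i * C"
  obtains w where "seg 0 w \<in> B C" "continuous_on UNIV w" "le_A A (seg 0 w) (seg 0 z)" "le_A A (seg 0 w) (seg 0 q)"
    "\<forall>s i \<eta>. - N < s \<longrightarrow> s < 0 \<longrightarrow>
      \<bar>(F (\<sigma> s \<omega>) (seg s z) $ i - A $ i $ i * z s $ i) - (F (\<sigma> s \<omega>) (seg s q) $ i - A $ i $ i * q s $ i)\<bar> \<le> \<eta> \<longrightarrow>
      (\<exists>D. ((\<lambda>s. z s $ i - w s $ i) has_real_derivative D) (at s) \<and> D \<le> A $ i $ i * (z s $ i - w s $ i) + \<eta>)"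
proof -
  have q0: "evolves (- N) \<omega> q"
    by (rule entire_evolves[OF q])
  have zR: "\<bar>z s $ i\<bar> \<le> R" if "s \<le> 0" for s i
    using z that by (auto simp: B_iff)
  have R0: "R \<ge> 0"
    using zR[of 0] abs_ge_zero order_trans by blast
  define f where "f = (\<lambda>i s. F (\<sigma> s \<omega>) (seg s z) $ i - A $ i $ i * z s $ i)"
  define g where "g = (\<lambda>i s. F (\<sigma> s \<omega>) (seg s q) $ i - A $ i $ i * q s $ i)"
  define m where "m = (\<lambda>i s. min (f i s) (g i s))"
  have m_cont: "continuous_on S (m i)" for i S
  proof -
    have "continuous_on UNIV (m i)"
      unfolding m_def f_def g_def
      using zR entire_bound[OF q] evolves_continuous[OF z(1)] evolves_continuous[OF q0]
      by (intro continuous_intros continuous_on_F_along[of z 0 R] continuous_on_F_along[of q 0 R])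
    then show ?thesis by (rule continuous_on_subset) auto
  qed
  have m_bound: "\<bar>m i s\<bar> \<le> - A $ i $ i * C" if "s \<le> 0" for i s
  proof -
    have bound: "\<bar>F (\<sigma> s \<omega>) x $ i - A $ i $ i * v\<bar> \<le> - A $ i $ i * C" if "x \<in> B R" "\<bar>v\<bar> \<le> R" for x v
    proof -
      have "\<bar>A $ i $ i * v\<bar> \<le> - A $ i $ i * R"
        using A_negative[of i] that by (simp add: abs_mult mult_left_mono)
      then show ?thesis
        using M[OF that(1), of "\<sigma> s \<omega>" i] C(3)[of i] by linarith
    qed
    have "seg s z \<in> B R"
      using that zR by (intro seg_in_B evolves_continuous[OF z(1)]) auto
    then show ?thesis
      using bound[of "seg s z" "z s $ i"] bound[OF entire_in_B[OF q], of "q s $ i"]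
        zR[OF that, of i] entire_bound[OF q, of s i]
      by (auto simp: m_def f_def g_def min_def)
  qed
  \<comment> \<open>Variation of constants: \<open>exp (A $ i $ i * s) * I i s\<close> solves w' = A
    w + m after - N and vanishes at - N.\<close>
  define I where "I = (\<lambda>i s. integral {- N..s} (\<lambda>r. exp (- A $ i $ i * r) * m i r))"
  have int_cont: "continuous_on S (\<lambda>r. exp (- A $ i $ i * r) * m i r)" for i S
    by (intro continuous_intros m_cont)
  have I_deriv: "(I i has_real_derivative exp (- A $ i $ i * s) * m i s) (at s)" if "s > - N" for i s
  proof -
    have "(I i has_real_derivative exp (- A $ i $ i * s) * m i s) (at s within {- N..s + 1})"
      unfolding I_def using that by (intro integral_has_real_derivative int_cont) auto
    then show ?thesis
      using that by (subst (asm) at_within_interior) auto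
  qed
  have I_init: "I i s = 0" if "s \<le> - N" for i s
    using that by (cases "s = - N") (auto simp: I_def)
  have I_cont: "continuous_on UNIV (I i)" for i
  proof -
    have half: "continuous_on ({..- N} \<union> {- N..max (- N) T}) (I i)" for T
    proof (rule continuous_on_closed_Un)
      show "continuous_on {..- N} (I i)"
        using I_init by (subst continuous_on_cong[where g = "\<lambda>_. 0"]) auto
      show "continuous_on {- N..max (- N) T} (I i)"
        unfolding I_def by (intro indefinite_integral_continuous_1 integrable_continuous_interval int_cont)
    qed auto
    have "continuous_on {..<T} (I i)" for T
      using half[of T] by (rule continuous_on_subset) auto
    then have "continuous_on (\<Union>n. {..<real n}) (I i)"
      by (intro continuous_on_open_UN) auto
    moreover have "(\<Union>n. {..<real n}) = UNIV"
      using reals_Archimedean2 by auto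
    ultimately show ?thesis by simp
  qed
  \<comment> \<open>The truncations \<open>max\<close> and \<open>min\<close> put two regimes into
    one continuous formula: up to - N it is h shifted in time, afterwards h enters only through its
    last value.\<close>
  define w where "w = (\<lambda>s. \<chi> i. exp (A $ i $ i * (max (- N) s + N)) * hist_fun h (min 0 (s + N)) $ i + exp (A $ i $ i * s) * I i s)"
  have w_cont: "continuous_on UNIV w"
    unfolding w_def
    by (intro continuous_on_vec_lambda continuous_intros I_cont continuous_on_compose2[OF continuous_hist_fun]) auto
  then have w_cont': "continuous_on S w" for S
    by (rule continuous_on_subset) auto
  have w_early: "w s = hist_fun h (s + N)" if "s \<le> - N" for s
    using that by (simp add: w_def vec_eq_iff I_init)
  have w_deriv: "((\<lambda>s. w s $ i) has_real_derivative A $ i $ i * w s $ i + m i s) (at s)" if "s > - N" for i s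
  proof -
    have "((\<lambda>s. exp (A $ i $ i * (s + N)) * hist_fun h 0 $ i + exp (A $ i $ i * s) * I i s)
        has_real_derivative exp (A $ i $ i * (s + N)) * (A $ i $ i) * hist_fun h 0 $ i +
          (exp (A $ i $ i * s) * A $ i $ i * I i s + exp (A $ i $ i * s) * (exp (- A $ i $ i * s) * m i s))) (at s)"
      by (auto intro!: derivative_eq_intros I_deriv[OF that])
    moreover have "exp (A $ i $ i * s) * (exp (- A $ i $ i * s) * m i s) = m i s"
      by (simp add: mult.assoc[symmetric] exp_add[symmetric])
    moreover have "w s $ i = exp (A $ i $ i * (s + N)) * hist_fun h 0 $ i + exp (A $ i $ i * s) * I i s"
      using that by (simp add: w_def)
    then have "exp (A $ i $ i * (s + N)) * A $ i $ i * hist_fun h 0 $ i + (exp (A $ i $ i * s) * A $ i $ i * I i s + m i s) =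
        A $ i $ i * w s $ i + m i s"
      by (simp only: distrib_left mult_ac add_ac)
    ultimately have "((\<lambda>s. exp (A $ i $ i * (s + N)) * hist_fun h 0 $ i + exp (A $ i $ i * s) * I i s)
        has_real_derivative A $ i $ i * w s $ i + m i s) (at s)"
      by (simp only:)
    then show ?thesis
      by (rule has_field_derivative_transform_within_open[of _ _ _ "{- N<..}"])
        (use that in \<open>auto simp: w_def\<close>)
  qed
  have seg_w: "seg (- N) w = h"
    by (rule hist_eqI) (simp add: hist_fun_seg w_cont' w_early)
  have N: "- N \<le> 0"
    using \<open>N > 0\<close> by simp
  have le_z: "le_A A (seg 0 w) (seg 0 z)"
  proof (rule le_A_segI[OF w_cont' evolves_continuous[OF z(1)] N])
    fix i and r :: real assume r: "- N < r" "r < 0"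
    have "((\<lambda>r. z r $ i - w r $ i) has_real_derivative
        F (\<sigma> r \<omega>) (seg r z) $ i - (A $ i $ i * w r $ i + m i r)) (at r)"
      by (intro DERIV_diff w_deriv evolves_derivative[OF z(1)] r)
    moreover have "m i r \<le> f i r" by (simp add: m_def)
    ultimately show "\<exists>D. ((\<lambda>r. z r $ i - w r $ i) has_real_derivative D) (at r) \<and>
        A $ i $ i * (z r $ i - w r $ i) \<le> D"
      by (intro exI conjI) (assumption, simp add: f_def algebra_simps)
  qed (use h seg_w in auto)
  have le_q: "le_A A (seg 0 w) (seg 0 q)"
  proof (rule le_A_segI[OF w_cont' evolves_continuous[OF q0] N])
    fix i and r :: real assume r: "- N < r" "r < 0"
    have "((\<lambda>r. q r $ i - w r $ i) has_real_derivative
        F (\<sigma> r \<omega>) (seg r q) $ i - (A $ i $ i * w r $ i + m i r)) (at r)"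
      by (intro DERIV_diff w_deriv evolves_derivative[OF q0] r)
    moreover have "m i r \<le> g i r" by (simp add: m_def)
    ultimately show "\<exists>D. ((\<lambda>r. q r $ i - w r $ i) has_real_derivative D) (at r) \<and>
        A $ i $ i * (q r $ i - w r $ i) \<le> D"
      by (intro exI conjI) (assumption, simp add: g_def algebra_simps)
  qed (use h seg_w in auto)
  have "\<bar>w s $ i\<bar> \<le> C" if s: "s \<le> 0" for s i
  proof -
    have h_bound: "\<bar>hist_fun h r $ i\<bar> \<le> C" if "r \<le> 0" for r
      using B_mono[OF h(1) C(2)] that by (simp add: B_iff)
    have upper: "w s $ i \<le> C"
      using le_A_ge[OF le_z s, of i] zR[OF s, of i] C(1) s evolves_continuous[OF z(1)]
      by (simp add: hist_fun_seg w_cont' abs_le_iff)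
    have lower: "0 \<le> w s $ i + C"
    proof (cases "s \<le> - N")
      case True
      then show ?thesis
        using h_bound[of "s + N"] by (simp add: w_early abs_le_iff)
    next
      case False
      \<comment> \<open>The bound m \<ge> A C makes w + C satisfy v' \<ge> A v, so it stays
        nonnegative.\<close>
      have "0 \<le> exp (A $ i $ i * (s - - N)) * (w (- N) $ i + C)"
        using h_bound[of 0] by (simp add: w_early abs_le_iff)
      also have "\<dots> \<le> w s $ i + C"
      proof (rule exp_growth)
        fix r assume r: "- N < r" "r < s"
        have "((\<lambda>r. w r $ i + C) has_real_derivative A $ i $ i * w r $ i + m i r + 0) (at r)"
          by (intro DERIV_add w_deriv r) auto
        then show "\<exists>D. ((\<lambda>r. w r $ i + C) has_real_derivative D) (at r) \<and> A $ i $ i * (w r $ i + C) \<le> D"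
          using m_bound[of r i] r s by (intro exI conjI) (assumption, simp add: algebra_simps abs_le_iff)
      qed (use False in \<open>auto intro!: continuous_intros w_cont'\<close>)
      finally show ?thesis .
    qed
    show ?thesis
      using upper lower by (simp add: abs_le_iff)
  qed
  then have "seg 0 w \<in> B C"
    by (intro seg_in_B w_cont') auto
  moreover have "\<exists>D. ((\<lambda>s. z s $ i - w s $ i) has_real_derivative D) (at s) \<and> D \<le> A $ i $ i * (z s $ i - w s $ i) + \<eta>"
    if s: "- N < s" "s < 0" and \<eta>: "\<bar>(F (\<sigma> s \<omega>) (seg s z) $ i - A $ i $ i * z s $ i) -
        (F (\<sigma> s \<omega>) (seg s q) $ i - A $ i $ i * q s $ i)\<bar> \<le> \<eta>" for s i \<eta>
  proof -
    have "((\<lambda>r. z r $ i - w r $ i) has_real_derivative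
        F (\<sigma> s \<omega>) (seg s z) $ i - (A $ i $ i * w s $ i + m i s)) (at s)"
      by (intro DERIV_diff w_deriv evolves_derivative[OF z(1)] s)
    moreover have "f i s - m i s \<le> \<eta>"
      using \<eta> by (auto simp: m_def f_def g_def)
    ultimately show ?thesis
      by (intro exI conjI) (assumption, simp add: f_def algebra_simps)
  qed
  ultimately show ?thesis
    using that w_cont le_z le_q by blast
qed

text \<open>A common lower bound w of z and of the entire solution through y is compared with each
  of them by (5), and the triangle inequality removes the order. On [-N2,0] the gap v = z - w
  satisfies v' \<le> A v + \<eta>, so that a gap of size 2 C at - N2 has decayed below \<zeta> on
  [-N1,0]. Hence closeness is required on a fixed window only, and before it a bounded lower bound
  is enough.\<close>

lemma approx_stable:
  assumes "R > 0" "e > 0"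
  obtains d N\<^sub>0 where "d > 0"
    "\<And>\<omega> y z N h t \<omega>'. N \<ge> N\<^sub>0 \<Longrightarrow> evolves (- N) \<omega> z \<Longrightarrow> seg 0 z \<in> B R \<Longrightarrow> h \<in> B R \<Longrightarrow>
       le_A A h (seg (- N) z) \<Longrightarrow> le_A A h (const_hist 0) \<Longrightarrow> (\<omega>, y) \<in> EB R \<Longrightarrow>
       dist (seg 0 z) y < d \<Longrightarrow> t \<ge> 0 \<Longrightarrow> dist (u \<sigma> F t \<omega>' (seg 0 z)) (u \<sigma> F t \<omega>' y) < e"
proof -
  obtain \<alpha> where \<alpha>: "\<alpha> > 0" "\<And>i. A $ i $ i \<le> - \<alpha>"
    using decay_rate by blast
  obtain M where M: "M > 0" "\<And>\<omega> x i. x \<in> B R \<Longrightarrow> \<bar>F \<omega> x $ i\<bar> \<le> M"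
    by (rule F_bounded[OF \<open>R > 0\<close>]) blast
  obtain C1 where C1: "C1 > 0" "\<And>\<omega> x. (\<omega>, x) \<in> EB R \<Longrightarrow> le_A A (const_hist (- C1)) x"
    by (rule EB_ge_const[OF \<open>R > 0\<close>]) blast
  \<comment> \<open>R bounds z and q, \<open>R + C1\<close> bounds the shifted h, and
    \<open>M / \<alpha>\<close> absorbs the bound on F, since \<alpha> is at most every
    \<open>- A $ i $ i\<close>.\<close>
  define C where "C = R + C1 + M / \<alpha>"
  have C: "C \<ge> R" "C \<ge> R + C1" "C > 0" "M - A $ i $ i * R \<le> - A $ i $ i * C" for i
  proof -
    show "C \<ge> R" "C \<ge> R + C1" "C > 0"
      using \<open>R > 0\<close> C1(1) M(1) \<alpha>(1) by (auto simp: C_def intro: add_pos_nonneg)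
    have "M = \<alpha> * (M / \<alpha>)" using \<alpha>(1) by simp
    also have "\<dots> \<le> - A $ i $ i * (M / \<alpha>)"
      using \<alpha> M(1) by (intro mult_right_mono) (auto simp: le_minus_iff[of \<alpha>])
    finally have "M \<le> - A $ i $ i * (M / \<alpha>)" .
    moreover have "0 \<le> - A $ i $ i * C1"
      using A_negative[of i] C1(1) by (intro mult_nonneg_nonneg) auto
    ultimately show "M - A $ i $ i * R \<le> - A $ i $ i * C"
      by (simp add: C_def algebra_simps)
  qed
  obtain d5 where d5: "d5 > 0" "\<And>x y t \<omega>. x \<in> B C \<Longrightarrow> y \<in> B C \<Longrightarrow> dist x y < d5 \<Longrightarrow> le_A A x y \<Longrightarrow> t \<ge> 0 \<Longrightarrow>
    dist (u \<sigma> F t \<omega> x) (u \<sigma> F t \<omega> y) < e / 2"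
    by (rule stableD[of "e / 2"]) (use \<open>e > 0\<close> in auto)
  have "d5 / 2 > 0" using d5(1) by simp
  from dist_hist_lessI[OF this, where 'm = 'm] obtain N1 \<zeta> where N1: "N1 > 0" "\<zeta> > 0"
    "\<And>x y :: 'm hist. (\<forall>s i. - N1 \<le> s \<longrightarrow> s \<le> 0 \<longrightarrow>
        \<bar>hist_fun x s $ i - hist_fun y s $ i\<bar> \<le> \<zeta>) \<Longrightarrow> dist x y < d5 / 2"
    by blast
  have "((\<lambda>N. exp (- \<alpha> * (N - N1)) * (2 * C)) \<longlongrightarrow> 0) at_top"
    using \<alpha>(1) by real_asymp
  then have "\<forall>\<^sub>F N in at_top. exp (- \<alpha> * (N - N1)) * (2 * C) < \<zeta> / 2"
    using N1(2) by (intro order_tendstoD(2)) auto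
  then obtain N' where N': "\<And>N. N \<ge> N' \<Longrightarrow> exp (- \<alpha> * (N - N1)) * (2 * C) < \<zeta> / 2"
    unfolding eventually_at_top_linorder by blast
  define N2 where "N2 = max N' N1"
  have N2: "N2 \<ge> N1" "exp (- \<alpha> * (N2 - N1)) * (2 * C) < \<zeta> / 2"
    using N'[of N2] by (auto simp: N2_def)
  \<comment> \<open>The equation v' = - \<alpha> v + \<eta> has the equilibrium \<zeta> / 2; the
    other half of \<zeta> is left for the decaying gap at - N2.\<close>
  define \<eta> where "\<eta> = \<alpha> * (\<zeta> / 2)"
  define a1 where "a1 = (\<Sum>i\<in>UNIV. \<bar>A $ i $ i\<bar>)"
  have a1: "- A $ i $ i \<le> a1" "a1 \<ge> 0" for i
    using member_le_sum[of i UNIV "\<lambda>i. \<bar>A $ i $ i\<bar>"] by (auto simp: a1_def sum_nonneg)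
  \<comment> \<open>Errors of this size in F and in the values change F - A z by at most \<eta>,
    since a1 bounds every diagonal entry of A in absolute value.\<close>
  have "\<eta> / (1 + a1) > 0"
    using \<alpha>(1) N1(2) a1(2) by (auto simp: \<eta>_def intro!: divide_pos_pos)
  obtain d6 where d6: "d6 > 0" "\<And>\<omega> y z s i. (\<omega>, y) \<in> EB R \<Longrightarrow> continuous_on UNIV z \<Longrightarrow> seg 0 z \<in> B R \<Longrightarrow>
      dist (seg 0 z) y < d6 \<Longrightarrow> - N2 \<le> s \<Longrightarrow> s \<le> 0 \<Longrightarrow>
      \<bar>F (\<sigma> s \<omega>) (seg s z) $ i - F (\<sigma> s \<omega>) (seg s (sol \<omega> y)) $ i\<bar> < \<eta> / (1 + a1) \<and> \<bar>z s $ i - sol \<omega> y s $ i\<bar> < \<eta> / (1 + a1)"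
    by (rule F_close[OF \<open>R > 0\<close> \<open>\<eta> / (1 + a1) > 0\<close>, of N2]) blast
  define d where "d = min d6 (d5 / 2)"
  have main: "dist (u \<sigma> F t \<omega>' (seg 0 z)) (u \<sigma> F t \<omega>' y) < e"
    if N: "N \<ge> N2" and z: "evolves (- N) \<omega> z" "seg 0 z \<in> B R" and h: "h \<in> B R" "le_A A h (seg (- N) z)" "le_A A h (const_hist 0)"
      and y: "(\<omega>, y) \<in> EB R" and dist: "dist (seg 0 z) y < d" and t: "t \<ge> 0" for \<omega> y z N h t \<omega>'
  proof -
    define q where "q = sol \<omega> y"
    have q: "entire R \<omega> q"
      unfolding q_def by (rule EB_entire[OF y])
    have q0: "seg 0 q = y"
      using EB_in_BC[OF y] by (simp add: q_def)
    have h': "shift_hist (- C1) h \<in> B (R + C1)"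
    proof -
      have "\<bar>hist_fun h s $ i - C1\<bar> \<le> R + C1" if "s \<le> 0" for s i
      proof -
        have "\<bar>hist_fun h s $ i\<bar> \<le> R"
          using h(1) that by (simp add: B_iff)
        then show ?thesis
          using C1(1) by linarith
      qed
      then show ?thesis by (simp add: B_iff)
    qed
    have h1: "le_A A (shift_hist (- C1) h) (seg (- N) z)"
      by (rule le_A_trans[OF le_A_shift h(2)]) (use C1 in auto)
    \<comment> \<open>h lies below 0, hence after the shift below the constant - C1, which lies
      below every member of \<open>EB R\<close>.\<close>
    have h2: "le_A A (shift_hist (- C1) h) (seg (- N) q)"
      by (rule le_A_trans[OF le_A_shift_const[OF h(3)] C1(2)[OF EB_I[OF q]]])
    have "N > 0"
      using N N1(1) N2(1) by simp
    obtain w where w: "seg 0 w \<in> B C" "continuous_on UNIV w" "le_A A (seg 0 w) (seg 0 z)" "le_A A (seg 0 w) (seg 0 q)"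
    "\<forall>s i \<eta>. - N < s \<longrightarrow> s < 0 \<longrightarrow>
      \<bar>(F (\<sigma> s \<omega>) (seg s z) $ i - A $ i $ i * z s $ i) - (F (\<sigma> s \<omega>) (seg s q) $ i - A $ i $ i * q s $ i)\<bar> \<le> \<eta> \<longrightarrow>
      (\<exists>D. ((\<lambda>s. z s $ i - w s $ i) has_real_derivative D) (at s) \<and> D \<le> A $ i $ i * (z s $ i - w s $ i) + \<eta>)"
      by (rule lower_bound_history[OF \<open>N > 0\<close> z q M(2) h' h1 h2 C(1,2,4)]) blast
    have v_bound: "\<bar>z s $ i - w s $ i\<bar> \<le> 2 * C" if "s \<le> 0" for s i
    proof -
      have "\<bar>z s $ i\<bar> \<le> C" "\<bar>w s $ i\<bar> \<le> C"
        using z w(1,2) that B_mono[OF z(2) C(1)]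
        by (auto simp: B_iff hist_fun_seg continuous_on_subset[OF w(2)])
      then show ?thesis by linarith
    qed
    have v_nonneg: "0 \<le> z s $ i - w s $ i" if "s \<le> 0" for s i
      using le_A_ge[OF w(3) that, of i] that z(1) by (simp add: hist_fun_seg continuous_on_subset[OF w(2)])
    have v_small: "z s $ i - w s $ i \<le> \<zeta>" if s: "- N1 \<le> s" "s \<le> 0" for s i
    proof -
      \<comment> \<open>The difference of the equilibrium \<open>\<zeta> / 2\<close> and the gap
        satisfies v' \<ge> A v.\<close>
      have "exp (A $ i $ i * (s - - N2)) * (\<zeta> / 2 - (z (- N2) $ i - w (- N2) $ i)) \<le> \<zeta> / 2 - (z s $ i - w s $ i)"
      proof (rule exp_growth)
        show "- N2 \<le> s" using s N2(1) by simp
        show "continuous_on {- N2..s} (\<lambda>s. \<zeta> / 2 - (z s $ i - w s $ i))"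
          by (intro continuous_intros evolves_continuous[OF z(1)] continuous_on_subset[OF w(2)]) auto
        fix r assume r: "- N2 < r" "r < s"
        have close: "\<bar>F (\<sigma> r \<omega>) (seg r z) $ i - F (\<sigma> r \<omega>) (seg r q) $ i\<bar> < \<eta> / (1 + a1)" "\<bar>z r $ i - q r $ i\<bar> < \<eta> / (1 + a1)"
          using d6(2)[OF y evolves_continuous[OF z(1)] z(2), of r i] dist r s unfolding q_def d_def by auto
        have "\<bar>A $ i $ i * (z r $ i - q r $ i)\<bar> \<le> a1 * (\<eta> / (1 + a1))"
          unfolding abs_mult using close(2) a1(1)[of i] a1(2) A_negative[of i] by (intro mult_mono) auto
        moreover have "(1 + a1) * (\<eta> / (1 + a1)) = \<eta>"
          using a1(2) by simp
        then have "\<eta> / (1 + a1) + a1 * (\<eta> / (1 + a1)) = \<eta>"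
          by (simp only: distrib_right mult_1)
        ultimately have "\<bar>(F (\<sigma> r \<omega>) (seg r z) $ i - A $ i $ i * z r $ i) - (F (\<sigma> r \<omega>) (seg r q) $ i - A $ i $ i * q r $ i)\<bar> \<le> \<eta>"
          using close(1) by (simp add: right_diff_distrib)
        then obtain D where D: "((\<lambda>s. z s $ i - w s $ i) has_real_derivative D) (at r)"
          "D \<le> A $ i $ i * (z r $ i - w r $ i) + \<eta>"
          using w(5)[rule_format, of r i \<eta>] r s N by auto
        have "((\<lambda>s. \<zeta> / 2 - (z s $ i - w s $ i)) has_real_derivative 0 - D) (at r)"
          by (intro DERIV_diff D(1)) auto
        moreover have "A $ i $ i * (\<zeta> / 2) \<le> - \<eta>"
          using mult_right_mono[OF \<alpha>(2)[of i], of "\<zeta> / 2"] N1(2) by (simp add: \<eta>_def)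
        ultimately show "\<exists>D. ((\<lambda>s. \<zeta> / 2 - (z s $ i - w s $ i)) has_real_derivative D) (at r) \<and>
            A $ i $ i * (\<zeta> / 2 - (z r $ i - w r $ i)) \<le> D"
          using D(2) by (intro exI conjI) (assumption, simp add: right_diff_distrib)
      qed
      moreover have "exp (A $ i $ i * (s - - N2)) * ((z (- N2) $ i - w (- N2) $ i) - \<zeta> / 2) \<le> exp (- \<alpha> * (N2 - N1)) * (2 * C)"
      proof (rule order_trans)
        show "exp (A $ i $ i * (s - - N2)) * ((z (- N2) $ i - w (- N2) $ i) - \<zeta> / 2) \<le> exp (A $ i $ i * (s - - N2)) * (2 * C)"
          using v_bound[of "- N2" i] N1 N2(1) by (intro mult_left_mono) (auto simp: abs_le_iff)
        have "A $ i $ i * (s - - N2) \<le> - \<alpha> * (s - - N2)"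
          using \<alpha>(2) s N2(1) by (intro mult_right_mono) auto
        also have "\<dots> \<le> - \<alpha> * (N2 - N1)"
          using \<alpha>(1) s by (intro mult_left_mono_neg) auto
        finally show "exp (A $ i $ i * (s - - N2)) * (2 * C) \<le> exp (- \<alpha> * (N2 - N1)) * (2 * C)"
          using C(3) by (intro mult_right_mono) auto
      qed
      ultimately show ?thesis
        using N2(2) by (simp add: right_diff_distrib)
    qed
    have "dist (seg 0 w) (seg 0 z) < d5 / 2"
    proof (rule N1(3), intro allI impI)
      fix s i assume "- N1 \<le> s" "s \<le> (0 :: real)"
      then show "\<bar>hist_fun (seg 0 w) s $ i - hist_fun (seg 0 z) s $ i\<bar> \<le> \<zeta>"
        using v_small[of s i] v_nonneg[of s i] z(1) by (simp add: hist_fun_seg continuous_on_subset[OF w(2)])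
    qed
    moreover have "dist (seg 0 z) y < d5 / 2"
      using dist by (simp add: d_def)
    ultimately have *: "dist (seg 0 w) (seg 0 z) < d5" "dist (seg 0 w) y < d5"
      using dist_triangle[of "seg 0 w" y "seg 0 z"] d5(1) by linarith+
    have "dist (u \<sigma> F t \<omega>' (seg 0 w)) (u \<sigma> F t \<omega>' (seg 0 z)) < e / 2"
      by (rule d5(2)[OF w(1) B_mono[OF z(2) C(1)] *(1) w(3) t])
    moreover have "dist (u \<sigma> F t \<omega>' (seg 0 w)) (u \<sigma> F t \<omega>' y) < e / 2"
      using w(4) q0 by (intro d5(2)[OF w(1) B_mono[OF EB_in_B[OF y] C(1)] *(2) _ t]) auto
    ultimately show ?thesis
      using dist_triangle[of "u \<sigma> F t \<omega>' (seg 0 z)" "u \<sigma> F t \<omega>' y" "u \<sigma> F t \<omega>' (seg 0 w)"]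
        dist_commute[of "u \<sigma> F t \<omega>' (seg 0 z)" "u \<sigma> F t \<omega>' (seg 0 w)"] by linarith
  qed
  show ?thesis
  proof (rule that)
    show "d > 0" using d6(1) d5(1) by (simp add: d_def)
  qed (rule main)
qed

text \<open>An entire solution has the constant - C below it at all times, so
  \<open>approx_stable\<close> applies with this h at any N. Thus stability no longer requires the
  pair to be ordered.\<close>

lemma EB_stable:
  assumes "R > 0" "e > 0"
  obtains d where "d > 0" "\<And>\<omega> x y t. (\<omega>, x) \<in> EB R \<Longrightarrow> (\<omega>, y) \<in> EB R \<Longrightarrow> dist x y < d \<Longrightarrow> t \<ge> 0 \<Longrightarrow>
    dist (u \<sigma> F t \<omega> x) (u \<sigma> F t \<omega> y) < e"
proof -
  obtain C where C: "C > 0" "\<And>\<omega> x. (\<omega>, x) \<in> EB R \<Longrightarrow> le_A A (const_hist (- C)) x"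
    by (rule EB_ge_const[OF \<open>R > 0\<close>]) blast
  have "max R C > 0" using C(1) by simp
  obtain d N0 where d: "d > 0"
    "\<And>\<omega> y z N h t \<omega>'. N \<ge> N0 \<Longrightarrow> evolves (- N) \<omega> z \<Longrightarrow> seg 0 z \<in> B (max R C) \<Longrightarrow> h \<in> B (max R C) \<Longrightarrow>
       le_A A h (seg (- N) z) \<Longrightarrow> le_A A h (const_hist 0) \<Longrightarrow> (\<omega>, y) \<in> EB (max R C) \<Longrightarrow>
       dist (seg 0 z) y < d \<Longrightarrow> t \<ge> 0 \<Longrightarrow> dist (u \<sigma> F t \<omega>' (seg 0 z)) (u \<sigma> F t \<omega>' y) < e"
    by (rule approx_stable[OF \<open>max R C > 0\<close> \<open>e > 0\<close>]) blast
  have "dist (u \<sigma> F t \<omega> x) (u \<sigma> F t \<omega> y) < e"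
    if x: "(\<omega>, x) \<in> EB R" and y: "(\<omega>, y) \<in> EB R" and "dist x y < d" "t \<ge> 0" for \<omega> x y t
  proof -
    have seg: "seg 0 (sol \<omega> x) = x"
      using EB_in_BC[OF x] by simp
    have c0: "le_A A (const_hist (- C)) (const_hist 0)"
      using C(1) by (auto simp: le_A_iff intro!: mult_nonpos_nonneg less_imp_le[OF A_negative])
    have "dist (u \<sigma> F t \<omega> (seg 0 (sol \<omega> x))) (u \<sigma> F t \<omega> y) < e"
    proof (rule d(2)[OF order_refl entire_evolves[OF EB_entire[OF x]] _ _ C(2)[OF EB_I[OF EB_entire[OF x]]] c0])
      show "seg 0 (sol \<omega> x) \<in> B (max R C)"
        unfolding seg using EB_in_B[OF x] by (rule B_mono) simp
      show "const_hist (- C) \<in> B (max R C)"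
        using C(1) by (intro const_hist_in_B) auto
      show "(\<omega>, y) \<in> EB (max R C)"
        using EB_mono[of R "max R C"] y by auto
    qed (use that seg in auto)
    then show ?thesis by (simp only: seg)
  qed
  with d(1) that show ?thesis by blast
qed

end

section \<open>Fibre-stable flows over a minimal base\<close>

lemma continuous_flow_tendsto:
  assumes "continuous_flow \<sigma>" "(f \<longlongrightarrow> t) G" "(g \<longlongrightarrow> \<omega>) G"
  shows "((\<lambda>n. \<sigma> (f n) (g n)) \<longlongrightarrow> \<sigma> t \<omega>) G"
  using continuous_on_tendsto_compose[of UNIV "\<lambda>(t, \<omega>). \<sigma> t \<omega>", OF _ tendsto_Pair[OF assms(2,3)]] assms(1)
  by (simp add: continuous_flow_def)

lemma minimal_flow_reverse:
  fixes \<sigma> :: "real \<Rightarrow> 'o::metric_space \<Rightarrow> 'o"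
  assumes "minimal_flow \<sigma>"
  shows "minimal_flow (\<lambda>t. \<sigma> (- t))"
proof -
  have "range (\<lambda>t. \<sigma> (- t) \<omega>) = range (\<lambda>t. \<sigma> t \<omega>)" for \<omega>
  proof (intro equalityI subsetI)
    fix x assume "x \<in> range (\<lambda>t. \<sigma> t \<omega>)"
    then obtain t where "x = \<sigma> t \<omega>" by blast
    then have "x = \<sigma> (- (- t)) \<omega>" by simp
    then show "x \<in> range (\<lambda>t. \<sigma> (- t) \<omega>)" by (rule range_eqI)
  qed blast
  moreover have "continuous_on UNIV (\<lambda>(t, \<omega>). \<sigma> (- t) \<omega>)"
  proof -
    have "continuous_on UNIV (\<lambda>(t, \<omega>). \<sigma> t \<omega>)"
      using assms unfolding minimal_flow_def continuous_flow_def by blast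
    moreover have "continuous_on UNIV (\<lambda>p :: real \<times> 'o. (- fst p, snd p))"
      by (intro continuous_on_Pair continuous_on_minus continuous_on_fst continuous_on_snd continuous_on_id)
    ultimately have "continuous_on UNIV (\<lambda>p. (\<lambda>(t, \<omega>). \<sigma> t \<omega>) (- fst p, snd p))"
      by (rule continuous_on_compose2) simp
    then show ?thesis
      by (simp add: case_prod_beta)
  qed
  moreover have "\<sigma> (- (s + t)) \<omega> = \<sigma> (- s) (\<sigma> (- t) \<omega>)" for s t \<omega>
    using assms unfolding minimal_flow_def continuous_flow_def minus_add_distrib by blast
  moreover have "\<sigma> (- 0) \<omega> = \<omega>" for \<omega>
    using assms by (simp add: minimal_flow_def continuous_flow_def)
  ultimately show ?thesis
    using assms unfolding minimal_flow_def continuous_flow_def by auto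
qed

text \<open>Density of a two-sided orbit does not by itself give large positive times. The orbit of
  \<omega> accumulates at some l along times tending to infinity, and a fixed translate of l is
  close to the target because the orbit of l is dense as well.\<close>

lemma minimal_flow_recurrent:
  fixes \<sigma> :: "real \<Rightarrow> 'o::metric_space \<Rightarrow> 'o"
  assumes "compact (UNIV :: 'o set)" "minimal_flow \<sigma>" "e > 0"
  shows "\<exists>t\<ge>T. dist (\<sigma> t \<omega>) \<omega>' < e"
proof -
  have flow: "continuous_flow \<sigma>" and dense: "closure (range (\<lambda>t. \<sigma> t \<omega>)) = UNIV" for \<omega>
    using assms(2) by (auto simp: minimal_flow_def)
  obtain l r where r: "strict_mono (r :: nat \<Rightarrow> nat)" "(\<lambda>n. \<sigma> (real (r n)) \<omega>) \<longlonglongrightarrow> l"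
    using assms(1)[unfolded compact_def, rule_format, of "\<lambda>n. \<sigma> (real n) \<omega>"] by (auto simp: o_def)
  obtain s where s: "dist (\<sigma> s l) \<omega>' < e"
    using dense[of l] \<open>e > 0\<close> closure_approachable[of \<omega>' "range (\<lambda>t. \<sigma> t l)"] by auto
  have "(\<lambda>n. \<sigma> (s + real (r n)) \<omega>) \<longlonglongrightarrow> \<sigma> s l"
    using continuous_flow_tendsto[OF flow tendsto_const r(2), of s] flow
    by (simp add: continuous_flow_def)
  then have "(\<lambda>n. dist (\<sigma> (s + real (r n)) \<omega>) \<omega>') \<longlonglongrightarrow> dist (\<sigma> s l) \<omega>'"
    by (intro tendsto_intros)
  then have "\<forall>\<^sub>F n in sequentially. dist (\<sigma> (s + real (r n)) \<omega>) \<omega>' < e"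
    using s by (rule order_tendstoD(2))
  moreover have "\<forall>\<^sub>F n in sequentially. T - s \<le> real (r n)"
    using filterlim_strict_mono_subseq[OF r(1) filterlim_real_sequentially] by (simp add: filterlim_at_top)
  ultimately have "\<forall>\<^sub>F n in sequentially. dist (\<sigma> (s + real (r n)) \<omega>) \<omega>' < e \<and> T - s \<le> real (r n)"
    by (rule eventually_conj)
  then obtain n where "dist (\<sigma> (s + real (r n)) \<omega>) \<omega>' < e" "T - s \<le> real (r n)"
    using eventually_happens trivial_limit_sequentially by blast
  then show ?thesis
    by (intro exI[of _ "s + real (r n)"]) auto
qed

text \<open>\<open>EB R\<close> with \<open>\<tau>\<close> and the first projection is the case in
  mind. Stability holds forward in time and for pairs over the same base point only; the proofs
  therefore go back in time, compare inside one fibre and return.\<close>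

locale fibred_flow =
  fixes \<sigma> :: "real \<Rightarrow> 'o::metric_space \<Rightarrow> 'o"
    and Z :: "'z::metric_space set" and \<theta> :: "real \<Rightarrow> 'z \<Rightarrow> 'z" and \<pi> :: "'z \<Rightarrow> 'o"
  assumes base_compact: "compact (UNIV :: 'o set)"
    and base_minimal: "minimal_flow \<sigma>"
    and compact_Z: "compact Z"
    and \<theta>_in: "\<And>z t. z \<in> Z \<Longrightarrow> \<theta> t z \<in> Z"
    and \<theta>_0: "\<And>z. z \<in> Z \<Longrightarrow> \<theta> 0 z = z"
    and \<theta>_add: "\<And>z s t. z \<in> Z \<Longrightarrow> \<theta> (s + t) z = \<theta> s (\<theta> t z)"
    and \<theta>_cont: "\<And>t. continuous_on Z (\<theta> t)"
    and \<pi>_cont: "continuous_on Z \<pi>"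
    and \<pi>_\<theta>: "\<And>z t. z \<in> Z \<Longrightarrow> \<pi> (\<theta> t z) = \<sigma> t (\<pi> z)"
    and fibre_stable: "\<And>e. e > 0 \<Longrightarrow> \<exists>d>0. \<forall>z\<in>Z. \<forall>z'\<in>Z. \<pi> z = \<pi> z' \<longrightarrow> dist z z' < d \<longrightarrow>
      (\<forall>t\<ge>0. dist (\<theta> t z) (\<theta> t z') < e)"
begin

definition invariant :: "'z set \<Rightarrow> bool" where
  "invariant L \<longleftrightarrow> L \<subseteq> Z \<and> closed L \<and> (\<forall>z\<in>L. \<forall>t. \<theta> t z \<in> L)"

lemma invariant_compact: "invariant L \<Longrightarrow> compact L"
  using compact_Int_closed[OF compact_Z, of L] by (simp add: invariant_def Int_absorb1)

lemma \<theta>_cancel: "z \<in> Z \<Longrightarrow> \<theta> t (\<theta> (- t) z) = z" "z \<in> Z \<Longrightarrow> \<theta> (- t) (\<theta> t z) = z"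
  using \<theta>_add[of z t "- t"] \<theta>_add[of z "- t" t] \<theta>_0 by auto

text \<open>The image of L in the base is compact and contains a whole orbit, which is dense by
  minimality.\<close>

lemma fibre_nonempty:
  assumes L: "invariant L" "L \<noteq> {}"
  shows "\<exists>z\<in>L. \<pi> z = \<omega>"
proof -
  obtain z where z: "z \<in> L" using L(2) by blast
  have "\<sigma> t (\<pi> z) \<in> \<pi> ` L" for t
    using z L(1) \<pi>_\<theta>[of z t] by (auto simp: invariant_def image_iff subset_iff) metis
  then have "closure (range (\<lambda>t. \<sigma> t (\<pi> z))) \<subseteq> \<pi> ` L"
    using L(1) invariant_compact[OF L(1)]
    by (intro closure_minimal compact_imp_closed compact_continuous_image continuous_on_subset[OF \<pi>_cont])
      (auto simp: invariant_def)
  then have "\<pi> ` L = UNIV"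
    using base_minimal by (auto simp: minimal_flow_def)
  then show ?thesis by (metis UNIV_I imageE)
qed

text \<open>The set of pieces of a finite cover that a fibre meets is upper semicontinuous in the base
  point, hence locally constant where its cardinality is minimal.\<close>

lemma fibres_locally_close:
  assumes L: "invariant L" and "d > 0"
  obtains U where "open U" "U \<noteq> {}"
    "\<And>z \<omega>. z \<in> L \<Longrightarrow> \<pi> z \<in> U \<Longrightarrow> \<omega> \<in> U \<Longrightarrow> \<exists>y\<in>L. \<pi> y = \<omega> \<and> dist y z < d"
proof -
  have "\<exists>D. finite D \<and> D \<subseteq> L \<and> L \<subseteq> (\<Union>x\<in>D. ball x (d / 3))"
    using seq_compact_imp_totally_bounded[OF compact_imp_seq_compact[OF invariant_compact[OF L]]] \<open>d > 0\<close>
    by (metis zero_less_divide_iff zero_less_numeral)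
  then obtain D where D: "finite D" "L \<subseteq> (\<Union>x\<in>D. ball x (d / 3))" by blast
  define P where "P = (\<lambda>c. \<pi> ` (L \<inter> cball c (d / 3)))"
  define I where "I = (\<lambda>\<omega>. {c\<in>D. \<omega> \<in> P c})"
  have P: "closed (P c)" for c
  proof -
    have "compact (L \<inter> cball c (d / 3))"
      by (rule compact_Int_closed[OF invariant_compact[OF L] closed_cball])
    then show ?thesis
      using L unfolding P_def
      by (intro compact_imp_closed compact_continuous_image continuous_on_subset[OF \<pi>_cont])
        (auto simp: invariant_def)
  qed
  obtain \<omega>1 where \<omega>1: "\<And>\<omega>. card (I \<omega>1) \<le> card (I \<omega>)"
    using ex_has_least_nat[of "\<lambda>_. True" _ "\<lambda>\<omega>. card (I \<omega>)"] by blast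
  define U where "U = - (\<Union>c\<in>D - I \<omega>1. P c)"
  have "open U"
    unfolding U_def using D(1) P by (intro open_Compl closed_UN) auto
  moreover have "\<omega>1 \<in> U"
    by (auto simp: U_def I_def)
  moreover have I_eq: "I \<omega> = I \<omega>1" if "\<omega> \<in> U" for \<omega>
    using that D(1) by (intro card_subset_eq le_antisym \<omega>1 card_mono) (auto simp: U_def I_def)
  have "\<exists>y\<in>L. \<pi> y = \<omega> \<and> dist y z < d" if z: "z \<in> L" "\<pi> z \<in> U" and "\<omega> \<in> U" for z \<omega>
  proof -
    obtain c where c: "c \<in> D" "dist c z < d / 3"
      using D(2) z(1) by (auto simp: subset_iff)
    then have "c \<in> I (\<pi> z)"
      using z(1) by (auto simp: I_def P_def)
    then have "\<omega> \<in> P c"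
      using I_eq[OF z(2)] I_eq[OF \<open>\<omega> \<in> U\<close>] by (auto simp: I_def)
    then obtain y where "y \<in> L" "\<pi> y = \<omega>" "dist c y \<le> d / 3"
      by (auto simp: P_def)
    then show ?thesis
      using c(2) dist_triangle3[of y z c] \<open>d > 0\<close> by (intro bexI[of _ y]) auto
  qed
  ultimately show ?thesis
    using that by blast
qed

text \<open>By recurrence of the reversed base flow, z is pulled back to a point z' over the open
  set U on which the fibres are close to each other. Points of nearby fibres are found close to z',
  and pushing them forward brings them close to z by stability.\<close>

lemma fibre_lower_semicontinuous:
  assumes L: "invariant L" and z: "z \<in> L" and "e > 0"
  shows "\<exists>\<eta>>0. \<forall>\<omega>. dist \<omega> (\<pi> z) < \<eta> \<longrightarrow> (\<exists>y\<in>L. \<pi> y = \<omega> \<and> dist y z < e)"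
proof (rule ccontr)
  assume "\<not> ?thesis"
  then have neg: "\<exists>\<omega>. dist \<omega> (\<pi> z) < \<eta> \<and> \<not> (\<exists>y\<in>L. \<pi> y = \<omega> \<and> dist y z < e)" if "\<eta> > 0" for \<eta>
    using that by blast
  have "\<exists>\<omega>. dist \<omega> (\<pi> z) < inverse (real (Suc n)) \<and> \<not> (\<exists>y\<in>L. \<pi> y = \<omega> \<and> dist y z < e)" for n
    by (rule neg) simp
  then obtain \<omega> where \<omega>: "\<And>n. dist (\<omega> n) (\<pi> z) < inverse (real (Suc n))"
    "\<And>n. \<not> (\<exists>y\<in>L. \<pi> y = \<omega> n \<and> dist y z < e)"
    by metis
  have "(\<lambda>n. dist (\<omega> n) (\<pi> z)) \<longlonglongrightarrow> 0"
    by (rule Lim_null_comparison[OF _ LIMSEQ_inverse_real_of_nat])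
      (use \<omega>(1) in \<open>auto intro!: always_eventually less_imp_le simp del: of_nat_Suc\<close>)
  then have \<omega>_lim: "\<omega> \<longlonglongrightarrow> \<pi> z"
    by (rule iffD2[OF tendsto_dist_iff])
  have LZ: "L \<subseteq> Z" "\<And>z t. z \<in> L \<Longrightarrow> \<theta> t z \<in> L"
    using L by (auto simp: invariant_def)
  obtain d where d: "d > 0" "\<And>z z' t. z \<in> Z \<Longrightarrow> z' \<in> Z \<Longrightarrow> \<pi> z = \<pi> z' \<Longrightarrow> dist z z' < d \<Longrightarrow> t \<ge> 0 \<Longrightarrow>
      dist (\<theta> t z) (\<theta> t z') < e"
    using fibre_stable[OF \<open>e > 0\<close>] by metis
  have "d / 2 > 0" using d(1) by simp
  obtain U where U: "open U" "U \<noteq> {}"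
    "\<And>z \<omega>. z \<in> L \<Longrightarrow> \<pi> z \<in> U \<Longrightarrow> \<omega> \<in> U \<Longrightarrow> \<exists>y\<in>L. \<pi> y = \<omega> \<and> dist y z < d / 2"
    by (rule fibres_locally_close[OF L \<open>d / 2 > 0\<close>]) blast
  obtain \<omega>1 r where "r > 0" "ball \<omega>1 r \<subseteq> U"
    using U(1,2) by (metis all_not_in_conv openE)
  moreover obtain s where "s \<ge> 0" "dist (\<sigma> (- s) (\<pi> z)) \<omega>1 < r"
    using minimal_flow_recurrent[OF base_compact minimal_flow_reverse[OF base_minimal] \<open>r > 0\<close>] by blast
  ultimately have s: "s \<ge> 0" "\<sigma> (- s) (\<pi> z) \<in> U"
    by (auto simp: dist_commute subset_iff)
  define z' where "z' = \<theta> (- s) z"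
  have z': "z' \<in> L" "\<pi> z' = \<sigma> (- s) (\<pi> z)" "\<theta> s z' = z"
    using z LZ \<pi>_\<theta>[of z "- s"] \<theta>_cancel(1)[of z s] by (auto simp: z'_def)
  have flow: "continuous_flow \<sigma>"
    using base_minimal by (simp add: minimal_flow_def)
  have "(\<lambda>n. \<sigma> (- s) (\<omega> n)) \<longlonglongrightarrow> \<sigma> (- s) (\<pi> z)"
    by (intro continuous_flow_tendsto[OF flow] tendsto_const \<omega>_lim)
  then have "\<forall>\<^sub>F n in sequentially. \<sigma> (- s) (\<omega> n) \<in> U"
    using U(1) s(2) by (rule topological_tendstoD)
  then obtain K where K: "\<And>n. n \<ge> K \<Longrightarrow> \<sigma> (- s) (\<omega> n) \<in> U"
    by (auto simp: eventually_sequentially)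
  have "\<exists>y\<in>L. \<pi> y = \<sigma> (- s) (\<omega> (n + K)) \<and> dist y z' < d / 2" for n
    using U(3)[OF z'(1), of "\<sigma> (- s) (\<omega> (n + K))"] z'(2) s(2) K[of "n + K"] by auto
  then obtain y where y: "\<And>n. y n \<in> L" "\<And>n. \<pi> (y n) = \<sigma> (- s) (\<omega> (n + K))" "\<And>n. dist (y n) z' < d / 2"
    by metis
  \<comment> \<open>The y n lie in varying fibres, where stability does not compare them with z'.
    Their limit l lies in the fibre of z', and continuity of the time s map returns to the y
    n.\<close>
  obtain l r where l: "l \<in> L" "strict_mono (r :: nat \<Rightarrow> nat)" "(\<lambda>n. y (r n)) \<longlonglongrightarrow> l"
    using invariant_compact[OF L, unfolded compact_def, rule_format, of y] y(1) by (auto simp: o_def)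
  have \<omega>K: "(\<lambda>n. \<omega> (r n + K)) \<longlonglongrightarrow> \<pi> z"
    using filterlim_strict_mono_subseq[OF l(2) LIMSEQ_ignore_initial_segment[OF \<omega>_lim]] .
  have "(\<lambda>n. \<pi> (y (r n))) \<longlonglongrightarrow> \<pi> l"
    using l y(1) LZ(1) by (intro continuous_on_tendsto_compose[OF \<pi>_cont]) (auto intro!: always_eventually)
  moreover have "(\<lambda>n. \<pi> (y (r n))) \<longlonglongrightarrow> \<sigma> (- s) (\<pi> z)"
    unfolding y(2) by (intro continuous_flow_tendsto[OF flow] tendsto_const \<omega>K)
  ultimately have "\<pi> l = \<pi> z'"
    unfolding z'(2) by (rule LIMSEQ_unique)
  moreover have "dist l z' \<le> d / 2"
    by (rule tendsto_upperbound[OF tendsto_dist[OF l(3) tendsto_const]])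
      (use y(3) in \<open>auto intro!: always_eventually less_imp_le\<close>)
  ultimately have "dist (\<theta> s l) (\<theta> s z') < e"
    using d(1) l(1) z'(1) LZ(1) s(1) by (intro d(2)) auto
  moreover have "(\<lambda>n. dist (\<theta> s (y (r n))) z) \<longlonglongrightarrow> dist (\<theta> s l) z"
    using l y(1) LZ(1)
    by (intro tendsto_dist tendsto_const continuous_on_tendsto_compose[OF \<theta>_cont]) (auto intro!: always_eventually)
  ultimately have "\<forall>\<^sub>F n in sequentially. dist (\<theta> s (y (r n))) z < e"
    unfolding z'(3) by (intro order_tendstoD(2))
  then obtain n where n: "dist (\<theta> s (y (r n))) z < e"
    using eventually_happens trivial_limit_sequentially by blast
  have "\<pi> (\<theta> s (y (r n))) = \<sigma> s (\<sigma> (- s) (\<omega> (r n + K)))"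
    using \<pi>_\<theta>[of "y (r n)" s] y(1,2) LZ(1) by auto
  also have "\<dots> = \<omega> (r n + K)"
    using flow unfolding continuous_flow_def by (metis add.right_inverse)
  finally show False
    using \<omega>(2)[of "r n + K"] n y(1) LZ(2) by blast
qed

text \<open>A point of L nearest to z is chosen in each fibre; it exists by compactness, and lower
  semicontinuity forces its distance from z to 0.\<close>

lemma fibre_lift_sequence:
  assumes L: "invariant L" and z: "z \<in> L" and \<omega>: "\<omega> \<longlonglongrightarrow> \<pi> z"
  obtains y where "\<And>n :: nat. y n \<in> L" "\<And>n. \<pi> (y n) = \<omega> n" "y \<longlonglongrightarrow> z"
proof -
  have "\<exists>y\<in>L. \<pi> y = \<omega> n \<and> (\<forall>y'\<in>L. \<pi> y' = \<omega> n \<longrightarrow> dist y z \<le> dist y' z)" for n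
  proof -
    have "compact {y\<in>L. \<pi> y = \<omega> n}"
    proof -
      have "closed (L \<inter> \<pi> -` {\<omega> n})"
        using L by (intro continuous_closed_preimage continuous_on_subset[OF \<pi>_cont]) (auto simp: invariant_def)
      then have "compact (L \<inter> (L \<inter> \<pi> -` {\<omega> n}))"
        by (rule compact_Int_closed[OF invariant_compact[OF L]])
      moreover have "L \<inter> (L \<inter> \<pi> -` {\<omega> n}) = {y\<in>L. \<pi> y = \<omega> n}" by auto
      ultimately show ?thesis by simp
    qed
    moreover have "{y\<in>L. \<pi> y = \<omega> n} \<noteq> {}"
      using fibre_nonempty[OF L, of "\<omega> n"] z by blast
    moreover have "continuous_on {y\<in>L. \<pi> y = \<omega> n} (\<lambda>y. dist y z)"
      by (intro continuous_intros)
    ultimately obtain y where "y \<in> {y\<in>L. \<pi> y = \<omega> n}" "\<forall>y'\<in>{y\<in>L. \<pi> y = \<omega> n}. dist y z \<le> dist y' z"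
      using continuous_attains_inf by blast
    then show ?thesis by blast
  qed
  then obtain y where y: "\<And>n. y n \<in> L" "\<And>n. \<pi> (y n) = \<omega> n" "\<And>n y'. y' \<in> L \<Longrightarrow> \<pi> y' = \<omega> n \<Longrightarrow> dist (y n) z \<le> dist y' z"
    by metis
  have "y \<longlonglongrightarrow> z"
  proof (rule tendstoI)
    fix e :: real assume "e > 0"
    from fibre_lower_semicontinuous[OF L z this] obtain \<eta> where \<eta>: "\<eta> > 0"
      "\<And>\<omega>. dist \<omega> (\<pi> z) < \<eta> \<Longrightarrow> \<exists>y\<in>L. \<pi> y = \<omega> \<and> dist y z < e"
      by blast
    show "\<forall>\<^sub>F n in sequentially. dist (y n) z < e"
      using tendstoD[OF \<omega> \<eta>(1)]
      by eventually_elim (use \<eta>(2) y(3) le_less_trans in blast)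
  qed
  with y(1,2) that show ?thesis by blast
qed

definition alpha_limit :: "'z \<Rightarrow> 'z set" where
  "alpha_limit p = {q\<in>Z. \<forall>e>0. \<forall>T. \<exists>s\<le>T. dist (\<theta> s p) q < e}"

lemma invariant_alpha_limit:
  assumes p: "p \<in> Z"
  shows "invariant (alpha_limit p)"
  unfolding invariant_def
proof (intro conjI ballI allI)
  show "alpha_limit p \<subseteq> Z"
    by (auto simp: alpha_limit_def)
  show "closed (alpha_limit p)"
    unfolding closed_sequential_limits
  proof (intro allI impI)
    fix x l assume x: "(\<forall>n. x n \<in> alpha_limit p) \<and> x \<longlonglongrightarrow> l"
    have "l \<in> Z"
      using x compact_imp_closed[OF compact_Z] closed_sequentially[of Z x l] by (auto simp: alpha_limit_def)
    moreover have "\<exists>s\<le>T. dist (\<theta> s p) l < e" if "e > 0" for e T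
    proof -
      have "\<forall>\<^sub>F n in sequentially. dist (x n) l < e / 2"
        using x that by (intro tendstoD) auto
      then obtain n where n: "dist (x n) l < e / 2"
        using eventually_happens trivial_limit_sequentially by blast
      have "e / 2 > 0" "x n \<in> alpha_limit p"
        using x that by auto
      then obtain s where "s \<le> T" "dist (\<theta> s p) (x n) < e / 2"
        unfolding alpha_limit_def by blast
      then show ?thesis
        using n dist_triangle_half_l[of "\<theta> s p" "x n" e l] dist_commute by metis
    qed
    ultimately show "l \<in> alpha_limit p"
      by (simp add: alpha_limit_def)
  qed
  fix q t assume q: "q \<in> alpha_limit p"
  then have "q \<in> Z" by (simp add: alpha_limit_def)
  have "\<exists>s\<le>T. dist (\<theta> s p) (\<theta> t q) < e" if "e > 0" for e T
  proof -
    obtain d where d: "d > 0" "\<And>z. z \<in> Z \<Longrightarrow> dist z q < d \<Longrightarrow> dist (\<theta> t z) (\<theta> t q) < e"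
      using \<theta>_cont[of t] \<open>q \<in> Z\<close> \<open>e > 0\<close> unfolding continuous_on_iff by metis
    obtain s where s: "s \<le> T - t" "dist (\<theta> s p) q < d"
      using q d(1) unfolding alpha_limit_def by blast
    then show ?thesis
      using d(2)[of "\<theta> s p"] p \<theta>_in \<theta>_add[OF p, of t s] by (intro exI[of _ "t + s"]) auto
  qed
  then show "\<theta> t q \<in> alpha_limit p"
    using \<theta>_in[OF \<open>q \<in> Z\<close>] by (simp add: alpha_limit_def)
qed

lemma alpha_limit_nonempty:
  assumes p: "p \<in> Z"
  shows "alpha_limit p \<noteq> {}"
proof -
  obtain l r where l: "l \<in> Z" "strict_mono (r :: nat \<Rightarrow> nat)" "(\<lambda>n. \<theta> (- real (r n)) p) \<longlonglongrightarrow> l"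
    using compact_Z[unfolded compact_def, rule_format, of "\<lambda>n. \<theta> (- real n) p"] \<theta>_in[OF p] by (auto simp: o_def)
  have "\<exists>s\<le>T. dist (\<theta> s p) l < e" if "e > 0" for e T
  proof -
    have "\<forall>\<^sub>F n in sequentially. - T \<le> real (r n)"
      using filterlim_strict_mono_subseq[OF l(2) filterlim_real_sequentially] by (simp add: filterlim_at_top)
    then have "\<forall>\<^sub>F n in sequentially. dist (\<theta> (- real (r n)) p) l < e \<and> - T \<le> real (r n)"
      using tendstoD[OF l(3) that] by (rule eventually_conj[rotated])
    then obtain n where "dist (\<theta> (- real (r n)) p) l < e" "- T \<le> real (r n)"
      using eventually_happens trivial_limit_sequentially by blast
    then show ?thesis
      by (intro exI[of _ "- real (r n)"]) auto
  qed
  with l(1) have "l \<in> alpha_limit p"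
    by (simp add: alpha_limit_def)
  then show ?thesis by blast
qed

text \<open>At some time s \<le> 0 the orbit of p is close to q. Lower semicontinuity gives a point
  y of L in the same fibre and close to the orbit; moving forward by - s, stability keeps y close,
  so points of L come arbitrarily close to p.\<close>

lemma mem_of_alpha_limit:
  assumes p: "p \<in> Z" and q: "q \<in> alpha_limit p" and L: "invariant L" "q \<in> L"
  shows "p \<in> L"
proof -
  have "\<exists>y\<in>L. dist y p < e" if "e > 0" for e
  proof -
    obtain d where d: "d > 0" "\<And>z z' t. z \<in> Z \<Longrightarrow> z' \<in> Z \<Longrightarrow> \<pi> z = \<pi> z' \<Longrightarrow> dist z z' < d \<Longrightarrow> t \<ge> 0 \<Longrightarrow>
        dist (\<theta> t z) (\<theta> t z') < e"
      using fibre_stable[OF \<open>e > 0\<close>] by metis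
    have "d / 2 > 0" using d(1) by simp
    obtain \<eta> where \<eta>: "\<eta> > 0" "\<And>\<omega>. dist \<omega> (\<pi> q) < \<eta> \<Longrightarrow> \<exists>y\<in>L. \<pi> y = \<omega> \<and> dist y q < d / 2"
      using fibre_lower_semicontinuous[OF L \<open>d / 2 > 0\<close>] by blast
    have qZ: "q \<in> Z" using q by (simp add: alpha_limit_def)
    obtain \<kappa> where \<kappa>: "\<kappa> > 0" "\<And>z. z \<in> Z \<Longrightarrow> dist z q < \<kappa> \<Longrightarrow> dist (\<pi> z) (\<pi> q) < \<eta>"
      using \<pi>_cont qZ \<eta>(1) unfolding continuous_on_iff by metis
    have "min \<kappa> (d / 2) > 0" using \<kappa>(1) d(1) by simp
    then obtain s where s: "s \<le> 0" "dist (\<theta> s p) q < min \<kappa> (d / 2)"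
      using q unfolding alpha_limit_def by blast
    obtain y where y: "y \<in> L" "\<pi> y = \<pi> (\<theta> s p)" "dist y q < d / 2"
      using \<eta>(2)[OF \<kappa>(2)[OF \<theta>_in[OF p]]] s(2) by (metis min_less_iff_conj)
    have "dist y (\<theta> s p) < d"
      using y(3) s(2) dist_triangle2[of y "\<theta> s p" q] by linarith
    then have "dist (\<theta> (- s) y) (\<theta> (- s) (\<theta> s p)) < e"
      using y L s(1) by (intro d(2) \<theta>_in p) (auto simp: invariant_def)
    then have "dist (\<theta> (- s) y) p < e"
      by (simp add: \<theta>_cancel p)
    moreover have "\<theta> (- s) y \<in> L"
      using y(1) L(1) by (simp add: invariant_def)
    ultimately show ?thesis by blast
  qed
  then have "p \<in> closure L"
    by (simp add: closure_approachable)
  then show ?thesis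
    using L(1) by (simp add: invariant_def)
qed

lemma mem_alpha_limit:
  assumes p: "p \<in> Z"
  shows "p \<in> alpha_limit p"
  using alpha_limit_nonempty[OF p] mem_of_alpha_limit[OF p _ invariant_alpha_limit[OF p]] by blast

end

section \<open>The greatest entire solution below an invariant set\<close>

text \<open>The solution bounded on the whole line is the integral of exp (- k (s - r)) m r over r
  \<le> s. The improper integral is obtained as a monotone limit.\<close>

lemma bounded_linear_solution:
  fixes m :: "real \<Rightarrow> real"
  assumes "k > 0" and m: "continuous_on UNIV m" "\<And>s. 0 \<le> m s" "\<And>s. m s \<le> M"
  obtains v where "\<And>s. (v has_real_derivative - k * v s + m s) (at s)" "\<And>s. 0 \<le> v s" "\<And>s. v s \<le> M / k"
proof -
  define g where "g = (\<lambda>s. exp (k * s) * m s)"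
  have g_cont: "continuous_on S g" for S
    unfolding g_def by (intro continuous_intros continuous_on_subset[OF m(1)]) auto
  have g_int: "g integrable_on {a..b}" for a b
    by (intro integrable_continuous_interval g_cont)
  have g0: "0 \<le> g s" "\<bar>g s\<bar> \<le> M * exp (k * s)" for s
    using m(2,3)[of s] by (auto simp: g_def abs_mult)
  have "0 \<le> M"
    using m(2,3)[of 0] by simp
  \<comment> \<open>For s below - n the interval is empty and the integral is 0, so that
    monotonicity in n holds for all n.\<close>
  define G where "G = (\<lambda>n s. integral {- real n..s} g)"
  have G_split: "G n s = G n b + integral {b..s} g" if "- real n \<le> b" "b \<le> s" for n b s
    unfolding G_def using Henstock_Kurzweil_Integration.integral_combine[OF that g_int] by simp
  have G_bound: "G n s \<le> M / k * exp (k * s)" for n s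
  proof (cases "- real n \<le> s")
    case True
    have "\<bar>G n s\<bar> \<le> M / k * exp (k * s)"
    proof (rule exp_derivative_bound[OF \<open>k > 0\<close> True])
      show "continuous_on {- real n..s} (G n)"
        unfolding G_def by (intro indefinite_integral_continuous_1 g_int)
      fix r assume r: "- real n < r" "r < s"
      have "(G n has_real_derivative g r) (at r within {- real n..s})"
        unfolding G_def using r by (intro integral_has_real_derivative g_cont) auto
      then have "(G n has_real_derivative g r) (at r)"
        using r by (subst (asm) at_within_interior) auto
      then show "\<exists>D. (G n has_real_derivative D) (at r) \<and> \<bar>D\<bar> \<le> M * exp (k * r)"
        using g0(2) by blast
    qed (use True \<open>0 \<le> M\<close> in \<open>auto simp: G_def\<close>)
    then show ?thesis by simp
  qed (use \<open>k > 0\<close> \<open>0 \<le> M\<close> in \<open>auto simp: G_def\<close>)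
  have G_mono: "incseq (\<lambda>n. G n s)" for s
  proof (rule incseq_SucI)
    fix n
    show "G n s \<le> G (Suc n) s"
    proof (cases "- real n \<le> s")
      case True
      have "0 \<le> G (Suc n) (- real n)"
        unfolding G_def by (intro integral_nonneg g_int g0)
      moreover have "G (Suc n) s = G (Suc n) (- real n) + G n s"
        using G_split[of "Suc n" "- real n" s] True by (simp add: G_def)
      ultimately show ?thesis by simp
    next
      case False
      then have "G n s = 0" by (simp add: G_def)
      also have "0 \<le> G (Suc n) s"
        unfolding G_def by (intro integral_nonneg g_int g0)
      finally show ?thesis .
    qed
  qed
  have "\<exists>l. (\<lambda>n. G n s) \<longlonglongrightarrow> l" for s
    using incseq_convergent[OF G_mono, of s "M / k * exp (k * s)"] G_bound by blast
  then obtain I where I: "\<And>s. (\<lambda>n. G n s) \<longlonglongrightarrow> I s"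
    by metis
  have I_split: "I s = I b + integral {b..s} g" if "b \<le> s" for b s
  proof (rule LIMSEQ_unique[OF I])
    have "(\<lambda>n. G n b + integral {b..s} g) \<longlonglongrightarrow> I b + integral {b..s} g"
      by (intro tendsto_intros I)
    moreover have "\<forall>\<^sub>F n in sequentially. - b \<le> real n"
      using filterlim_real_sequentially by (simp add: filterlim_at_top)
    then have "\<forall>\<^sub>F n in sequentially. G n s = G n b + integral {b..s} g"
      by eventually_elim (use that in \<open>intro G_split, auto\<close>)
    ultimately show "(\<lambda>n. G n s) \<longlonglongrightarrow> I b + integral {b..s} g"
      using Lim_transform_eventually[OF _ eventually_mono] by (simp add: tendsto_cong)
  qed
  have I_deriv: "(I has_real_derivative g s) (at s)" for s
  proof -
    have "((\<lambda>r. integral {s - 1..r} g) has_real_derivative g s) (at s within {s - 1..s + 1})"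
      by (intro integral_has_real_derivative g_cont) auto
    then have "((\<lambda>r. integral {s - 1..r} g) has_real_derivative g s) (at s)"
      by (subst (asm) at_within_interior) auto
    then have "((\<lambda>r. I (s - 1) + integral {s - 1..r} g) has_real_derivative 0 + g s) (at s)"
      by (intro DERIV_add) auto
    then have "((\<lambda>r. I (s - 1) + integral {s - 1..r} g) has_real_derivative g s) (at s)"
      by simp
    then show ?thesis
      by (rule has_field_derivative_transform_within_open[of _ _ _ "{s - 1<..}"]) (auto intro: I_split[symmetric])
  qed
  have I0: "0 \<le> I s" "I s \<le> M / k * exp (k * s)" for s
  proof -
    show "0 \<le> I s"
      by (rule LIMSEQ_le_const[OF I]) (auto simp: G_def intro!: integral_nonneg g_int g0)
    show "I s \<le> M / k * exp (k * s)"
      by (rule LIMSEQ_le_const2[OF I]) (intro exI allI impI G_bound)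
  qed
  define v where "v = (\<lambda>s. exp (- k * s) * I s)"
  show ?thesis
  proof (rule that[of v])
    fix s
    have "(v has_real_derivative exp (- k * s) * (- k) * I s + exp (- k * s) * g s) (at s)"
      unfolding v_def by (auto intro!: derivative_eq_intros I_deriv)
    moreover have "exp (- k * s) * g s = m s"
      by (simp add: g_def mult.assoc[symmetric] exp_add[symmetric])
    ultimately show "(v has_real_derivative - k * v s + m s) (at s)"
      by (simp add: v_def mult_ac)
    show "0 \<le> v s"
      using I0(1) by (simp add: v_def)
    have "exp (- k * s) * I s \<le> exp (- k * s) * (M / k * exp (k * s))"
      by (intro mult_left_mono I0) auto
    also have "\<dots> = M / k"
      by (simp add: exp_minus)
    finally show "v s \<le> M / k"
      by (simp add: v_def)
  qed
qed

lemma (in diagonal_matrix) le_A_antisym: "le_A A x y \<Longrightarrow> le_A A y x \<Longrightarrow> x = y"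
  by (rule hist_eqI) (auto simp: le_A_iff vec_eq_iff intro!: antisym)

context delay_system
begin

section \<open>Order structure on bounded entire solutions\<close>

lemma fibred_flow_EB:
  assumes "R > 0"
  shows "fibred_flow \<sigma> (EB R) (\<tau> \<sigma> F) fst"
proof
  show "compact (EB R)" "continuous_on (EB R) (\<tau> \<sigma> F t)" for t
    by (rule compact_EB continuous_on_\<tau>; fact)+
  show "continuous_on (EB R) fst"
    by (intro continuous_intros)
  fix e :: real assume "e > 0"
  obtain d where d: "d > 0" "\<And>\<omega> x y t. (\<omega>, x) \<in> EB R \<Longrightarrow> (\<omega>, y) \<in> EB R \<Longrightarrow> dist x y < d \<Longrightarrow> t \<ge> 0 \<Longrightarrow>
      dist (u \<sigma> F t \<omega> x) (u \<sigma> F t \<omega> y) < e"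
    by (rule EB_stable[OF \<open>R > 0\<close> \<open>e > 0\<close>]) blast
  then show "\<exists>d>0. \<forall>z\<in>EB R. \<forall>z'\<in>EB R. fst z = fst z' \<longrightarrow> dist z z' < d \<longrightarrow>
      (\<forall>t\<ge>0. dist (\<tau> \<sigma> F t z) (\<tau> \<sigma> F t z') < e)"
    by (intro exI[of _ d]) (auto simp: \<tau>_def dist_Pair_Pair)
qed (auto intro: compact_base minimal \<tau>_EB \<tau>_0 \<tau>_add, auto simp: \<tau>_def)

abbreviation invariant_in :: "real \<Rightarrow> ('o \<times> 'm hist) set \<Rightarrow> bool" where
  "invariant_in R \<equiv> fibred_flow.invariant (EB R) (\<tau> \<sigma> F)"

lemma invariant_in_iff:
  assumes "R > 0"
  shows "invariant_in R L \<longleftrightarrow> L \<subseteq> EB R \<and> closed L \<and> (\<forall>z\<in>L. \<forall>t. \<tau> \<sigma> F t z \<in> L)"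
  using fibred_flow.invariant_def[OF fibred_flow_EB[OF assms]] by blast

lemma le_A_u_all:
  assumes x: "(\<omega>, x) \<in> EB R" and y: "(\<omega>, y) \<in> EB R'" and le: "le_A A x y"
  shows "le_A A (u \<sigma> F t \<omega> x) (u \<sigma> F t \<omega> y)"
proof (cases "t \<ge> 0")
  case True
  then show ?thesis
    by (intro le_A_u EB_in_BC[OF x] EB_in_BC[OF y] le)
next
  case False
  have "hist_fun (u \<sigma> F t \<omega> x) s = hist_fun x (t + s)" "hist_fun (u \<sigma> F t \<omega> y) s = hist_fun y (t + s)"
    if "s \<le> 0" for s
    using that False EB_in_BC[OF x] EB_in_BC[OF y]
    by (auto simp: u_def hist_fun_seg_evolves[OF evolves_sol[OF EB_in_BC[OF x]]]
        hist_fun_seg_evolves[OF evolves_sol[OF EB_in_BC[OF y]]] sol_init)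
  then show ?thesis
    using False le_A_ge[OF le, of "t + _"] le_A_exp[OF le, of "t + _" "t + _"]
    by (simp add: le_A_iff[of "u \<sigma> F t \<omega> x"])
qed

lemma sandwich_bound:
  assumes x: "(\<omega>, x) \<in> EB R" and y: "(\<omega>, y) \<in> EB R" and w: "w \<in> BC" and le: "le_A A x w" "le_A A w y"
  shows "\<bar>sol \<omega> w t $ i\<bar> \<le> R"
proof -
  have "sol \<omega> x t $ i \<le> sol \<omega> w t $ i \<and> sol \<omega> w t $ i \<le> sol \<omega> y t $ i"
  proof (cases "t \<ge> 0")
    case True
    have "le_A A (u \<sigma> F t \<omega> x) (u \<sigma> F t \<omega> w)" "le_A A (u \<sigma> F t \<omega> w) (u \<sigma> F t \<omega> y)"
      using True by (auto intro!: le_A_u EB_in_BC[OF x] EB_in_BC[OF y] w le)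
    from le_A_ge[OF this(1), of 0 i] le_A_ge[OF this(2), of 0 i] show ?thesis
      by (simp add: u_def hist_fun_seg_evolves[OF evolves_sol[OF w]]
          hist_fun_seg_evolves[OF evolves_sol[OF EB_in_BC[OF x]]] hist_fun_seg_evolves[OF evolves_sol[OF EB_in_BC[OF y]]])
  next
    case False
    then show ?thesis
      using le_A_ge[OF le(1), of t i] le_A_ge[OF le(2), of t i] w EB_in_BC[OF x] EB_in_BC[OF y]
      by (simp add: sol_init)
  qed
  then show ?thesis
    using entire_bound[OF EB_entire[OF x], of t i] entire_bound[OF EB_entire[OF y], of t i] by linarith
qed

text \<open>With D p = p' - A p, the supremum w has as its D the maximum of the two given ones: to
  px is added the bounded solution of v' = A v + m, where m is the excess of D py over D px. By (3)
  an entire upper bound has a D at least as large as both at all times, so it lies above w. In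
  general w is no solution of the delay equation.\<close>

lemma sup_history:
  assumes p: "(\<omega>, x) \<in> EB R" and q: "(\<omega>, y) \<in> EB R" and "R > 0"
  obtains w where "w \<in> BC" "le_A A x w" "le_A A y w"
    "\<And>r. (\<omega>, r) \<in> EB R \<Longrightarrow> le_A A x r \<Longrightarrow> le_A A y r \<Longrightarrow> le_A A w r"
proof -
  define px where "px = sol \<omega> x"
  define py where "py = sol \<omega> y"
  have ex: "entire R \<omega> px" and ey: "entire R \<omega> py"
    unfolding px_def py_def by (intro EB_entire p q)+
  have segs: "seg 0 px = x" "seg 0 py = y"
    using EB_in_BC[OF p] EB_in_BC[OF q] by (auto simp: px_def py_def)
  obtain M where M: "M > 0" "\<And>\<omega> x i. x \<in> B R \<Longrightarrow> \<bar>F \<omega> x $ i\<bar> \<le> M"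
    by (rule F_bounded[OF \<open>R > 0\<close>]) blast
  define D where "D = (\<lambda>(p :: real \<Rightarrow> real ^ 'm) i s. F (\<sigma> s \<omega>) (seg s p) $ i - A $ i $ i * p s $ i)"
  have D_cont: "continuous_on UNIV (D p i)" if "entire R \<omega> p" for p i
    unfolding D_def using entire_bound[OF that] evolves_continuous[OF entire_evolves[OF that, of 0]]
    by (intro continuous_intros continuous_on_F_along[of p 0 R])
  have D_bound: "\<bar>D p i s\<bar> \<le> M + \<bar>A $ i $ i\<bar> * R" if "entire R \<omega> p" for p i s
  proof -
    have "\<bar>A $ i $ i * p s $ i\<bar> \<le> \<bar>A $ i $ i\<bar> * R"
      unfolding abs_mult using entire_bound[OF that] by (intro mult_left_mono) auto
    then show ?thesis
      using M(2)[OF entire_in_B[OF that, of s], of "\<sigma> s \<omega>" i] unfolding D_def by linarith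
  qed
  have deriv: "((\<lambda>s. p s $ i) has_real_derivative D p i s + A $ i $ i * p s $ i) (at s)" if "entire R \<omega> p" for p i s
    using evolves_derivative[OF entire_evolves[OF that, of "s - 1"], of s i] by (simp add: D_def)
  define m where "m = (\<lambda>i s. max 0 (D py i s - D px i s))"
  have "\<exists>v. (\<forall>s. (v has_real_derivative A $ i $ i * v s + m i s) (at s)) \<and>
      (\<forall>s. \<bar>v s\<bar> \<le> 2 * (M + \<bar>A $ i $ i\<bar> * R) / (- A $ i $ i))" for i
  proof -
    have 1: "- A $ i $ i > 0" "continuous_on UNIV (m i)"
      using A_negative[of i] unfolding m_def by (auto intro!: continuous_intros D_cont ex ey)
    have 2: "0 \<le> m i s" "m i s \<le> 2 * (M + \<bar>A $ i $ i\<bar> * R)" for s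
    proof -
      show "0 \<le> m i s" by (simp add: m_def)
      show "m i s \<le> 2 * (M + \<bar>A $ i $ i\<bar> * R)"
      proof -
        have "max 0 (b - a) \<le> 2 * K" if "\<bar>a\<bar> \<le> K" "\<bar>b\<bar> \<le> K" for a b K :: real
          using that by (auto simp: max_def abs_le_iff)
        from this[OF D_bound[OF ex] D_bound[OF ey]] show ?thesis
          by (simp add: m_def)
      qed
    qed
    obtain v where "\<And>s. (v has_real_derivative - (- A $ i $ i) * v s + m i s) (at s)"
      "\<And>s. 0 \<le> v s" "\<And>s. v s \<le> 2 * (M + \<bar>A $ i $ i\<bar> * R) / (- A $ i $ i)"
      by (rule bounded_linear_solution[OF 1 2]) blast
    then show ?thesis
      unfolding minus_minus by (intro exI[of _ v]) (simp add: abs_of_nonneg)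
  qed
  then obtain v where v: "\<And>i s. (v i has_real_derivative A $ i $ i * v i s + m i s) (at s)"
      "\<And>i s. \<bar>v i s\<bar> \<le> 2 * (M + \<bar>A $ i $ i\<bar> * R) / (- A $ i $ i)"
    by metis
  define b where "b = (\<Sum>i\<in>UNIV. \<bar>2 * (M + \<bar>A $ i $ i\<bar> * R) / (- A $ i $ i)\<bar>)"
  have b: "\<bar>v i s\<bar> \<le> b" for i s
  proof -
    have "\<bar>v i s\<bar> \<le> \<bar>2 * (M + \<bar>A $ i $ i\<bar> * R) / (- A $ i $ i)\<bar>"
      using v(2)[of i s] by linarith
    also have "\<dots> \<le> b"
      unfolding b_def by (rule member_le_sum) auto
    finally show ?thesis .
  qed
  define z where "z = (\<lambda>s. px s + (\<chi> i. v i s))"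
  have c: "continuous_on S px" "continuous_on S py" "continuous_on S z" for S
  proof -
    show 1: "continuous_on S px" "continuous_on S py"
      using ex ey by (auto intro: evolves_continuous entire_evolves)
    have "continuous_on S (v i)" for i
      using v(1) by (intro DERIV_continuous_on) (auto intro: DERIV_subset)
    then show "continuous_on S z"
      unfolding z_def by (intro continuous_intros continuous_on_vec_lambda 1)
  qed
  have z_deriv: "((\<lambda>s. z s $ i) has_real_derivative max (D px i s) (D py i s) + A $ i $ i * z s $ i) (at s)" for i s
  proof -
    have "((\<lambda>s. px s $ i + v i s) has_real_derivative
        (D px i s + A $ i $ i * px s $ i) + (A $ i $ i * v i s + m i s)) (at s)"
      by (intro DERIV_add deriv ex v)
    moreover have "(D px i s + A $ i $ i * px s $ i) + (A $ i $ i * v i s + m i s) =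
        max (D px i s) (D py i s) + A $ i $ i * z s $ i"
      by (auto simp: m_def z_def distrib_left max_def)
    ultimately show ?thesis
      by (simp add: z_def)
  qed
  have zB: "seg 0 z \<in> B (R + b)"
  proof (rule seg_in_B[OF c(3)])
    fix s i
    show "\<bar>z s $ i\<bar> \<le> R + b"
      using entire_bound[OF ex, of s i] b[of i s] by (simp add: z_def)
  qed
  have le: "le_A A (seg 0 p) (seg 0 z)" if p: "entire R \<omega> p" and D: "\<And>i s. D p i s \<le> max (D px i s) (D py i s)" for p
  proof (rule le_A_of_derivatives[OF _ c(3) entire_in_B[OF p] zB])
    show "continuous_on {..0} p"
      using p by (auto intro: evolves_continuous entire_evolves)
    fix i and s :: real
    have "((\<lambda>s. z s $ i - p s $ i) has_real_derivative
        (max (D px i s) (D py i s) + A $ i $ i * z s $ i) - (D p i s + A $ i $ i * p s $ i)) (at s)"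
      by (intro DERIV_diff z_deriv deriv p)
    then show "\<exists>D'. ((\<lambda>s. z s $ i - p s $ i) has_real_derivative D') (at s) \<and> A $ i $ i * (z s $ i - p s $ i) \<le> D'"
      using D[of i s] by (intro exI conjI) (assumption, simp add: right_diff_distrib)
  qed
  show ?thesis
  proof (rule that[of "seg 0 z"])
    show "seg 0 z \<in> BC"
      using zB by (rule B_imp_BC)
    show "le_A A x (seg 0 z)"
      using le[OF ex] segs by simp
    show "le_A A y (seg 0 z)"
      using le[OF ey] segs by simp
    fix r assume r: "(\<omega>, r) \<in> EB R" "le_A A x r" "le_A A y r"
    define pr where "pr = sol \<omega> r"
    have er: "entire R \<omega> pr"
      unfolding pr_def by (intro EB_entire r)
    have D_le: "D p i s \<le> D pr i s" if x': "(\<omega>, x') \<in> EB R" "le_A A x' r" and p: "p = sol \<omega> x'" for x' p i s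
    proof -
      have e: "entire R \<omega> p" unfolding p by (rule EB_entire[OF x'(1)])
      have "le_A A (seg s p) (seg s pr)"
        using le_A_u_all[OF x'(1) r(1) x'(2), of s] by (simp add: u_def pr_def p)
      then have "A *v (hist_fun (seg s pr) 0 - hist_fun (seg s p) 0) \<le> F (\<sigma> s \<omega>) (seg s pr) - F (\<sigma> s \<omega>) (seg s p)"
        by (intro F_monotone B_imp_BC[OF entire_in_B[OF e]] B_imp_BC[OF entire_in_B[OF er]])
      then have "(A *v (hist_fun (seg s pr) 0 - hist_fun (seg s p) 0)) $ i \<le> (F (\<sigma> s \<omega>) (seg s pr) - F (\<sigma> s \<omega>) (seg s p)) $ i"
        unfolding less_eq_vec_def by blast
      then show ?thesis
        using entire_evolves[OF e, of 0] entire_evolves[OF er, of 0]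
        by (simp add: A_mult_component D_def hist_fun_seg_evolves algebra_simps)
    qed
    have "le_A A (seg 0 z) (seg 0 pr)"
    proof (rule le_A_of_derivatives[OF c(3) _ zB entire_in_B[OF er]])
      show "continuous_on {..0} pr"
        using er by (auto intro: evolves_continuous entire_evolves)
      fix i and s :: real
      have "((\<lambda>s. pr s $ i - z s $ i) has_real_derivative
          (D pr i s + A $ i $ i * pr s $ i) - (max (D px i s) (D py i s) + A $ i $ i * z s $ i)) (at s)"
        by (intro DERIV_diff z_deriv deriv er)
      then show "\<exists>D'. ((\<lambda>s. pr s $ i - z s $ i) has_real_derivative D') (at s) \<and> A $ i $ i * (pr s $ i - z s $ i) \<le> D'"
        using D_le[OF p r(2) px_def, of i s] D_le[OF q r(3) py_def, of i s]
        by (intro exI conjI) (assumption, simp add: right_diff_distrib)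
    qed
    then show "le_A A (seg 0 z) r"
      using EB_in_BC[OF r(1)] by (simp add: pr_def)
  qed
qed


section \<open>Entire lower bounds of an invariant set and the greatest one among them\<close>

definition lower :: "real \<Rightarrow> ('o \<times> 'm hist) set \<Rightarrow> ('o \<times> 'm hist) set" where
  "lower R K = {z\<in>EB R. \<forall>x. (fst z, x) \<in> K \<longrightarrow> le_A A (snd z) x}"

lemma lowerD: "(\<omega>, e) \<in> lower R K \<Longrightarrow> (\<omega>, e) \<in> EB R" "(\<omega>, e) \<in> lower R K \<Longrightarrow> (\<omega>, x) \<in> K \<Longrightarrow> le_A A e x"
  by (auto simp: lower_def)

lemma lowerI: "(\<omega>, e) \<in> EB R \<Longrightarrow> (\<And>x. (\<omega>, x) \<in> K \<Longrightarrow> le_A A e x) \<Longrightarrow> (\<omega>, e) \<in> lower R K"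
  by (auto simp: lower_def)

lemma invariant_preimage:
  assumes "R > 0" and K: "invariant_in R K" and x: "(\<sigma> t \<omega>, x) \<in> K"
  obtains x' where "(\<omega>, x') \<in> K" "x = u \<sigma> F t \<omega> x'"
proof -
  interpret fibred_flow \<sigma> "EB R" "\<tau> \<sigma> F" fst
    by (rule fibred_flow_EB[OF \<open>R > 0\<close>])
  have xE: "(\<sigma> t \<omega>, x) \<in> EB R" and *: "\<tau> \<sigma> F (- t) (\<sigma> t \<omega>, x) \<in> K"
    using K x unfolding invariant_def by blast+
  have "\<tau> \<sigma> F t (\<tau> \<sigma> F (- t) (\<sigma> t \<omega>, x)) = (\<sigma> t \<omega>, x)"
    by (rule \<theta>_cancel(1)[OF xE])
  with * that show ?thesis
    by (simp add: \<tau>_def)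
qed

text \<open>Invariance holds because the flow preserves the order in both time directions. For
  closedness, a point x of K over the limit base point must be reached by points of K over the
  approximating base points; this is where lower semicontinuity of the fibres enters.\<close>

lemma invariant_lower:
  assumes "R > 0" and K: "invariant_in R K"
  shows "invariant_in R (lower R K)"
proof -
  interpret fibred_flow \<sigma> "EB R" "\<tau> \<sigma> F" fst
    by (rule fibred_flow_EB[OF \<open>R > 0\<close>])
  show ?thesis
    unfolding invariant_def[of "lower R K"]
  proof (intro conjI ballI allI)
    show "lower R K \<subseteq> EB R"
      by (auto simp: lower_def)
    show "closed (lower R K)"
      unfolding closed_sequential_limits
    proof (intro allI impI)
      fix w l assume w: "(\<forall>n. w n \<in> lower R K) \<and> w \<longlonglongrightarrow> l"
      have "l \<in> EB R"
        using w compact_imp_closed[OF compact_Z] closed_sequentially[of "EB R" w l] by (auto simp: lower_def)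
      moreover have "le_A A (snd l) x" if x: "(fst l, x) \<in> K" for x
      proof -
        have "(\<lambda>n. fst (w n)) \<longlonglongrightarrow> fst (fst l, x)"
          using w by (auto intro!: tendsto_intros)
        then obtain y where y: "\<And>n :: nat. y n \<in> K" "\<And>n. fst (y n) = fst (w n)" "y \<longlonglongrightarrow> (fst l, x)"
          by (rule fibre_lift_sequence[OF K x]) blast
        show ?thesis
        proof (rule le_A_limit)
          show "(\<lambda>n. snd (w n)) \<longlonglongrightarrow> snd l"
            using w by (auto intro!: tendsto_intros)
          show "(\<lambda>n. snd (y n)) \<longlonglongrightarrow> x"
            using tendsto_snd[OF y(3)] by simp
          have "le_A A (snd (w n)) (snd (y n))" for n
          proof -
            have "(fst (w n), snd (y n)) \<in> K"
              using y(1)[of n] by (simp add: y(2)[symmetric])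
            then show ?thesis
              using w by (auto simp: lower_def)
          qed
          then show "\<forall>\<^sub>F n in sequentially. le_A A (snd (w n)) (snd (y n))"
            by simp
        qed simp
      qed
      ultimately show "l \<in> lower R K"
        by (auto simp: lower_def)
    qed
    fix z t assume z: "z \<in> lower R K"
    obtain \<omega> e where \<omega>: "z = (\<omega>, e)" by (cases z)
    show "\<tau> \<sigma> F t z \<in> lower R K"
      unfolding \<omega> \<tau>_def fst_conv snd_conv
    proof (rule lowerI)
      show "(\<sigma> t \<omega>, u \<sigma> F t \<omega> e) \<in> EB R"
        using \<theta>_in[of z t] lowerD(1) z by (simp add: \<tau>_def \<omega>)
      fix x assume "(\<sigma> t \<omega>, x) \<in> K"
      then obtain x' where x': "(\<omega>, x') \<in> K" "x = u \<sigma> F t \<omega> x'"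
        by (rule invariant_preimage[OF assms]) blast
      show "le_A A (u \<sigma> F t \<omega> e) x"
        unfolding x'(2)
      proof (rule le_A_u_all)
        show "(\<omega>, e) \<in> EB R" "le_A A e x'"
          using z x'(1) by (auto simp: \<omega> intro: lowerD)
        show "(\<omega>, x') \<in> EB R"
          using x'(1) K by (auto simp: invariant_def)
      qed
    qed
  qed
qed

lemma evolves_sol_shift:
  assumes "x \<in> BC"
  shows "evolves (- s) (\<sigma> s \<omega>) (\<lambda>t. sol \<omega> x (s + t))"
  using evolves_shift[OF evolves_sol[OF assms], of s] by simp

text \<open>The constant - C lies below K over \<open>\<omega>1\<close>, and the solution starting
  from it is followed forward. It stays below K, and \<open>ordered_gap_bounded\<close> keeps it
  bounded, though possibly by more than R. Its limit along times tending to infinity is entire, and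
  lifting sequences to K carries the order to the limit.\<close>

lemma lower_nonempty:
  assumes "R > 0" and K: "invariant_in R K" "K \<noteq> {}"
  obtains R' where "R' \<ge> R" "lower R' K \<noteq> {}"
proof -
  interpret fibred_flow \<sigma> "EB R" "\<tau> \<sigma> F" fst
    by (rule fibred_flow_EB[OF \<open>R > 0\<close>])
  have KE: "K \<subseteq> EB R" using K(1) by (simp add: invariant_def)
  obtain C where C: "C > 0" "\<And>\<omega> x. (\<omega>, x) \<in> EB R \<Longrightarrow> le_A A (const_hist (- C)) x"
    by (rule EB_ge_const[OF \<open>R > 0\<close>]) blast
  obtain \<omega>1 x1 where x1: "(\<omega>1, x1) \<in> K" using K(2) by auto
  define h where "h = (const_hist (- C) :: 'm hist)"
  define R1 where "R1 = max R C"
  have hB: "h \<in> B R1"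
    unfolding h_def R1_def using C(1) by (intro const_hist_in_B) auto
  then have hBC: "h \<in> BC" by (rule B_imp_BC)
  have x1E: "(\<omega>1, x1) \<in> EB R" using x1 KE by auto
  obtain N where N: "\<And>t \<omega> i. t \<ge> 0 \<Longrightarrow> \<bar>sol \<omega> h t $ i - sol \<omega> x1 t $ i\<bar> \<le> N"
    by (rule ordered_gap_bounded[OF hB, of x1])
      (use B_mono[OF EB_in_B[OF x1E], of R1] C(2)[OF x1E] in \<open>auto simp: R1_def h_def\<close>)
  define R' where "R' = R1 + \<bar>N\<bar>"
  have R': "R' \<ge> R" "R' > 0" using \<open>R > 0\<close> by (auto simp: R'_def R1_def)
  have bound: "\<bar>sol \<omega>1 h t $ i\<bar> \<le> R'" for t i
  proof (cases "t \<ge> 0")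
    case True
    then show ?thesis
      using N[OF True, of \<omega>1 i] entire_bound[OF EB_entire[OF x1E], of t i] unfolding R'_def R1_def by linarith
  next
    case False
    then have "\<bar>hist_fun h t $ i\<bar> \<le> R1"
      using hB by (simp add: B_iff)
    then show ?thesis
      using False by (simp add: sol_init hBC R'_def)
  qed
  obtain r1 \<omega>2 where r1: "strict_mono (r1 :: nat \<Rightarrow> nat)" "(\<lambda>n. \<sigma> (real (r1 n)) \<omega>1) \<longlonglongrightarrow> \<omega>2"
    using compact_base[unfolded compact_def, rule_format, of "\<lambda>n. \<sigma> (real n) \<omega>1"] by (auto simp: o_def)
  obtain r2 p where r2: "strict_mono (r2 :: nat \<Rightarrow> nat)" "entire R' \<omega>2 p"
    "\<And>t. (\<lambda>n. seg t (\<lambda>s. sol \<omega>1 h (real (r1 (r2 n)) + s))) \<longlonglongrightarrow> seg t p"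
    by (rule entire_limit[OF R'(2) r1(2) evolves_sol_shift[OF hBC] filterlim_strict_mono_subseq[OF r1(1) filterlim_real_sequentially] bound]) blast
  have "(\<omega>2, seg 0 p) \<in> lower R' K"
  proof (rule lowerI[OF EB_I0[OF r2(2)]])
    fix x assume x: "(\<omega>2, x) \<in> K"
    have "(\<lambda>n. \<sigma> (real (r1 (r2 n))) \<omega>1) \<longlonglongrightarrow> fst (\<omega>2, x)"
      using filterlim_strict_mono_subseq[OF r2(1) r1(2)] by simp
    then obtain y where y: "\<And>n :: nat. y n \<in> K" "\<And>n. fst (y n) = \<sigma> (real (r1 (r2 n))) \<omega>1" "y \<longlonglongrightarrow> (\<omega>2, x)"
      by (rule fibre_lift_sequence[OF K(1) x]) blast
    show "le_A A (seg 0 p) x"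
    proof (rule le_A_limit[OF r2(3)])
      show "(\<lambda>n. snd (y n)) \<longlonglongrightarrow> x"
        using tendsto_snd[OF y(3)] by simp
      have "le_A A (seg 0 (\<lambda>s. sol \<omega>1 h (real (r1 (r2 n)) + s))) (snd (y n))" for n
      proof -
        have "(\<sigma> (real (r1 (r2 n))) \<omega>1, snd (y n)) \<in> K"
          using y(1)[of n] by (simp add: y(2)[symmetric])
        then obtain x' where x': "(\<omega>1, x') \<in> K" "snd (y n) = u \<sigma> F (real (r1 (r2 n))) \<omega>1 x'"
          by (rule invariant_preimage[OF \<open>R > 0\<close> K(1)]) blast
        have x'E: "(\<omega>1, x') \<in> EB R" using x'(1) KE by auto
        have "le_A A (u \<sigma> F (real (r1 (r2 n))) \<omega>1 h) (u \<sigma> F (real (r1 (r2 n))) \<omega>1 x')"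
          by (intro le_A_u hBC EB_in_BC[OF x'E]) (use C(2)[OF x'E] in \<open>auto simp: h_def\<close>)
        then show ?thesis
          by (simp add: x'(2) u_def seg_shift)
      qed
      then show "\<forall>\<^sub>F n in sequentially. le_A A (seg 0 (\<lambda>s. sol \<omega>1 h (real (r1 (r2 n)) + s))) (snd (y n))"
        by simp
    qed simp
  qed
  with R'(1) that show ?thesis by blast
qed

text \<open>The supremum of both lower bounds at time - n is used only as an initial history. At
  time 0 the solution started there lies above both and below K, it is bounded by the sandwich, and
  its limit as n tends to infinity is entire.\<close>

lemma lower_directed:
  assumes "R > 0" and K: "invariant_in R K" "K \<noteq> {}"
    and e1: "(\<omega>, e1) \<in> lower R K" and e2: "(\<omega>, e2) \<in> lower R K"
  obtains e where "(\<omega>, e) \<in> lower R K" "le_A A e1 e" "le_A A e2 e"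
proof -
  interpret fibred_flow \<sigma> "EB R" "\<tau> \<sigma> F" fst
    by (rule fibred_flow_EB[OF \<open>R > 0\<close>])
  have KE: "K \<subseteq> EB R" using K(1) by (simp add: invariant_def)
  have low: "\<tau> \<sigma> F t z \<in> lower R K" if "z \<in> lower R K" for t z
    using invariant_lower[OF \<open>R > 0\<close> K(1)] that by (simp add: invariant_def)
  define b where "b = (\<lambda>n :: nat. \<sigma> (- real n) \<omega>)"
  define bk where "bk = (\<lambda>n x. u \<sigma> F (- real n) \<omega> x)"
  have bk_low: "(b n, bk n e) \<in> lower R K" if "(\<omega>, e) \<in> lower R K" for n e
    using low[OF that, of "- real n"] by (simp add: \<tau>_def b_def bk_def)
  have bk_K: "(b n, bk n x) \<in> K" if "(\<omega>, x) \<in> K" for n x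
    using K(1) that unfolding invariant_def b_def bk_def by (auto simp: \<tau>_def dest: bspec)
  have forth: "u \<sigma> F (real n) (b n) (bk n x) = x" if "(\<omega>, x) \<in> EB R" for n x
    using \<theta>_cancel(1)[OF that, of "real n"] by (simp add: \<tau>_def b_def bk_def)
  have "\<exists>w. w \<in> BC \<and> le_A A (bk n e1) w \<and> le_A A (bk n e2) w \<and>
      (\<forall>x. (\<omega>, x) \<in> K \<longrightarrow> le_A A w (bk n x))" for n
  proof -
    obtain w where w: "w \<in> BC" "le_A A (bk n e1) w" "le_A A (bk n e2) w"
      "\<And>r. (b n, r) \<in> EB R \<Longrightarrow> le_A A (bk n e1) r \<Longrightarrow> le_A A (bk n e2) r \<Longrightarrow> le_A A w r"
      by (rule sup_history[OF lowerD(1)[OF bk_low[OF e1]] lowerD(1)[OF bk_low[OF e2]] \<open>R > 0\<close>]) blast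
    have "le_A A w (bk n x)" if "(\<omega>, x) \<in> K" for x
      using bk_K[OF that] KE
      by (intro w(4) lowerD(2)[OF bk_low[OF e1]] lowerD(2)[OF bk_low[OF e2]]) auto
    with w show ?thesis by blast
  qed
  then obtain w where w: "\<And>n. w n \<in> BC" "\<And>n. le_A A (bk n e1) (w n)" "\<And>n. le_A A (bk n e2) (w n)"
    "\<And>n x. (\<omega>, x) \<in> K \<Longrightarrow> le_A A (w n) (bk n x)"
    by metis
  obtain x0 where x0: "(\<omega>, x0) \<in> K"
    using fibre_nonempty[OF K, of \<omega>] by auto
  have ev: "evolves (- real n) \<omega> (\<lambda>t. sol (b n) (w n) (real n + t))" for n
    using evolves_sol_shift[OF w(1), of "real n" "b n" n] by (simp add: b_def)
  have bound: "\<bar>sol (b n) (w n) (real n + t) $ i\<bar> \<le> R" for n t i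
    using bk_K[OF x0, of n] KE
    by (intro sandwich_bound[OF lowerD(1)[OF bk_low[OF e1]] _ w(1,2) w(4)[OF x0]]) auto
  obtain r p where r: "strict_mono (r :: nat \<Rightarrow> nat)" "entire R \<omega> p"
    "\<And>t. (\<lambda>n. seg t (\<lambda>t. sol (b (r n)) (w (r n)) (real (r n) + t))) \<longlonglongrightarrow> seg t p"
    by (rule entire_limit[OF \<open>R > 0\<close> tendsto_const ev filterlim_real_sequentially bound]) blast
  have lim: "(\<lambda>n. u \<sigma> F (real (r n)) (b (r n)) (w (r n))) \<longlonglongrightarrow> seg 0 p"
    using r(3)[of 0] by (simp add: u_def seg_shift)
  have ge: "le_A A e (seg 0 p)" if e: "(\<omega>, e) \<in> EB R" "\<And>n. le_A A (bk n e) (w n)" "\<And>n. bk n e \<in> BC" for e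
  proof (rule le_A_limit[OF tendsto_const lim])
    have "le_A A (u \<sigma> F (real (r n)) (b (r n)) (bk (r n) e)) (u \<sigma> F (real (r n)) (b (r n)) (w (r n)))" for n
      by (intro le_A_u e w(1)) auto
    then show "\<forall>\<^sub>F n in sequentially. le_A A e (u \<sigma> F (real (r n)) (b (r n)) (w (r n)))"
      by (simp add: forth[OF e(1)])
  qed simp
  have le: "le_A A (seg 0 p) x" if x: "(\<omega>, x) \<in> K" for x
  proof (rule le_A_limit[OF lim tendsto_const])
    have xE: "(\<omega>, x) \<in> EB R" using x KE by auto
    have "le_A A (u \<sigma> F (real (r n)) (b (r n)) (w (r n))) (u \<sigma> F (real (r n)) (b (r n)) (bk (r n) x))" for n
      using bk_K[OF x, of "r n"] KE by (intro le_A_u w(1) w(4) x EB_in_BC[of "b (r n)" _ R]) auto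
    then show "\<forall>\<^sub>F n in sequentially. le_A A (u \<sigma> F (real (r n)) (b (r n)) (w (r n))) x"
      by (simp add: forth[OF xE])
  qed simp
  show ?thesis
  proof (rule that)
    show "(\<omega>, seg 0 p) \<in> lower R K"
      by (intro lowerI EB_I0[OF r(2)] le)
    show "le_A A e1 (seg 0 p)"
      by (intro ge w lowerD(1)[OF e1] EB_in_BC[OF lowerD(1)[OF bk_low[OF e1]]])
    show "le_A A e2 (seg 0 p)"
      by (intro ge w lowerD(1)[OF e2] EB_in_BC[OF lowerD(1)[OF bk_low[OF e2]]])
  qed
qed

text \<open>The lower bounds over \<omega> form a compact set, and the sets of histories above a
  given one are closed. Directedness gives the finite intersection property, and any common point is
  greatest.\<close>

lemma lower_greatest:
  assumes "R > 0" and K: "invariant_in R K" "K \<noteq> {}" and ne: "lower R K \<noteq> {}"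
  obtains c where "(\<omega>, c) \<in> lower R K" "\<And>e. (\<omega>, e) \<in> lower R K \<Longrightarrow> le_A A e c"
proof -
  interpret fibred_flow \<sigma> "EB R" "\<tau> \<sigma> F" fst
    by (rule fibred_flow_EB[OF \<open>R > 0\<close>])
  note inv = invariant_lower[OF \<open>R > 0\<close> K(1)]
  define S where "S = {e. (\<omega>, e) \<in> lower R K}"
  define F' where "F' = (\<lambda>e. {e'. le_A A e e'}) ` S"
  have S: "S = snd ` (lower R K \<inter> ({\<omega>} \<times> UNIV))"
    by (force simp: S_def)
  have "compact S"
    unfolding S
    by (intro compact_continuous_image compact_Int_closed invariant_compact inv closed_Times continuous_intros)
  moreover have "closed T" if TF: "T \<in> F'" for T
  proof -
    obtain e where T: "T = {e'. le_A A e e'}" using TF unfolding F'_def by blast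
    show ?thesis
      unfolding closed_sequential_limits T
      by (auto intro!: le_A_limit[OF tendsto_const])
  qed
  moreover have "S \<inter> \<Inter>G \<noteq> {}" if G: "finite G" "G \<subseteq> F'" for G
  proof -
    obtain E where E: "finite E" "E \<subseteq> S" "G = (\<lambda>e. {e'. le_A A e e'}) ` E"
      using finite_subset_image[OF G(1) G(2)[unfolded F'_def]] by blast
    have "\<exists>e'\<in>S. \<forall>e\<in>E. le_A A e e'"
      using E(1,2)
    proof (induction E)
      case empty
      then show ?case
        using fibre_nonempty[OF inv ne, of \<omega>] by (auto simp: S_def)
    next
      case (insert e E)
      then obtain e' where e': "e' \<in> S" "\<forall>e\<in>E. le_A A e e'" by auto
      have "(\<omega>, e') \<in> lower R K" "(\<omega>, e) \<in> lower R K"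
        using e'(1) insert by (auto simp: S_def)
      then obtain e'' where "(\<omega>, e'') \<in> lower R K" "le_A A e' e''" "le_A A e e''"
        by (rule lower_directed[OF assms(1-3)]) blast
      then show ?case
        using e'(2) le_A_trans by (intro bexI[of _ e'']) (auto simp: S_def)
    qed
    then show ?thesis
      unfolding E(3) by blast
  qed
  ultimately have "S \<inter> \<Inter>F' \<noteq> {}"
    by (rule compact_imp_fip)
  then obtain c where "c \<in> S" "\<And>e. e \<in> S \<Longrightarrow> le_A A e c"
    by (auto simp: F'_def)
  then show ?thesis
    using that by (simp add: S_def)
qed

text \<open>Greatest elements are unique and the flow preserves order and lower bounds, whence
  equivariance. A cluster value of c at \<omega> is a lower bound, so it is at most c \<omega>;
  conversely c \<omega> is a limit of lower bounds over the nearby base points, each of them below c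
  there, so it is at most the cluster value.\<close>

lemma greatest_lower_solution:
  assumes "R > 0" and K: "invariant_in R K" "K \<noteq> {}" and ne: "lower R K \<noteq> {}"
  obtains c where "\<And>\<omega>. (\<omega>, c \<omega>) \<in> lower R K" "\<And>\<omega> e. (\<omega>, e) \<in> lower R K \<Longrightarrow> le_A A e (c \<omega>)"
    "continuous_on UNIV c" "\<And>t \<omega>. u \<sigma> F t \<omega> (c \<omega>) = c (\<sigma> t \<omega>)"
proof -
  interpret fibred_flow \<sigma> "EB R" "\<tau> \<sigma> F" fst
    by (rule fibred_flow_EB[OF \<open>R > 0\<close>])
  note inv = invariant_lower[OF \<open>R > 0\<close> K(1)]
  have "\<exists>c. (\<omega>, c) \<in> lower R K \<and> (\<forall>e. (\<omega>, e) \<in> lower R K \<longrightarrow> le_A A e c)" for \<omega>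
    by (rule lower_greatest[OF assms, of \<omega>]) blast
  then obtain c where c: "\<And>\<omega>. (\<omega>, c \<omega>) \<in> lower R K" "\<And>\<omega> e. (\<omega>, e) \<in> lower R K \<Longrightarrow> le_A A e (c \<omega>)"
    by metis
  have cE: "(\<omega>, c \<omega>) \<in> EB R" for \<omega>
    by (rule lowerD(1)[OF c(1)])
  have move: "(\<sigma> t \<omega>, u \<sigma> F t \<omega> e) \<in> lower R K" if "(\<omega>, e) \<in> lower R K" for t \<omega> e
    using inv that unfolding invariant_def by (force simp: \<tau>_def)
  have "u \<sigma> F t \<omega> (c \<omega>) = c (\<sigma> t \<omega>)" for t \<omega>
  proof (rule le_A_antisym)
    show "le_A A (u \<sigma> F t \<omega> (c \<omega>)) (c (\<sigma> t \<omega>))"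
      by (intro c move)
    obtain x where x: "(\<omega>, x) \<in> lower R K" "c (\<sigma> t \<omega>) = u \<sigma> F t \<omega> x"
      by (rule invariant_preimage[OF \<open>R > 0\<close> inv c(1)]) blast
    show "le_A A (c (\<sigma> t \<omega>)) (u \<sigma> F t \<omega> (c \<omega>))"
      unfolding x(2) by (rule le_A_u_all[OF lowerD(1)[OF x(1)] cE c(2)[OF x(1)]])
  qed
  moreover have "continuous_on UNIV c"
    unfolding continuous_on_sequentially o_def
  proof (intro allI ballI impI, elim conjE)
    fix w :: "nat \<Rightarrow> 'o" and \<omega> assume w: "w \<longlonglongrightarrow> \<omega>"
    show "(\<lambda>n. c (w n)) \<longlonglongrightarrow> c \<omega>"
    proof (rule tendsto_by_subsequences)
      fix r :: "nat \<Rightarrow> nat" assume r: "strict_mono r"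
      obtain l r' where l: "l \<in> lower R K" "strict_mono (r' :: nat \<Rightarrow> nat)" "(\<lambda>n. (w (r (r' n)), c (w (r (r' n))))) \<longlonglongrightarrow> l"
        using invariant_compact[OF inv, unfolded compact_def, rule_format, of "\<lambda>n. (w (r n), c (w (r n)))"] c(1)
        by (auto simp: o_def)
      have w': "(\<lambda>n. w (r (r' n))) \<longlonglongrightarrow> \<omega>"
        by (intro filterlim_strict_mono_subseq[OF l(2)] filterlim_strict_mono_subseq[OF r] w)
      have fst_l: "fst l = \<omega>"
        using tendsto_fst[OF l(3)] LIMSEQ_unique[OF w'] by simp
      have snd_l: "(\<lambda>n. c (w (r (r' n)))) \<longlonglongrightarrow> snd l"
        using tendsto_snd[OF l(3)] by simp
      have "(\<lambda>n. w (r (r' n))) \<longlonglongrightarrow> fst (\<omega>, c \<omega>)"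
        using w' by simp
      then obtain y where y: "\<And>n :: nat. y n \<in> lower R K" "\<And>n. fst (y n) = w (r (r' n))" "y \<longlonglongrightarrow> (\<omega>, c \<omega>)"
        by (rule fibre_lift_sequence[OF inv c(1)]) blast
      have "le_A A (c \<omega>) (snd l)"
      proof (rule le_A_limit[OF _ snd_l])
        show "(\<lambda>n. snd (y n)) \<longlonglongrightarrow> c \<omega>"
          using tendsto_snd[OF y(3)] by simp
        have "le_A A (snd (y n)) (c (w (r (r' n))))" for n
          using y(1)[of n] by (intro c(2)) (simp add: y(2)[symmetric])
        then show "\<forall>\<^sub>F n in sequentially. le_A A (snd (y n)) (c (w (r (r' n))))"
          by simp
      qed simp
      moreover have "le_A A (snd l) (c \<omega>)"
        using l(1) fst_l by (intro c(2)) auto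
      ultimately have "snd l = c \<omega>"
        by (intro le_A_antisym)
      with snd_l l(2) show "\<exists>r'. strict_mono r' \<and> (\<lambda>n. c (w (r (r' n)))) \<longlonglongrightarrow> c \<omega>"
        by auto
    qed
  qed
  ultimately show ?thesis
    using c that by blast
qed


section \<open>Strict monotonicity and the identification of K with the graph of c\<close>

lemma backward_extension_EB:
  assumes "(\<omega>, x) \<in> EB R"
  shows "backward_extension \<sigma> F \<omega> x"
  unfolding backward_extension_def
proof (intro exI conjI allI impI)
  have ent: "entire R \<omega> (sol \<omega> x)" by (rule EB_entire[OF assms])
  show "continuous_on {..0} (\<lambda>s. \<tau> \<sigma> F s (\<omega>, x))"
  proof -
    have "continuous_on UNIV (\<lambda>s. \<sigma> s \<omega>)"
      unfolding continuous_on_def by (intro ballI flow_tendsto tendsto_ident_at tendsto_const)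
    moreover have "continuous_on UNIV (\<lambda>s. seg s (sol \<omega> x))"
      by (rule continuous_on_seg[OF evolves_continuous[OF entire_evolves[OF ent]]])
    ultimately have "continuous_on UNIV (\<lambda>s. \<tau> \<sigma> F s (\<omega>, x))"
      unfolding \<tau>_def u_def fst_conv snd_conv by (rule continuous_on_Pair)
    then show ?thesis by (rule continuous_on_subset) simp
  qed
  show "\<tau> \<sigma> F 0 (\<omega>, x) = (\<omega>, x)"
    by (rule \<tau>_0[OF assms])
  fix s :: real assume "s \<le> 0"
  have in_EB: "\<tau> \<sigma> F s (\<omega>, x) \<in> EB R"
    by (rule \<tau>_EB[OF assms])
  then have BC: "snd (\<tau> \<sigma> F s (\<omega>, x)) \<in> BC"
    by (cases "\<tau> \<sigma> F s (\<omega>, x)") (simp add: EB_in_BC)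
  then show "\<tau> \<sigma> F s (\<omega>, x) \<in> UNIV \<times> BC"
    by (cases "\<tau> \<sigma> F s (\<omega>, x)") simp
  fix t assume t: "0 \<le> t \<and> t \<le> - s"
  show "ereal t < lifetime \<sigma> F (fst (\<tau> \<sigma> F s (\<omega>, x))) (snd (\<tau> \<sigma> F s (\<omega>, x)))"
    using t BC by (intro lifetime_infinite) auto
  show "\<tau> \<sigma> F t (\<tau> \<sigma> F s (\<omega>, x)) = \<tau> \<sigma> F (s + t) (\<omega>, x)"
    using \<tau>_add[OF assms, of t s] by (simp add: add.commute)
qed

lemma F_component_continuous:
  assumes "R > 0" "K \<subseteq> EB R"
  shows "continuous_on K (\<lambda>z. F (fst z) (snd z) $ i)"
proof -
  have "continuous_on K (\<lambda>(\<omega>, x). F \<omega> x)"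
    using assms(2) EB_in_B by (intro continuous_on_subset[OF F_continuous[OF assms(1)]]) auto
  then have "continuous_on K (\<lambda>z. (case z of (\<omega>, x) \<Rightarrow> F \<omega> x) $ i)"
    by (rule continuous_on_component)
  then show ?thesis
    by (simp add: case_prod_beta)
qed

lemma continuous_on_hist_component: "s \<le> 0 \<Longrightarrow> continuous_on S f \<Longrightarrow> continuous_on S (\<lambda>z. hist_fun (f z) s $ i)"
  unfolding continuous_on_def by (blast intro: tendsto_hist_component)

text \<open>If the gap in component i vanishes at one point of K, it vanishes at all earlier times
  by the exponential inequality, and at all times because the point is in its own alpha-limit set.
  The points with this property form an invariant set, which then contains p0 and all of K.\<close>

lemma component_dichotomy:
  assumes "R > 0" and p0: "p0 \<in> EB R" and K_def: "K = fibred_flow.alpha_limit (EB R) (\<tau> \<sigma> F) p0"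
    and c_cont: "continuous_on UNIV c" and cE: "\<And>\<omega>. (\<omega>, c \<omega>) \<in> EB R'"
    and c_inv: "\<And>t \<omega>. u \<sigma> F t \<omega> (c \<omega>) = c (\<sigma> t \<omega>)"
    and c_le: "\<And>\<omega> x. (\<omega>, x) \<in> K \<Longrightarrow> le_A A (c \<omega>) x"
  shows "(\<forall>(\<omega>, x)\<in>K. hist_fun x 0 $ i = hist_fun (c \<omega>) 0 $ i) \<or>
    (\<forall>(\<omega>, x)\<in>K. hist_fun (c \<omega>) 0 $ i < hist_fun x 0 $ i)"
proof -
  interpret fibred_flow \<sigma> "EB R" "\<tau> \<sigma> F" fst
    by (rule fibred_flow_EB[OF \<open>R > 0\<close>])
  have K: "invariant K"
    unfolding K_def by (rule invariant_alpha_limit[OF p0])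
  have KE: "K \<subseteq> EB R" and K_inv: "\<And>z t. z \<in> K \<Longrightarrow> \<tau> \<sigma> F t z \<in> K" and K_closed: "closed K"
    using K by (auto simp: invariant_def)
  define g where "g = (\<lambda>z. hist_fun (snd z) 0 $ i - hist_fun (c (fst z)) 0 $ i)"
  have g_cont: "continuous_on S g" for S
    unfolding g_def
    by (intro continuous_on_diff continuous_on_hist_component order_refl continuous_on_compose2[OF c_cont]
        continuous_on_fst continuous_on_snd continuous_on_id) auto
  have g_\<tau>_cont: "continuous_on (EB R) (\<lambda>z. g (\<tau> \<sigma> F t z))" for t
    by (rule continuous_on_compose2[OF g_cont[of UNIV] \<theta>_cont]) simp
  have g_nonneg: "0 \<le> g z" if "z \<in> K" for z
    using le_A_ge[OF c_le, of "fst z" "snd z" 0 i] that by (simp add: g_def)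
  have g_back: "g (\<tau> \<sigma> F t z) = 0" if z: "z \<in> K" "g z = 0" and "t \<le> 0" for z t
  proof -
    obtain \<omega> x where \<omega>: "z = (\<omega>, x)" by (cases z)
    have xE: "(\<omega>, x) \<in> EB R" using z KE \<omega> by auto
    have "g (\<tau> \<sigma> F t z) = hist_fun x t $ i - hist_fun (c \<omega>) t $ i"
      using \<open>t \<le> 0\<close> unfolding g_def \<omega> \<tau>_def fst_conv snd_conv c_inv[symmetric] u_def
      by (simp add: hist_fun_seg_evolves[OF evolves_sol[OF EB_in_BC[OF xE]]] EB_in_BC[OF xE] sol_init
          hist_fun_seg_evolves[OF evolves_sol[OF EB_in_BC[OF cE]]] EB_in_BC[OF cE])
    \<comment> \<open>A positive gap at time t would keep the gap at time 0 positive.\<close>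
    moreover have "exp (A $ i $ i * (0 - t)) * (hist_fun x t $ i - hist_fun (c \<omega>) t $ i) \<le> 0"
      using le_A_exp[OF c_le, of \<omega> x t 0 i] z \<open>t \<le> 0\<close> by (simp add: g_def \<omega>)
    ultimately have "g (\<tau> \<sigma> F t z) \<le> 0"
      by (simp add: mult_le_0_iff)
    then show ?thesis
      using g_nonneg[OF K_inv[OF z(1)]] by (intro antisym)
  qed
  have g_zero: "g (\<tau> \<sigma> F t z) = 0" if z: "z \<in> K" "g z = 0" for z t
  proof -
    have zE: "z \<in> EB R" using z KE by auto
    have "\<bar>g (\<tau> \<sigma> F t z)\<bar> \<le> 0 + e" if "e > 0" for e
    proof -
      obtain d where d: "d > 0" "\<And>z'. z' \<in> EB R \<Longrightarrow> dist z' z < d \<Longrightarrow> dist (g (\<tau> \<sigma> F t z')) (g (\<tau> \<sigma> F t z)) < e"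
        using g_\<tau>_cont[of t] zE \<open>e > 0\<close> unfolding continuous_on_iff by metis
      \<comment> \<open>The return time is taken so early that t + s \<le> 0, where g is known to
        vanish.\<close>
      obtain s where s: "s \<le> - \<bar>t\<bar>" "dist (\<tau> \<sigma> F s z) z < d"
        using mem_alpha_limit[OF zE] d(1) unfolding alpha_limit_def by blast
      have "g (\<tau> \<sigma> F t (\<tau> \<sigma> F s z)) = 0"
        using g_back[OF z, of "t + s"] s(1) \<theta>_add[OF zE, of t s] by simp
      then show ?thesis
        using d(2)[OF \<theta>_in[OF zE] s(2)] by (simp add: dist_real_def)
    qed
    then have "\<bar>g (\<tau> \<sigma> F t z)\<bar> \<le> 0"
      by (rule field_le_epsilon)
    then show ?thesis by simp
  qed
  define L where "L = {z\<in>K. \<forall>t. g (\<tau> \<sigma> F t z) = 0}"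
  have L: "invariant L"
    unfolding invariant_def
  proof (intro conjI ballI allI)
    show "L \<subseteq> EB R" using KE by (auto simp: L_def)
    have "L = (\<Inter>t. {z\<in>K. g (\<tau> \<sigma> F t z) = 0})"
      by (auto simp: L_def)
    moreover have "closed {z\<in>K. g (\<tau> \<sigma> F t z) = 0}" for t
      by (rule continuous_closed_preimage_constant[OF continuous_on_subset[OF g_\<tau>_cont KE] K_closed])
    ultimately show "closed L"
      by (simp add: closed_INT)
    fix z t assume "z \<in> L"
    then show "\<tau> \<sigma> F t z \<in> L"
      using K_inv KE \<theta>_add[of z _ t, symmetric] by (auto simp: L_def)
  qed
  show ?thesis
  proof (cases "\<exists>z\<in>K. g z = 0")
    case True
    then obtain q where "q \<in> K" "q \<in> L"
      using g_zero by (auto simp: L_def)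
    \<comment> \<open>L meets the alpha-limit set of p0, hence contains p0, hence the closure of its
      orbit, and K lies in that closure.\<close>
    then have p0L: "p0 \<in> L"
      using mem_of_alpha_limit[OF p0 _ L] unfolding K_def by blast
    have "z \<in> L" if "z \<in> K" for z
    proof -
      have "\<exists>y\<in>L. dist y z < e" if "e > 0" for e
        using \<open>z \<in> K\<close> that p0L L unfolding K_def alpha_limit_def invariant_def by blast
      then have "z \<in> closure L"
        by (simp add: closure_approachable)
      then show ?thesis
        using L by (simp add: invariant_def)
    qed
    then have "g (\<tau> \<sigma> F 0 z) = 0" if "z \<in> K" for z
      using that unfolding L_def by blast
    then have "g z = 0" if "z \<in> K" for z
      using that \<theta>_0[of z] KE by (metis subsetD)
    then have "\<forall>(\<omega>, x)\<in>K. hist_fun x 0 $ i = hist_fun (c \<omega>) 0 $ i"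
      by (auto simp: g_def)
    then show ?thesis ..
  next
    case False
    then have "g z > 0" if "z \<in> K" for z
      using g_nonneg[OF that] that by (metis less_eq_real_def)
    then show ?thesis
      by (force simp: g_def)
  qed
qed

text \<open>Two facts combine. \<open>isolated\<close>: no entire solution other than c lies between
  c and K and remains within d of c. \<open>chain\<close>: along interpolated initial histories from
  c to the orbit of p0, started ever earlier, no step can leave c by as much as d, so the last step,
  which is p0 itself, is on c.\<close>

lemma point_on_equilibrium:
  assumes "R > 0" and p0: "p0 \<in> EB R"
  obtains R' c where "R' \<ge> R" "\<And>\<omega>. (\<omega>, c \<omega>) \<in> EB R'" "continuous_on UNIV c"
    "\<And>t \<omega>. u \<sigma> F t \<omega> (c \<omega>) = c (\<sigma> t \<omega>)" "snd p0 = c (fst p0)"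
proof -
  interpret fibred_flow \<sigma> "EB R" "\<tau> \<sigma> F" fst
    by (rule fibred_flow_EB[OF \<open>R > 0\<close>])
  define K where "K = alpha_limit p0"
  have K: "invariant K" and p0K: "p0 \<in> K"
    unfolding K_def by (rule invariant_alpha_limit[OF p0], rule mem_alpha_limit[OF p0])
  have K_ne: "K \<noteq> {}" using p0K by blast
  have KE: "K \<subseteq> EB R" and K_inv: "\<And>z t. z \<in> K \<Longrightarrow> \<tau> \<sigma> F t z \<in> K"
    using K by (auto simp: invariant_def)
  obtain R' where R': "R' \<ge> R" "lower R' K \<noteq> {}"
    by (rule lower_nonempty[OF \<open>R > 0\<close> K K_ne]) blast
  have "R' > 0" using R'(1) \<open>R > 0\<close> by simp
  have K': "invariant_in R' K"
    using K EB_mono[OF R'(1)] unfolding invariant_in_iff[OF \<open>R > 0\<close>] invariant_in_iff[OF \<open>R' > 0\<close>] by blast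
  have KE': "K \<subseteq> EB R'" using KE EB_mono[OF R'(1)] by blast
  obtain c where c_low: "\<And>\<omega>. (\<omega>, c \<omega>) \<in> lower R' K" and c_max: "\<And>\<omega> e. (\<omega>, e) \<in> lower R' K \<Longrightarrow> le_A A e (c \<omega>)"
    and c_cont: "continuous_on UNIV c" and c_inv: "\<And>t \<omega>. u \<sigma> F t \<omega> (c \<omega>) = c (\<sigma> t \<omega>)"
    by (rule greatest_lower_solution[OF \<open>R' > 0\<close> K' K_ne R'(2)]) blast
  have cE: "(\<omega>, c \<omega>) \<in> EB R'" for \<omega>
    by (rule lowerD(1)[OF c_low])
  have c_le: "le_A A (c \<omega>) x" if "(\<omega>, x) \<in> K" for \<omega> x
    by (rule lowerD(2)[OF c_low that])
  \<comment> \<open>The components in which c and K differ somewhere; by the dichotomy they differ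
    at all points of K.\<close>
  define J where "J = {i. \<exists>(\<omega>, x)\<in>K. hist_fun x 0 $ i \<noteq> hist_fun (c \<omega>) 0 $ i}"
  have J0: "hist_fun x 0 $ i = hist_fun (c \<omega>) 0 $ i" if "(\<omega>, x) \<in> K" "i \<notin> J" for \<omega> x i
    using that by (auto simp: J_def)
  have J1: "hist_fun (c \<omega>) 0 $ i < hist_fun x 0 $ i" if "(\<omega>, x) \<in> K" "i \<in> J" for \<omega> x i
    using component_dichotomy[OF \<open>R > 0\<close> p0 K_def c_cont cE c_inv c_le, of i] that by (auto simp: J_def)
  have at: "hist_fun (u \<sigma> F s \<omega> x) 0 = sol \<omega> x s" "hist_fun (c (\<sigma> s \<omega>)) 0 = sol \<omega> (c \<omega>) s"
    if "(\<omega>, x) \<in> EB R'" for \<omega> x s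
    unfolding c_inv[symmetric]
    by (simp_all add: u_def hist_fun_seg_evolves[OF evolves_sol[OF EB_in_BC[OF that]]]
        hist_fun_seg_evolves[OF evolves_sol[OF EB_in_BC[OF cE]]])
  have K_move: "(\<sigma> s \<omega>, u \<sigma> F s \<omega> x) \<in> K" if "(\<omega>, x) \<in> K" for \<omega> x s
    using K_inv[OF that, of s] by (simp add: \<tau>_def)
  have J0': "sol \<omega> x s $ i = sol \<omega> (c \<omega>) s $ i" if "(\<omega>, x) \<in> K" "i \<notin> J" for \<omega> x s i
    using J0[OF K_move[OF that(1)] that(2), of s] at[of \<omega> x s] that(1) KE' by auto
  have J1': "sol \<omega> (c \<omega>) s $ i < sol \<omega> x s $ i" if "(\<omega>, x) \<in> K" "i \<in> J" for \<omega> x s i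
    using J1[OF K_move[OF that(1)] that(2), of s] at[of \<omega> x s] that(1) KE' by auto
  \<comment> \<open>The difference of x' - A x for a point of K and for c. It is continuous on the
    compact K and positive by (4) for i in J, so it has a positive minimum.\<close>
  define G where "G = (\<lambda>i z. F (fst z) (snd z) $ i - F (fst z) (c (fst z)) $ i -
      A $ i $ i * (hist_fun (snd z) 0 $ i - hist_fun (c (fst z)) 0 $ i))"
  have G_cont: "continuous_on K (G i)" for i
  proof -
    have cc: "continuous_on K (\<lambda>z. (fst z, c (fst z)))"
      by (intro continuous_intros continuous_on_compose2[OF c_cont]) auto
    have "continuous_on K (\<lambda>z. F (fst (fst z, c (fst z))) (snd (fst z, c (fst z))) $ i)"
      by (rule continuous_on_compose2[OF F_component_continuous[OF \<open>R' > 0\<close> order_refl] cc]) (auto intro: cE)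
    then show ?thesis
      unfolding G_def fst_conv snd_conv
      by (intro continuous_on_diff continuous_on_mult_left continuous_on_hist_component order_refl
          F_component_continuous[OF \<open>R > 0\<close> KE] continuous_on_compose2[OF c_cont] continuous_on_fst
          continuous_on_snd continuous_on_id) auto
  qed
  have G_pos: "G i z > 0" if "z \<in> K" "i \<in> J" for i z
  proof -
    obtain \<omega> x where z: "z = (\<omega>, x)" by (cases z)
    have xK: "(\<omega>, x) \<in> K" using that(1) z by simp
    have xE: "(\<omega>, x) \<in> EB R" using xK KE by blast
    note BC = EB_in_BC[OF xE] EB_in_BC[OF cE[of \<omega>]]
    have "\<forall>i\<in>J. F \<omega> x $ i - F \<omega> (c \<omega>) $ i - (A *v (hist_fun x 0 - hist_fun (c \<omega>) 0)) $ i > 0"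
    proof (rule F_strict[OF BC(2) BC(1) backward_extension_EB[OF cE] backward_extension_EB[OF xE] c_le[OF xK]])
      show "\<forall>i. i \<notin> J \<longrightarrow> (\<forall>s\<le>0. hist_fun (c \<omega>) s $ i = hist_fun x s $ i)"
        using J0'[OF xK] BC by (metis sol_init)
      show "\<forall>i\<in>J. \<forall>s\<le>0. hist_fun (c \<omega>) s $ i < hist_fun x s $ i"
        using J1'[OF xK] BC by (metis sol_init)
    qed
    then show ?thesis
      using that(2) by (simp add: G_def z A_mult_component)
  qed
  have "\<exists>m>0. \<forall>z\<in>K. m \<le> G i z" if "i \<in> J" for i
  proof -
    obtain z where "z \<in> K" "\<forall>y\<in>K. G i z \<le> G i y"
      using continuous_attains_inf[OF invariant_compact[OF K] K_ne G_cont] by blast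
    then show ?thesis
      using G_pos[OF _ that] by blast
  qed
  then obtain m where m: "\<And>i. i \<in> J \<Longrightarrow> m i > 0" "\<And>i z. i \<in> J \<Longrightarrow> z \<in> K \<Longrightarrow> m i \<le> G i z"
    by metis
  define \<eta> where "\<eta> = Min (insert 1 (m ` J))"
  have \<eta>: "\<eta> > 0" "\<And>i z. i \<in> J \<Longrightarrow> z \<in> K \<Longrightarrow> \<eta> \<le> G i z"
  proof -
    show "\<eta> > 0"
      using m(1) by (auto simp: \<eta>_def)
    fix i z assume "i \<in> J" "z \<in> K"
    then have "\<eta> \<le> m i"
      unfolding \<eta>_def by (intro Min_le) auto
    with m(2)[OF \<open>i \<in> J\<close> \<open>z \<in> K\<close>] show "\<eta> \<le> G i z" by simp
  qed
  define a1 where "a1 = (\<Sum>i\<in>UNIV. \<bar>A $ i $ i\<bar>)"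
  have a1: "\<bar>A $ i $ i\<bar> \<le> a1" for i
    using member_le_sum[of i UNIV "\<lambda>i. \<bar>A $ i $ i\<bar>"] by (auto simp: a1_def)
  have a1_nonneg: "a1 \<ge> 0"
    by (simp add: a1_def sum_nonneg)
  \<comment> \<open>A solution that is within e1 of c, in value and in F, has x' - A x at most
    \<eta> above that of c, hence not above that of K.\<close>
  define e1 where "e1 = \<eta> / (1 + a1)"
  have e1: "e1 > 0" "e1 + a1 * e1 = \<eta>"
  proof -
    show "e1 > 0"
      using \<eta>(1) a1_nonneg by (simp add: e1_def add_pos_nonneg)
    have "(1 + a1) * e1 = \<eta>"
      using a1_nonneg by (simp add: e1_def)
    then show "e1 + a1 * e1 = \<eta>"
      by (simp add: distrib_right)
  qed
  obtain d where d: "d > 0" "\<And>\<omega> y z s i. (\<omega>, y) \<in> EB R' \<Longrightarrow> continuous_on UNIV z \<Longrightarrow> seg 0 z \<in> B R' \<Longrightarrow>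
      dist (seg 0 z) y < d \<Longrightarrow> - 0 \<le> s \<Longrightarrow> s \<le> 0 \<Longrightarrow>
      \<bar>F (\<sigma> s \<omega>) (seg s z) $ i - F (\<sigma> s \<omega>) (seg s (sol \<omega> y)) $ i\<bar> < e1 \<and> \<bar>z s $ i - sol \<omega> y s $ i\<bar> < e1"
    by (rule F_close[OF \<open>R' > 0\<close> e1(1), of 0]) blast
  \<comment> \<open>As c is the greatest lower bound, it is enough that e lies below all of K: in
    the components of J by the gap, in the others because e is squeezed between c and x, which agree
    there.\<close>
  have isolated: "e = c \<omega>"
    if e: "(\<omega>, e) \<in> EB R'" "le_A A (c \<omega>) e" and x: "(\<omega>, x) \<in> K" "le_A A e x"
      and close: "\<And>t. dist (u \<sigma> F t \<omega> e) (c (\<sigma> t \<omega>)) < d" for \<omega> e x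
  proof (rule le_A_antisym[OF _ e(2)], rule c_max, rule lowerI[OF e(1)])
    fix y assume y: "(\<omega>, y) \<in> K"
    have yE: "(\<omega>, y) \<in> EB R'" and xE: "(\<omega>, x) \<in> EB R'" using x(1) y KE' by auto
    define q where "q = sol \<omega> e"
    define r where "r = sol \<omega> y"
    define cc where "cc = sol \<omega> (c \<omega>)"
    have q: "entire R' \<omega> q" and r: "entire R' \<omega> r"
      using e(1) yE by (auto simp: q_def r_def EB_entire)
    note BC = EB_in_BC[OF e(1)] EB_in_BC[OF yE] EB_in_BC[OF cE[of \<omega>]] EB_in_BC[OF xE]
    have rate: "A $ i $ i * (r s $ i - q s $ i) \<le> F (\<sigma> s \<omega>) (seg s r) $ i - F (\<sigma> s \<omega>) (seg s q) $ i"
      if "i \<in> J" for i s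
    proof -
      have "\<eta> \<le> G i (\<sigma> s \<omega>, u \<sigma> F s \<omega> y)"
        by (rule \<eta>(2)[OF that K_move[OF y]])
      then have 1: "\<eta> \<le> F (\<sigma> s \<omega>) (seg s r) $ i - F (\<sigma> s \<omega>) (c (\<sigma> s \<omega>)) $ i - A $ i $ i * (r s $ i - cc s $ i)"
        using at[OF yE, of s] by (simp add: G_def r_def cc_def u_def)
      have seg0: "seg 0 (\<lambda>t. q (s + t)) = seg s q"
        by (simp add: seg_shift)
      have "\<bar>F (\<sigma> 0 (\<sigma> s \<omega>)) (seg 0 (\<lambda>t. q (s + t))) $ i - F (\<sigma> 0 (\<sigma> s \<omega>)) (seg 0 (sol (\<sigma> s \<omega>) (c (\<sigma> s \<omega>)))) $ i\<bar> < e1 \<and>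
          \<bar>q (s + 0) $ i - sol (\<sigma> s \<omega>) (c (\<sigma> s \<omega>)) 0 $ i\<bar> < e1"
      proof (rule d(2)[OF cE])
        show "continuous_on UNIV (\<lambda>t. q (s + t))"
          using entire_shift[OF q, of s] evolves_continuous entire_evolves by blast
        show "seg 0 (\<lambda>t. q (s + t)) \<in> B R'"
          unfolding seg0 by (rule entire_in_B[OF q])
        show "dist (seg 0 (\<lambda>t. q (s + t))) (c (\<sigma> s \<omega>)) < d"
          unfolding seg0 using close[of s] by (simp add: u_def q_def)
      qed auto
      then have 2: "\<bar>F (\<sigma> s \<omega>) (seg s q) $ i - F (\<sigma> s \<omega>) (c (\<sigma> s \<omega>)) $ i\<bar> < e1" "\<bar>q s $ i - cc s $ i\<bar> < e1"
        using EB_in_BC[OF cE[of "\<sigma> s \<omega>"]] at(2)[OF yE, of s] by (auto simp: seg0 cc_def sol_init)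
      have "\<bar>A $ i $ i * (q s $ i - cc s $ i)\<bar> \<le> a1 * e1"
        unfolding abs_mult using 2(2) a1[of i] a1_nonneg by (intro mult_mono) auto
      with 1 2(1) e1(2) show ?thesis
        unfolding right_diff_distrib by linarith
    qed
    show "le_A A e y"
    proof (rule le_A_I[OF EB_in_B[OF e(1)] EB_in_B[OF yE]])
      fix i and s t :: real assume st: "s \<le> t" "t \<le> 0"
      have "exp (A $ i $ i * (t - s)) * (r s $ i - q s $ i) \<le> r t $ i - q t $ i"
      proof (cases "i \<in> J")
        case True
        show ?thesis
        proof (rule exp_growth[OF st(1)])
          show "continuous_on {s..t} (\<lambda>s. r s $ i - q s $ i)"
            using entire_evolves[OF q, of 0] entire_evolves[OF r, of 0] by (intro continuous_intros evolves_continuous)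
          fix w
          have "((\<lambda>s. r s $ i - q s $ i) has_real_derivative
              F (\<sigma> w \<omega>) (seg w r) $ i - F (\<sigma> w \<omega>) (seg w q) $ i) (at w)"
            by (intro DERIV_diff evolves_derivative[OF entire_evolves[OF q, of "w - 1"]]
                evolves_derivative[OF entire_evolves[OF r, of "w - 1"]]) auto
          then show "\<exists>D. ((\<lambda>s. r s $ i - q s $ i) has_real_derivative D) (at w) \<and>
              A $ i $ i * (r w $ i - q w $ i) \<le> D"
            using rate[OF True] by blast
        qed
      next
        case False
        have "q s $ i = r s $ i" if "s \<le> 0" for s
        proof -
          have "cc s $ i \<le> q s $ i" "q s $ i \<le> sol \<omega> x s $ i"
            using le_A_ge[OF e(2) that, of i] le_A_ge[OF x(2) that, of i] BC that
            by (auto simp: cc_def q_def sol_init)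
          then show ?thesis
            using J0'[OF x(1) False, of s] J0'[OF y False, of s] by (simp add: cc_def r_def)
        qed
        then show ?thesis
          using st by simp
      qed
      then show "exp (A $ i $ i * (t - s)) * (hist_fun y s $ i - hist_fun e s $ i) \<le> hist_fun y t $ i - hist_fun e t $ i"
        using st BC by (simp add: q_def r_def sol_init)
    qed
  qed
  obtain \<omega> x where p0_eq: "p0 = (\<omega>, x)" by (cases p0)
  have xK: "(\<omega>, x) \<in> K" using p0K p0_eq by simp
  have xE: "(\<omega>, x) \<in> EB R'" using xK KE' by blast
  \<comment> \<open>Steps shorter than d / 2 have limits of length at most d / 2, still strictly
    below the isolation distance.\<close>
  have "d / 2 > 0" using d(1) by simp
  obtain \<delta> where \<delta>: "\<delta> > 0" "\<And>x y t \<omega>. x \<in> B R' \<Longrightarrow> y \<in> B R' \<Longrightarrow> dist x y < \<delta> \<Longrightarrow> le_A A x y \<Longrightarrow> t \<ge> 0 \<Longrightarrow>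
      dist (u \<sigma> F t \<omega> x) (u \<sigma> F t \<omega> y) < d / 2"
    by (rule stableD[OF \<open>d / 2 > 0\<close>]) blast
  obtain N :: nat where N: "2 * R' / \<delta> < real N" "N > 0"
    using reals_Archimedean2[of "max (2 * R' / \<delta>) 0"] by auto
  define b where "b = (\<lambda>k :: nat. \<sigma> (- real k) \<omega>)"
  define xb where "xb = (\<lambda>k :: nat. u \<sigma> F (- real k) \<omega> x)"
  have xbK: "(b k, xb k) \<in> K" for k
    unfolding b_def xb_def by (rule K_move[OF xK])
  have xbE: "(b k, xb k) \<in> EB R'" for k
    using xbK KE' by blast
  \<comment> \<open>For each k these histories lead from c to the orbit of x, both at time - k. The
    intermediate ones are initial values only.\<close>
  define y where "y = (\<lambda>j k. convex_hist (real j / real N) (c (b k)) (xb k))"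
  have yB: "y j k \<in> B R'" if "j \<le> N" for j k
    unfolding y_def using that N(2)
    by (intro convex_hist_in_B EB_in_B[OF cE] EB_in_B[OF xbE]) (auto simp: field_simps)
  have y_mono: "le_A A (y j k) (y j' k)" if "j \<le> j'" for j j' k
    unfolding y_def using that by (intro le_A_convex c_le xbK divide_right_mono) auto
  have y0: "y 0 k = c (b k)" and yN: "y N k = xb k" for k
    using N(2) by (auto simp: y_def)
  have y_ge: "le_A A (c (b k)) (y j k)" for j k
    using y_mono[of 0 j k] by (simp add: y0)
  have y_le: "le_A A (y j k) (xb k)" if "j \<le> N" for j k
    using y_mono[OF that, of k] by (simp add: yN)
  have y_step: "dist (u \<sigma> F t (b k) (y j k)) (u \<sigma> F t (b k) (y (Suc j) k)) < d / 2" if "j < N" "t \<ge> 0" for j k t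
  proof (rule \<delta>(2)[OF yB yB])
    have "dist (y j k) (y (Suc j) k) \<le> \<bar>real j / real N - real (Suc j) / real N\<bar> * (2 * R')"
      unfolding y_def by (rule dist_convex_hist[OF EB_in_B[OF cE] EB_in_B[OF xbE]])
    also have "\<bar>real j / real N - real (Suc j) / real N\<bar> = 1 / real N"
      using N(2) by (simp add: field_simps)
    also have "1 / real N * (2 * R') < \<delta>"
      using N \<delta>(1) by (simp add: field_simps)
    finally show "dist (y j k) (y (Suc j) k) < \<delta>" .
  qed (use that y_mono in auto)
  have flow_b: "\<sigma> (t + real k) (b k) = \<sigma> t \<omega>" for t k
    by (simp add: b_def flow_add)
  have u_x: "u \<sigma> F (t + real k) (b k) (xb k) = u \<sigma> F t \<omega> x" for t k
    using \<tau>_add[OF xE, of "t + real k" "- real k"] by (simp add: \<tau>_def b_def xb_def)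
  have u_c: "u \<sigma> F (t + real k) (b k) (c (b k)) = c (\<sigma> t \<omega>)" for t k
    unfolding c_inv flow_b ..
  \<comment> \<open>If the solutions from step j tend to c, those from step j + 1 have an entire
    limit between c and K that stays within d / 2 of c at all times, so it is c by
    isolation.\<close>
  have chain: "\<exists>r'. strict_mono r' \<and>
      (\<forall>t. (\<lambda>n. u \<sigma> F (t + real (r (r' n))) (b (r (r' n))) (y j (r (r' n)))) \<longlonglongrightarrow> c (\<sigma> t \<omega>))"
    if "j \<le> N" "strict_mono (r :: nat \<Rightarrow> nat)" for j r
    using that
  proof (induction j arbitrary: r)
    case 0
    show ?case
      by (intro exI[of _ id]) (simp add: y0 u_c strict_mono_def)
  next
    case (Suc j)
    obtain r1 where r1: "strict_mono (r1 :: nat \<Rightarrow> nat)"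
      "\<And>t. (\<lambda>n. u \<sigma> F (t + real (r (r1 n))) (b (r (r1 n))) (y j (r (r1 n)))) \<longlonglongrightarrow> c (\<sigma> t \<omega>)"
      using Suc.IH[OF _ Suc.prems(2)] Suc.prems(1) by auto
    define k where "k = (\<lambda>n. r (r1 n))"
    have k: "strict_mono k"
      using strict_mono_o[OF Suc.prems(2) r1(1)] by (simp add: k_def o_def)
    have yBC: "y (Suc j) n \<in> BC" for n
      using yB[OF Suc.prems(1)] by (rule B_imp_BC)
    have ev: "evolves (- real (k n)) \<omega> (\<lambda>t. sol (b (k n)) (y (Suc j) (k n)) (real (k n) + t))" for n
      using evolves_sol_shift[OF yBC, of "real (k n)" "b (k n)" "k n"] by (simp add: b_def)
    have bound: "\<bar>sol (b (k n)) (y (Suc j) (k n)) (real (k n) + t) $ i\<bar> \<le> R'" for n t i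
      by (rule sandwich_bound[OF cE xbE yBC y_ge y_le[OF Suc.prems(1)]])
    obtain r2 p where r2: "strict_mono (r2 :: nat \<Rightarrow> nat)" "entire R' \<omega> p"
      "\<And>t. (\<lambda>n. seg t (\<lambda>t. sol (b (k (r2 n))) (y (Suc j) (k (r2 n))) (real (k (r2 n)) + t))) \<longlonglongrightarrow> seg t p"
      by (rule entire_limit[OF \<open>R' > 0\<close> tendsto_const ev
            filterlim_strict_mono_subseq[OF k filterlim_real_sequentially] bound]) blast
    define l where "l = (\<lambda>n. k (r2 n))"
    have l: "filterlim (\<lambda>n. real (l n)) at_top sequentially"
      unfolding l_def by (intro filterlim_strict_mono_subseq[OF r2(1)] filterlim_strict_mono_subseq[OF k] filterlim_real_sequentially)
    have lim: "(\<lambda>n. u \<sigma> F (t + real (l n)) (b (l n)) (y (Suc j) (l n))) \<longlonglongrightarrow> seg t p" for t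
      using r2(3)[of t] unfolding seg_shift' by (simp add: u_def l_def)
    have lim_j: "(\<lambda>n. u \<sigma> F (t + real (l n)) (b (l n)) (y j (l n))) \<longlonglongrightarrow> c (\<sigma> t \<omega>)" for t
      using filterlim_strict_mono_subseq[OF r2(1) r1(2)] by (simp add: l_def k_def)
    have late: "\<forall>\<^sub>F n in sequentially. t + real (l n) \<ge> 0" for t
    proof -
      have "\<forall>\<^sub>F n in sequentially. - t \<le> real (l n)"
        using l by (simp add: filterlim_at_top)
      then show ?thesis by eventually_elim simp
    qed
    have seg_eq: "seg t p = c (\<sigma> t \<omega>)" for t
    proof (rule isolated)
      show "(\<sigma> t \<omega>, seg t p) \<in> EB R'"
        by (rule EB_I[OF r2(2)])
      show "(\<sigma> t \<omega>, u \<sigma> F t \<omega> x) \<in> K"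
        by (rule K_move[OF xK])
      show "le_A A (c (\<sigma> t \<omega>)) (seg t p)"
      proof (rule le_A_limit[OF tendsto_const lim])
        show "\<forall>\<^sub>F n in sequentially. le_A A (c (\<sigma> t \<omega>)) (u \<sigma> F (t + real (l n)) (b (l n)) (y (Suc j) (l n)))"
          using late[of t]
        proof eventually_elim
          case (elim n)
          have "le_A A (u \<sigma> F (t + real (l n)) (b (l n)) (c (b (l n)))) (u \<sigma> F (t + real (l n)) (b (l n)) (y (Suc j) (l n)))"
            by (rule le_A_u[OF EB_in_BC[OF cE] yBC y_ge elim])
          then show ?case by (simp add: u_c)
        qed
      qed simp
      show "le_A A (seg t p) (u \<sigma> F t \<omega> x)"
      proof (rule le_A_limit[OF lim tendsto_const])
        show "\<forall>\<^sub>F n in sequentially. le_A A (u \<sigma> F (t + real (l n)) (b (l n)) (y (Suc j) (l n))) (u \<sigma> F t \<omega> x)"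
          using late[of t]
        proof eventually_elim
          case (elim n)
          have "le_A A (u \<sigma> F (t + real (l n)) (b (l n)) (y (Suc j) (l n))) (u \<sigma> F (t + real (l n)) (b (l n)) (xb (l n)))"
            by (rule le_A_u[OF yBC EB_in_BC[OF xbE] y_le[OF Suc.prems(1)] elim])
          then show ?case by (simp add: u_x)
        qed
      qed simp
      fix s
      have "dist (seg (s + t) p) (c (\<sigma> (s + t) \<omega>)) \<le> d / 2"
      proof (rule tendsto_upperbound[OF tendsto_dist[OF lim lim_j]])
        show "\<forall>\<^sub>F n in sequentially. dist (u \<sigma> F (s + t + real (l n)) (b (l n)) (y (Suc j) (l n)))
            (u \<sigma> F (s + t + real (l n)) (b (l n)) (y j (l n))) \<le> d / 2"
          using late[of "s + t"]
        proof eventually_elim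
          case (elim n)
          then show ?case
            using y_step[of j "s + t + real (l n)" "l n"] Suc.prems(1) by (simp add: dist_commute less_imp_le)
        qed
      qed simp
      then show "dist (u \<sigma> F s (\<sigma> t \<omega>) (seg t p)) (c (\<sigma> s (\<sigma> t \<omega>))) < d"
        using d(1) by (simp add: u_def entire_sol[OF r2(2)] seg_shift' flow_add)
    qed
    show ?case
    proof (intro exI[of _ "\<lambda>n. r1 (r2 n)"] conjI allI)
      show "strict_mono (\<lambda>n. r1 (r2 n))"
        using strict_mono_o[OF r1(1) r2(1)] by (simp add: o_def)
      show "(\<lambda>n. u \<sigma> F (t + real (r (r1 (r2 n)))) (b (r (r1 (r2 n)))) (y (Suc j) (r (r1 (r2 n))))) \<longlonglongrightarrow> c (\<sigma> t \<omega>)" for t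
        using lim[of t] by (simp add: seg_eq l_def k_def)
    qed
  qed
  \<comment> \<open>The last step starts on the orbit of x itself, so at time 0 the sequence is
    constantly x.\<close>
  obtain r' where "(\<lambda>n. u \<sigma> F (0 + real (r' n)) (b (r' n)) (y N (r' n))) \<longlonglongrightarrow> c (\<sigma> 0 \<omega>)"
    using chain[of N "\<lambda>n. n"] unfolding strict_mono_def by blast
  then have "(\<lambda>n :: nat. u \<sigma> F 0 \<omega> x) \<longlonglongrightarrow> c \<omega>"
    unfolding yN u_x by simp
  then have "x = c \<omega>"
    using LIMSEQ_unique[OF tendsto_const] EB_in_BC[OF xE] by simp
  then show ?thesis
    using that[OF R'(1) cE c_cont c_inv] p0_eq by simp
qed

end

section \<open>Initial values of bounded variation\<close>

text \<open>Unlike in \<open>total_variation\<close> the end points are not prescribed, so that one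
  supremum covers partitions reaching arbitrarily far into the past.\<close>

definition variation_sum :: "(real \<Rightarrow> real) \<Rightarrow> nat \<Rightarrow> (nat \<Rightarrow> real) \<Rightarrow> real" where
  "variation_sum f n p = (\<Sum>i<n. \<bar>f (p (Suc i)) - f (p i)\<bar>)"

lemma variation_sum_le_total_variation:
  assumes p: "mono p" "a \<le> p 0" "p n \<le> b"
  shows "ereal (variation_sum f n p) \<le> total_variation f a b"
proof -
  \<comment> \<open>a and b are attached to the partition as new first and last points.\<close>
  define q where "q = (\<lambda>i. if i = 0 then a else if i \<le> Suc n then p (i - 1) else b)"
  have ab: "p i \<le> b" "a \<le> p i" if "i \<le> n" for i
    using p monoD[OF p(1), of i n] monoD[OF p(1), of 0 i] that by auto
  have q: "q 0 = a" "q (Suc (Suc n)) = b" "q i \<le> q (Suc i)" for i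
    using ab monoD[OF p(1), of "i - 1" i] ab[of 0] ab[of "i - 1"] by (auto simp: q_def le_Suc_eq)
  have "variation_sum f n p = (\<Sum>i<n. \<bar>f (q (Suc (Suc i))) - f (q (Suc i))\<bar>)"
    unfolding variation_sum_def by (intro sum.cong) (auto simp: q_def)
  also have "\<dots> \<le> (\<Sum>i<Suc n. \<bar>f (q (Suc (Suc i))) - f (q (Suc i))\<bar>)"
    by simp
  also have "\<dots> \<le> (\<Sum>i<Suc (Suc n). \<bar>f (q (Suc i)) - f (q i)\<bar>)"
    unfolding sum.lessThan_Suc_shift[of _ "Suc n"] by simp
  finally have "ereal (variation_sum f n p) \<le> ereal (\<Sum>i<Suc (Suc n). \<bar>f (q (Suc i)) - f (q i)\<bar>)"
    by simp
  also have "\<dots> \<le> total_variation f a b"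
    unfolding total_variation_def
    by (rule SUP_upper2[of "(Suc (Suc n), q)"]) (use q in auto)
  finally show ?thesis .
qed

lemma mono_min_const:
  fixes p :: "nat \<Rightarrow> real"
  assumes "mono p"
  shows "mono (\<lambda>i. min (p i) c)"
proof (rule monoI)
  fix i j :: nat assume "i \<le> j"
  then have "p i \<le> p j" by (rule monoD[OF assms])
  then show "min (p i) c \<le> min (p j) c" by (rule min.mono) simp
qed

lemma mono_max_const:
  fixes p :: "nat \<Rightarrow> real"
  assumes "mono p"
  shows "mono (\<lambda>i. max (p i) c)"
proof (rule monoI)
  fix i j :: nat assume "i \<le> j"
  then have "p i \<le> p j" by (rule monoD[OF assms])
  then show "max (p i) c \<le> max (p j) c" by (rule max.mono) simp
qed

text \<open>Truncation by \<open>min\<close> and \<open>max\<close> has the effect of inserting c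
  without renumbering the partition; an increment straddling c obeys the triangle
  inequality.\<close>

lemma variation_sum_split:
  assumes "mono p"
  shows "variation_sum f n p \<le> variation_sum f n (\<lambda>i. min (p i) c) + variation_sum f n (\<lambda>i. max (p i) c)"
  unfolding variation_sum_def sum.distrib[symmetric]
proof (rule sum_mono)
  fix i
  have "p i \<le> p (Suc i)" using assms by (simp add: monoD)
  then consider "p (Suc i) \<le> c" | "c \<le> p i" | "p i \<le> c" "c \<le> p (Suc i)" by linarith
  then show "\<bar>f (p (Suc i)) - f (p i)\<bar> \<le>
      \<bar>f (min (p (Suc i)) c) - f (min (p i) c)\<bar> + \<bar>f (max (p (Suc i)) c) - f (max (p i) c)\<bar>"
    using \<open>p i \<le> p (Suc i)\<close> by cases (auto simp: min_def max_def)
qed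

lemma continuous_on_variation_sum:
  assumes X: "continuous_on {..0} X" and g: "\<And>i. continuous_on {..0} (g i)" "\<And>i s. s \<le> 0 \<Longrightarrow> i \<le> n \<Longrightarrow> g i s \<le> 0"
  shows "continuous_on {..0} (\<lambda>s. variation_sum X n (\<lambda>i. g i s))"
  unfolding variation_sum_def
  by (intro continuous_on_sum continuous_on_rabs continuous_on_diff continuous_on_compose2[OF X] g)
    (use g(2) in auto)

text \<open>Used with f a component of the initial value and k = \<open>- A $ i $ i\<close>. The
  uniform variation bound on unit intervals, together with the weight \<open>exp (k * s)\<close>,
  makes the variation over (-\<infinity>,t] finite and of order exp (k t).\<close>

locale weighted_bounded_variation =
  fixes f :: "real \<Rightarrow> real" and r k V :: real
  assumes f_cont: "continuous_on {..0} f" and f_bound: "\<And>s. s \<le> 0 \<Longrightarrow> \<bar>f s\<bar> \<le> r"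
    and k: "k > 0"
    and V: "\<And>n :: nat. n \<ge> 1 \<Longrightarrow> total_variation f (- real n) (- real n + 1) \<le> ereal V"
begin

definition X :: "real \<Rightarrow> real" where "X s = exp (k * s) * f s"

lemma X_cont: "continuous_on {..0} X"
  unfolding X_def by (intro continuous_intros f_cont)

lemma r_nonneg: "0 \<le> r"
  using f_bound[of 0] by simp

text \<open>Product rule: the increments of f carry a weight of at most
  \<open>exp (- k * real j)\<close>, and the increments of the weight are multiplied by at most r
  and telescope.\<close>

lemma variation_sum_unit:
  assumes p: "mono p" "- real (Suc j) \<le> p 0" "p n \<le> - real j"
  shows "variation_sum X n p \<le> (V + r) * exp (- k * real j)"
proof -
  have p_le: "p i \<le> - real j" if "i \<le> n" for i
    using p(3) monoD[OF p(1), of i n] that by simp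
  have "variation_sum X n p \<le> (\<Sum>i<n. exp (- k * real j) * \<bar>f (p (Suc i)) - f (p i)\<bar> +
      r * (exp (k * p (Suc i)) - exp (k * p i)))"
    unfolding variation_sum_def
  proof (rule sum_mono)
    fix i assume "i \<in> {..<n}"
    then have i: "p (Suc i) \<le> - real j" "p i \<le> p (Suc i)"
      using p_le[of "Suc i"] p(1) by (auto simp: monoD)
    have "X (p (Suc i)) - X (p i) = exp (k * p (Suc i)) * (f (p (Suc i)) - f (p i)) +
        f (p i) * (exp (k * p (Suc i)) - exp (k * p i))"
      by (simp add: X_def algebra_simps)
    also have "\<bar>\<dots>\<bar> \<le> exp (k * p (Suc i)) * \<bar>f (p (Suc i)) - f (p i)\<bar> + \<bar>f (p i)\<bar> * (exp (k * p (Suc i)) - exp (k * p i))"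
      using i k by (intro order_trans[OF abs_triangle_ineq]) (auto simp: abs_mult)
    also have "\<dots> \<le> exp (- k * real j) * \<bar>f (p (Suc i)) - f (p i)\<bar> + r * (exp (k * p (Suc i)) - exp (k * p i))"
    proof (intro add_mono mult_right_mono)
      have "k * p (Suc i) \<le> k * (- real j)"
        using i(1) k by (intro mult_left_mono) auto
      then show "exp (k * p (Suc i)) \<le> exp (- k * real j)" by simp
      show "\<bar>f (p i)\<bar> \<le> r"
        using i by (intro f_bound) simp
    qed (use i k in auto)
    finally show "\<bar>X (p (Suc i)) - X (p i)\<bar> \<le> exp (- k * real j) * \<bar>f (p (Suc i)) - f (p i)\<bar> +
        r * (exp (k * p (Suc i)) - exp (k * p i))" .
  qed
  also have "\<dots> = exp (- k * real j) * variation_sum f n p + r * (exp (k * p n) - exp (k * p 0))"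
    by (simp add: sum.distrib sum_distrib_left[symmetric] variation_sum_def sum_lessThan_telescope[of "\<lambda>i. exp (k * p i)"])
  also have "\<dots> \<le> exp (- k * real j) * V + r * exp (- k * real j)"
  proof (intro add_mono mult_left_mono)
    have "ereal (variation_sum f n p) \<le> total_variation f (- real (Suc j)) (- real (Suc j) + 1)"
      by (rule variation_sum_le_total_variation) (use p in auto)
    also have "\<dots> \<le> ereal V"
      by (rule V) simp
    finally show "variation_sum f n p \<le> V" by simp
    have "exp (k * p n) \<le> exp (- k * real j)"
      using mult_left_mono[OF p(3), of k] k by simp
    then show "exp (k * p n) - exp (k * p 0) \<le> exp (- k * real j)"
      using exp_gt_zero[of "k * p 0"] by linarith
  qed (use r_nonneg in auto)
  finally show ?thesis
    by (simp add: algebra_simps)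
qed

lemma V_nonneg: "0 \<le> V"
proof -
  have "ereal (variation_sum f 0 (\<lambda>_. -1)) \<le> total_variation f (- real 1) (- real 1 + 1)"
    by (rule variation_sum_le_total_variation) (auto simp: mono_def)
  also have "\<dots> \<le> ereal V" by (rule V) simp
  finally show ?thesis by (simp add: variation_sum_def)
qed

text \<open>Sum of the geometric series, with ratio \<open>exp (- k)\<close>, of the bounds for the
  unit intervals.\<close>

definition C :: real where "C = (V + r) / (1 - exp (- k))"

lemma C: "0 \<le> C" "C * exp (- k) + (V + r) = C"
proof -
  have "1 - exp (- k) > 0" using k by simp
  then show "0 \<le> C" "C * exp (- k) + (V + r) = C"
    using V_nonneg r_nonneg by (auto simp: C_def field_simps)
qed

lemma variation_sum_integer_bound:
  assumes "mono p" "- real (j + d) \<le> p 0" "p n \<le> - real j"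
  shows "variation_sum X n p \<le> C * exp (- k * real j)"
  using assms
proof (induction d arbitrary: j p)
  case 0
  have "p i = - real j" if "i \<le> n" for i
    using 0 monoD[OF 0(1), of i n] monoD[OF 0(1), of 0 i] that by simp
  then have "variation_sum X n p = 0"
    by (simp add: variation_sum_def)
  then show ?case
    using C(1) by simp
next
  case (Suc d)
  have "variation_sum X n p \<le> variation_sum X n (\<lambda>i. min (p i) (- real (Suc j))) +
      variation_sum X n (\<lambda>i. max (p i) (- real (Suc j)))"
    by (rule variation_sum_split[OF Suc.prems(1)])
  also have "variation_sum X n (\<lambda>i. min (p i) (- real (Suc j))) \<le> C * exp (- k * real (Suc j))"
  proof (rule Suc.IH)
    show "mono (\<lambda>i. min (p i) (- real (Suc j)))"
      by (rule mono_min_const[OF Suc.prems(1)])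
  qed (use Suc.prems in auto)
  also have "variation_sum X n (\<lambda>i. max (p i) (- real (Suc j))) \<le> (V + r) * exp (- k * real j)"
  proof (rule variation_sum_unit)
    show "mono (\<lambda>i. max (p i) (- real (Suc j)))"
      by (rule mono_max_const[OF Suc.prems(1)])
  qed (use Suc.prems in auto)
  also have "C * exp (- k * real (Suc j)) + (V + r) * exp (- k * real j) =
      (C * exp (- k) + (V + r)) * exp (- k * real j)"
    by (simp add: algebra_simps exp_add[symmetric] exp_diff exp_minus divide_simps)
  finally show ?case
    by (simp add: C(2))
qed

lemma variation_sum_bound:
  assumes p: "mono p" "p n \<le> t" and t: "t \<le> 0"
  shows "variation_sum X n p \<le> C * exp k * exp (k * t)"
proof -
  \<comment> \<open>Rounding t up to the integer - j costs the factor exp k.\<close>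
  define j where "j = nat \<lfloor>- t\<rfloor>"
  have j: "t \<le> - real j" "- real j \<le> t + 1"
    using t unfolding j_def by linarith+
  obtain d :: nat where "- p 0 \<le> real d"
    using real_arch_simple by blast
  then have "variation_sum X n p \<le> C * exp (- k * real j)"
    using p j by (intro variation_sum_integer_bound[where d = d]) auto
  also have "- k * real j \<le> k + k * t"
    using mult_left_mono[OF j(2), of k] k by (simp add: algebra_simps)
  then have "C * exp (- k * real j) \<le> C * exp (k + k * t)"
    using C(1) by (intro mult_left_mono) auto
  finally show ?thesis
    by (simp add: exp_add mult.assoc)
qed

text \<open>The variation of X over (-\<infinity>,t]. On t \<le> 0 both P and P + X are
  nondecreasing, which is how it enters the lower bound h.\<close>

definition P :: "real \<Rightarrow> real" where
  "P t = Sup {variation_sum X n p | n p. mono p \<and> p n \<le> t}"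

lemma P_upper: "mono p \<Longrightarrow> p n \<le> t \<Longrightarrow> t \<le> 0 \<Longrightarrow> variation_sum X n p \<le> P t"
  unfolding P_def using variation_sum_bound
  by (intro cSup_upper bdd_aboveI[of _ "C * exp k * exp (k * t)"]) blast+

lemma P_nonempty: "{variation_sum X n p | n p. mono p \<and> p n \<le> t} \<noteq> {}"
  by (auto intro!: exI[of _ "\<lambda>_ :: nat. t"] simp: mono_def)

lemma P_bound:
  assumes "t \<le> 0"
  shows "0 \<le> P t" "P t \<le> C * exp k * exp (k * t)"
proof -
  show "0 \<le> P t"
    using P_upper[of "\<lambda>_. t" 0 t] assms by (simp add: variation_sum_def mono_def)
  show "P t \<le> C * exp k * exp (k * t)"
    unfolding P_def by (rule cSup_least[OF P_nonempty]) (use variation_sum_bound assms in blast)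
qed

lemma P_less:
  assumes "a < P t"
  obtains n p where "mono p" "p n \<le> t" "a < variation_sum X n p"
  using less_cSupE[OF assms[unfolded P_def] P_nonempty] by blast

lemma P_superadditive:
  assumes "s \<le> t" "t \<le> 0"
  shows "P s + \<bar>X t - X s\<bar> \<le> P t"
proof -
  have "P s \<le> P t - \<bar>X t - X s\<bar>"
    unfolding P_def[of s]
  proof (rule cSup_least[OF P_nonempty])
    fix v assume "v \<in> {variation_sum X n p | n p. mono p \<and> p n \<le> s}"
    then obtain n p where v: "v = variation_sum X n p" and p: "mono p" "p n \<le> s"
      by blast
    define q where "q = (\<lambda>i. if i \<le> n then p i else if i = Suc n then s else t)"
    have "mono q"
    proof (rule incseq_SucI)
      fix i
      show "q i \<le> q (Suc i)"
        using p assms monoD[OF p(1), of i "Suc i"] by (auto simp: q_def le_Suc_eq not_le)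
    qed
    moreover have "q (Suc (Suc n)) \<le> t"
      by (simp add: q_def)
    ultimately have "variation_sum X (Suc (Suc n)) q \<le> P t"
      using assms by (intro P_upper)
    moreover have "variation_sum X n q = variation_sum X n p"
      unfolding variation_sum_def by (intro sum.cong) (auto simp: q_def)
    then have "variation_sum X (Suc (Suc n)) q = v + \<bar>X s - X (p n)\<bar> + \<bar>X t - X s\<bar>"
      by (simp add: variation_sum_def v q_def)
    ultimately show "v \<le> P t - \<bar>X t - X s\<bar>"
      by simp
  qed
  then show ?thesis by simp
qed

lemma P_mono: "s \<le> t \<Longrightarrow> t \<le> 0 \<Longrightarrow> P s \<le> P t"
  using P_superadditive[of s t] by linarith

lemma P_variation_sum:
  assumes "mono q" "q n \<le> 0"
  shows "P (q 0) + variation_sum X n q \<le> P (q n)"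
  using assms(2)
proof (induction n)
  case (Suc n)
  have "q n \<le> q (Suc n)" using assms(1) by (simp add: monoD)
  then show ?case
    using Suc P_superadditive[of "q n" "q (Suc n)"] by (simp add: variation_sum_def)
qed (simp add: variation_sum_def)

text \<open>From below: a nearly optimal partition for t is truncated at s, and its sum depends
  continuously on s. From above: a nearly optimal partition for time 0 is used; the sum Q s over its
  part to the right of s is continuous in s, and P s \<le> P 0 - Q s by superadditivity.\<close>

lemma P_cont: "continuous_on {..0} P"
  unfolding continuous_on_def
proof (intro ballI order_tendstoI)
  fix t a assume t: "t \<in> {..0 :: real}" and "a < P t"
  obtain n p where p: "mono p" "p n \<le> t" "a < variation_sum X n p"
    by (rule P_less[OF \<open>a < P t\<close>])
  have "p i \<le> t" if "i \<le> n" for i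
    using p(2) monoD[OF p(1) that] by simp
  then have "variation_sum X n (\<lambda>i. min (p i) t) = variation_sum X n p"
    unfolding variation_sum_def by (intro sum.cong) (auto simp: min_absorb1 Suc_le_eq)
  moreover have "continuous_on {..0} (\<lambda>s. variation_sum X n (\<lambda>i. min (p i) s))"
    by (intro continuous_on_variation_sum[OF X_cont] continuous_intros) auto
  then have "((\<lambda>s. variation_sum X n (\<lambda>i. min (p i) s)) \<longlongrightarrow> variation_sum X n (\<lambda>i. min (p i) t)) (at t within {..0})"
    using t by (simp add: continuous_on_def)
  ultimately have "\<forall>\<^sub>F s in at t within {..0}. a < variation_sum X n (\<lambda>i. min (p i) s)"
    using p(3) by (intro order_tendstoD(1)) auto
  moreover have "\<forall>\<^sub>F s in at t within {..0}. s \<le> 0"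
    by (simp add: eventually_at_filter)
  ultimately show "\<forall>\<^sub>F s in at t within {..0}. a < P s"
  proof eventually_elim
    case (elim s)
    have "variation_sum X n (\<lambda>i. min (p i) s) \<le> P s"
      using p(1) elim(2) by (intro P_upper mono_min_const) auto
    with elim show ?case by simp
  qed
next
  fix t a assume t: "t \<in> {..0 :: real}" and "P t < a"
  then have "P 0 - (a - P t) < P 0" by simp
  then obtain n p where p: "mono p" "p n \<le> 0" "P 0 - (a - P t) < variation_sum X n p"
    by (rule P_less)
  define Q where "Q = (\<lambda>s. variation_sum X n (\<lambda>i. max (p i) s))"
  have "variation_sum X n (\<lambda>i. min (p i) t) \<le> P t"
    using p(1) t by (intro P_upper mono_min_const) auto
  then have "P 0 - Q t < a"
    using variation_sum_split[OF p(1), of X n t] p(3) unfolding Q_def by linarith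
  moreover have "p i \<le> 0" if "i \<le> n" for i
    using p(2) monoD[OF p(1) that] by simp
  then have "continuous_on {..0} Q"
    unfolding Q_def by (intro continuous_on_variation_sum[OF X_cont] continuous_intros) auto
  then have "((\<lambda>s. P 0 - Q s) \<longlongrightarrow> P 0 - Q t) (at t within {..0})"
    using t by (intro tendsto_intros) (simp add: continuous_on_def)
  ultimately have "\<forall>\<^sub>F s in at t within {..0}. P 0 - Q s < a"
    by (intro order_tendstoD(2))
  moreover have "\<forall>\<^sub>F s in at t within {..0}. s \<le> 0"
    by (simp add: eventually_at_filter)
  ultimately show "\<forall>\<^sub>F s in at t within {..0}. P s < a"
  proof eventually_elim
    case (elim s)
    have "P s \<le> P (max (p 0) s)"
      using elim(2) p monoD[OF p(1), of 0 n] by (intro P_mono) auto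
    moreover have "P (max (p 0) s) + Q s \<le> P (max (p n) s)"
      unfolding Q_def using elim(2) p by (intro P_variation_sum mono_max_const) auto
    moreover have "P (max (p n) s) \<le> P 0"
      using elim(2) p by (intro P_mono) auto
    ultimately show ?case
      using elim(1) by linarith
  qed
qed

end

text \<open>For bounded histories, h \<le> x in the exponential order means that exp (- A s) (x - h)
  is nondecreasing. With P the variation of exp (- A s) x and h = - exp (A s) P, this is the
  monotonicity of P + exp (- A s) x; for 0 in place of x it is the monotonicity of P. The growth
  bound on P keeps h bounded.\<close>

lemma (in diagonal_matrix) bounded_variation_lower_bound:
  assumes x: "x \<in> B r"
    and V: "\<And>i n. n \<ge> (1 :: nat) \<Longrightarrow> total_variation (\<lambda>s. hist_fun x s $ i) (- real n) (- real n + 1) \<le> ereal V"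
  obtains h where "h \<in> BC" "le_A A h x" "le_A A h (const_hist 0)"
proof -
  have "\<exists>P. continuous_on {..0} P \<and> (\<exists>c. \<forall>t\<le>0. 0 \<le> P t \<and> P t \<le> c * exp (- A $ i $ i * t)) \<and>
      (\<forall>s t. s \<le> t \<longrightarrow> t \<le> 0 \<longrightarrow>
        P s + \<bar>exp (- A $ i $ i * t) * hist_fun x t $ i - exp (- A $ i $ i * s) * hist_fun x s $ i\<bar> \<le> P t)" for i
  proof -
    interpret weighted_bounded_variation "\<lambda>s. hist_fun x s $ i" r "- A $ i $ i" V
    proof
      show "continuous_on {..0} (\<lambda>s. hist_fun x s $ i)"
        by (intro continuous_intros continuous_hist_fun)
      show "\<bar>hist_fun x s $ i\<bar> \<le> r" if "s \<le> 0" for s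
        using x that by (simp add: B_iff)
    qed (use A_negative V in auto)
    show ?thesis
      using P_cont P_bound P_superadditive unfolding X_def by blast
  qed
  then obtain P c where P: "\<And>i. continuous_on {..0} (P i)" "\<And>i t. t \<le> 0 \<Longrightarrow> 0 \<le> P i t"
    "\<And>i t. t \<le> 0 \<Longrightarrow> P i t \<le> c i * exp (- A $ i $ i * t)"
    "\<And>i s t. s \<le> t \<Longrightarrow> t \<le> 0 \<Longrightarrow>
        P i s + \<bar>exp (- A $ i $ i * t) * hist_fun x t $ i - exp (- A $ i $ i * s) * hist_fun x s $ i\<bar> \<le> P i t"
    by metis
  define h where "h = Hist (restrict (\<lambda>s. \<chi> i. - (exp (A $ i $ i * s) * P i s)) {..0})"
  have h: "hist_fun h s $ i = - (exp (A $ i $ i * s) * P i s)" if "s \<le> 0" for s i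
  proof -
    have "hist_fun h s = (\<chi> i. - (exp (A $ i $ i * s) * P i s))"
      unfolding h_def using that
      by (intro Hist_inverse_restrict continuous_on_vec_lambda continuous_intros P(1)) auto
    then show ?thesis by simp
  qed
  define b where "b = (\<Sum>i\<in>UNIV. \<bar>c i\<bar>)"
  have hB: "h \<in> B b"
    unfolding B_iff
  proof (intro allI impI)
    fix s :: real and i assume s: "s \<le> 0"
    have "exp (A $ i $ i * s) * P i s \<le> exp (A $ i $ i * s) * (c i * exp (- A $ i $ i * s))"
      by (intro mult_left_mono P(3) s) auto
    also have "\<dots> = c i"
      by (simp add: exp_minus)
    also have "\<dots> \<le> b"
      unfolding b_def using member_le_sum[of i UNIV "\<lambda>i. \<bar>c i\<bar>"] by auto
    finally show "\<bar>hist_fun h s $ i\<bar> \<le> b"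
      using P(2)[OF s, of i] by (simp add: h s abs_mult)
  qed
  have weight: "exp (A $ i $ i * (t - s)) * v = exp (A $ i $ i * t) * (exp (- A $ i $ i * s) * v)" for i s t v
    by (simp add: mult.assoc[symmetric] exp_add[symmetric] right_diff_distrib)
  have unweight: "exp (A $ i $ i * t) * (exp (- A $ i $ i * t) * v) = v"
    "exp (- A $ i $ i * t) * (exp (A $ i $ i * t) * v) = v" for i t v
    by (simp_all add: mult.assoc[symmetric] exp_add[symmetric])
  have "le_A A h x"
  proof (rule le_A_I[OF hB x])
    fix i and s t :: real assume st: "s \<le> t" "t \<le> 0"
    have "exp (- A $ i $ i * s) * hist_fun x s $ i + P i s \<le> exp (- A $ i $ i * t) * hist_fun x t $ i + P i t"
      using P(4)[OF st, of i] by linarith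
    then have "exp (A $ i $ i * t) * (exp (- A $ i $ i * s) * hist_fun x s $ i + P i s) \<le>
        exp (A $ i $ i * t) * (exp (- A $ i $ i * t) * hist_fun x t $ i + P i t)"
      by (intro mult_left_mono) auto
    moreover have "exp (- A $ i $ i * s) * hist_fun x s $ i + P i s = exp (- A $ i $ i * s) * (hist_fun x s $ i - hist_fun h s $ i)"
      "exp (- A $ i $ i * t) * hist_fun x t $ i + P i t = exp (- A $ i $ i * t) * (hist_fun x t $ i - hist_fun h t $ i)"
      using st by (simp_all only: h diff_minus_eq_add distrib_left unweight order_trans[OF st])
    ultimately show "exp (A $ i $ i * (t - s)) * (hist_fun x s $ i - hist_fun h s $ i) \<le> hist_fun x t $ i - hist_fun h t $ i"
      by (simp only: weight unweight)
  qed
  moreover have "le_A A h (const_hist 0)"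
  proof (rule le_A_I[OF hB])
    show "const_hist 0 \<in> (B 0 :: 'm hist set)"
      by (rule const_hist_in_B) simp
    fix i and s t :: real assume st: "s \<le> t" "t \<le> 0"
    have "P i s \<le> P i t"
      using P(4)[OF st, of i] by linarith
    then have "exp (A $ i $ i * t) * P i s \<le> exp (A $ i $ i * t) * P i t"
      by (intro mult_left_mono) auto
    moreover have "exp (A $ i $ i * (t - s)) * (exp (A $ i $ i * s) * P i s) = exp (A $ i $ i * t) * P i s"
      by (simp only: weight unweight)
    ultimately have "exp (A $ i $ i * (t - s)) * (exp (A $ i $ i * s) * P i s) \<le> exp (A $ i $ i * t) * P i t"
      by (simp only:)
    then show "exp (A $ i $ i * (t - s)) * (hist_fun (const_hist 0) s $ i - hist_fun h s $ i)
        \<le> hist_fun (const_hist 0) t $ i - hist_fun h t $ i"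
      using st by (simp add: h)
  qed
  ultimately show ?thesis
    using that B_imp_BC[OF hB] by blast
qed

section \<open>Convergence to an equilibrium\<close>

context delay_system
begin

text \<open>F is bounded on \<open>B R\<close>, so entire solutions of size R are Lipschitz.\<close>

lemma EB_in_BU:
  assumes "R > 0" "(\<omega>, x) \<in> EB R"
  shows "x \<in> BU"
proof -
  have ent: "entire R \<omega> (sol \<omega> x)" by (rule EB_entire[OF assms(2)])
  obtain M where M: "M > 0" "\<And>\<omega> x i. x \<in> B R \<Longrightarrow> \<bar>F \<omega> x $ i\<bar> \<le> M"
    by (rule F_bounded[OF \<open>R > 0\<close>]) blast
  have "uniformly_continuous_on {..0} (hist_fun x)"
    unfolding uniformly_continuous_on_def
  proof (intro allI impI)
    fix e :: real assume "e > 0"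
    define d where "d = e / (real CARD('m) * M)"
    have "d > 0"
      using \<open>e > 0\<close> M(1) by (simp add: d_def)
    moreover have "dist (hist_fun x t) (hist_fun x s) < e" if "s \<le> 0" "t \<le> 0" "dist t s < d" for s t
    proof -
      have "\<bar>(sol \<omega> x t - sol \<omega> x s) $ i\<bar> \<le> M * \<bar>t - s\<bar>" for i
        using evolves_lipschitz[OF M(2) entire_evolves[OF ent, of "min s t - 1"] entire_bound[OF ent], of s t i] by simp
      then have "norm (sol \<omega> x t - sol \<omega> x s) \<le> real CARD('m) * (M * \<bar>t - s\<bar>)"
        by (rule norm_le_of_components)
      also have "\<dots> = (real CARD('m) * M) * \<bar>t - s\<bar>"
        by simp
      also have "\<dots> < (real CARD('m) * M) * d"
        using that(3) M(1) by (intro mult_strict_left_mono) (auto simp: dist_real_def)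
      also have "\<dots> = e"
        using M(1) by (simp add: d_def)
      finally show ?thesis
        using that EB_in_BC[OF assms(2)] by (simp add: dist_norm sol_init)
    qed
    ultimately show "\<exists>d>0. \<forall>x'\<in>{..0}. \<forall>x''\<in>{..0}. dist x'' x' < d \<longrightarrow> dist (hist_fun x x'') (hist_fun x x') < e"
      by blast
  qed
  with EB_in_BC[OF assms(2)] show ?thesis
    by (simp add: BU_def)
qed

text \<open>A limit of the trajectory along some times k n lies on an equilibrium c, so at one late
  time k n the trajectory is close to c over the same base point. From then on
  \<open>approx_stable\<close> keeps it close, with h as the lower bound of the initial
  history.\<close>

lemma convergence_to_equilibrium:
  assumes x0: "x\<^sub>0 \<in> BC" and h: "h \<in> BC" "le_A A h x\<^sub>0" "le_A A h (const_hist 0)"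
    and bounded: "bounded (range (sol \<omega>\<^sub>0 x\<^sub>0))"
  obtains c where "\<And>\<omega>. c \<omega> \<in> BU" "continuous_on UNIV c" "\<And>t \<omega>. u \<sigma> F t \<omega> (c \<omega>) = c (\<sigma> t \<omega>)"
    "((\<lambda>t. dist (u \<sigma> F t \<omega>\<^sub>0 x\<^sub>0) (c (\<sigma> t \<omega>\<^sub>0))) \<longlongrightarrow> 0) at_top"
proof -
  define z where "z = sol \<omega>\<^sub>0 x\<^sub>0"
  have z: "evolves 0 \<omega>\<^sub>0 z" unfolding z_def by (rule evolves_sol[OF x0])
  obtain b where b: "norm (z t) \<le> b" for t
    using bounded by (auto simp: bounded_iff z_def)
  obtain r where r: "h \<in> B r" by (rule in_BC_E[OF h(1)])
  define R where "R = \<bar>b\<bar> + \<bar>r\<bar> + 1"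
  have "R > 0" by (simp add: R_def)
  have zR: "\<bar>z t $ i\<bar> \<le> R" for t i
    using component_le_norm_cart[of "z t" i] b[of t] unfolding R_def by linarith
  have hR: "h \<in> B R"
    using r by (rule B_mono) (simp add: R_def)
  obtain r1 \<omega>1 where r1: "strict_mono (r1 :: nat \<Rightarrow> nat)" "(\<lambda>n. \<sigma> (real (r1 n)) \<omega>\<^sub>0) \<longlonglongrightarrow> \<omega>1"
    using compact_base[unfolded compact_def, rule_format, of "\<lambda>n. \<sigma> (real n) \<omega>\<^sub>0"] by (auto simp: o_def)
  have shift: "evolves (- s) (\<sigma> s \<omega>\<^sub>0) (\<lambda>t. z (s + t))" for s
    unfolding z_def by (rule evolves_sol_shift[OF x0])
  obtain r2 p where r2: "strict_mono (r2 :: nat \<Rightarrow> nat)" "entire R \<omega>1 p"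
    "\<And>t. (\<lambda>n. seg t (\<lambda>s. z (real (r1 (r2 n)) + s))) \<longlonglongrightarrow> seg t p"
    by (rule entire_limit[OF \<open>R > 0\<close> r1(2) shift filterlim_strict_mono_subseq[OF r1(1) filterlim_real_sequentially] zR]) blast
  obtain R' c where R': "R' \<ge> R" and cE: "\<And>\<omega>. (\<omega>, c \<omega>) \<in> EB R'" and c_cont: "continuous_on UNIV c"
    and c_inv: "\<And>t \<omega>. u \<sigma> F t \<omega> (c \<omega>) = c (\<sigma> t \<omega>)" and c_p: "snd (\<omega>1, seg 0 p) = c (fst (\<omega>1, seg 0 p))"
    by (rule point_on_equilibrium[OF \<open>R > 0\<close> EB_I0[OF r2(2)]]) blast
  have "R' > 0" using R' \<open>R > 0\<close> by simp
  define k where "k = (\<lambda>n. real (r1 (r2 n)))"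
  have k: "filterlim k at_top sequentially"
    unfolding k_def by (intro filterlim_strict_mono_subseq[OF r2(1)] filterlim_strict_mono_subseq[OF r1(1)] filterlim_real_sequentially)
  have base_lim: "(\<lambda>n. \<sigma> (k n) \<omega>\<^sub>0) \<longlonglongrightarrow> \<omega>1"
    unfolding k_def using filterlim_strict_mono_subseq[OF r2(1) r1(2)] .
  have "(\<lambda>n. c (\<sigma> (k n) \<omega>\<^sub>0)) \<longlonglongrightarrow> c \<omega>1"
    by (rule continuous_on_tendsto_compose[OF c_cont base_lim]) auto
  moreover have "(\<lambda>n. seg 0 (\<lambda>s. z (k n + s))) \<longlonglongrightarrow> c \<omega>1"
    using r2(3)[of 0] c_p by (simp add: k_def)
  ultimately have dist_lim: "(\<lambda>n. dist (seg 0 (\<lambda>s. z (k n + s))) (c (\<sigma> (k n) \<omega>\<^sub>0))) \<longlonglongrightarrow> dist (c \<omega>1) (c \<omega>1)"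
    by (intro tendsto_dist)
  have "((\<lambda>t. dist (u \<sigma> F t \<omega>\<^sub>0 x\<^sub>0) (c (\<sigma> t \<omega>\<^sub>0))) \<longlongrightarrow> 0) at_top"
  proof (rule tendstoI)
    fix e :: real assume "e > 0"
    obtain d N0 where d: "d > 0"
      "\<And>\<omega> y z N h t \<omega>'. N \<ge> N0 \<Longrightarrow> evolves (- N) \<omega> z \<Longrightarrow> seg 0 z \<in> B R' \<Longrightarrow> h \<in> B R' \<Longrightarrow>
         le_A A h (seg (- N) z) \<Longrightarrow> le_A A h (const_hist 0) \<Longrightarrow> (\<omega>, y) \<in> EB R' \<Longrightarrow>
         dist (seg 0 z) y < d \<Longrightarrow> t \<ge> 0 \<Longrightarrow> dist (u \<sigma> F t \<omega>' (seg 0 z)) (u \<sigma> F t \<omega>' y) < e"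
      by (rule approx_stable[OF \<open>R' > 0\<close> \<open>e > 0\<close>]) blast
    have "\<forall>\<^sub>F n in sequentially. dist (seg 0 (\<lambda>s. z (k n + s))) (c (\<sigma> (k n) \<omega>\<^sub>0)) < d"
      using dist_lim d(1) by (intro order_tendstoD(2)) auto
    \<comment> \<open>Seen from time k n, the initial history lies before - k n; it must be at least
      N0 in the past.\<close>
    moreover have "\<forall>\<^sub>F n in sequentially. max N0 0 \<le> k n"
      using k unfolding filterlim_at_top by blast
    ultimately have "\<forall>\<^sub>F n in sequentially. dist (seg 0 (\<lambda>s. z (k n + s))) (c (\<sigma> (k n) \<omega>\<^sub>0)) < d \<and> max N0 0 \<le> k n"
      by (rule eventually_conj)
    then obtain n where n: "dist (seg 0 (\<lambda>s. z (k n + s))) (c (\<sigma> (k n) \<omega>\<^sub>0)) < d" "max N0 0 \<le> k n"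
      using eventually_happens trivial_limit_sequentially by blast
    have zB: "seg s z \<in> B R" for s
      using zR by (intro seg_in_B evolves_continuous[OF z])
    have late: "dist (u \<sigma> F t \<omega>\<^sub>0 x\<^sub>0) (c (\<sigma> t \<omega>\<^sub>0)) < e" if t: "t \<ge> k n" for t
    proof -
      have "dist (u \<sigma> F (t - k n) (\<sigma> (k n) \<omega>\<^sub>0) (seg 0 (\<lambda>s. z (k n + s))))
          (u \<sigma> F (t - k n) (\<sigma> (k n) \<omega>\<^sub>0) (c (\<sigma> (k n) \<omega>\<^sub>0))) < e"
      proof (rule d(2)[OF _ shift _ B_mono[OF hR R'] _ h(3) cE n(1)])
        show "seg 0 (\<lambda>s. z (k n + s)) \<in> B R'"
          using B_mono[OF zB[of "k n"] R'] by (simp add: seg_shift)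
        show "le_A A h (seg (- k n) (\<lambda>s. z (k n + s)))"
          using h(2) x0 by (simp add: seg_shift z_def)
      qed (use n(2) t in auto)
      moreover have "u \<sigma> F (t - k n) (\<sigma> (k n) \<omega>\<^sub>0) (seg (k n) z) = seg t z"
        using u_seg[OF z _ B_imp_BC[OF zB], of "k n" "t - k n"] n(2) by simp
      moreover have "seg 0 (\<lambda>s. z (k n + s)) = seg (k n) z"
        by (simp add: seg_shift)
      moreover have "u \<sigma> F (t - k n) (\<sigma> (k n) \<omega>\<^sub>0) (c (\<sigma> (k n) \<omega>\<^sub>0)) = c (\<sigma> t \<omega>\<^sub>0)"
        by (simp add: c_inv flow_add[symmetric])
      moreover have "u \<sigma> F t \<omega>\<^sub>0 x\<^sub>0 = seg t z"
        by (simp add: u_def z_def)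
      ultimately show ?thesis
        by (simp only:)
    qed
    show "\<forall>\<^sub>F t in at_top. dist (dist (u \<sigma> F t \<omega>\<^sub>0 x\<^sub>0) (c (\<sigma> t \<omega>\<^sub>0))) 0 < e"
      using eventually_ge_at_top[of "k n"] by eventually_elim (use late in auto)
  qed
  with that[of c] EB_in_BU[OF \<open>R' > 0\<close> cE] c_cont c_inv show ?thesis
    by blast
qed

text \<open>Along times tending to infinity the trajectory tends to c \<omega> as soon as the base
  points tend to \<omega>, and recurrence of the base supplies such times for every
  \<omega>.\<close>

lemma omega_limit_eq_graph:
  assumes x0: "x\<^sub>0 \<in> BC" and c_cont: "continuous_on UNIV c"
    and conv: "((\<lambda>t. dist (u \<sigma> F t \<omega>\<^sub>0 x\<^sub>0) (c (\<sigma> t \<omega>\<^sub>0))) \<longlongrightarrow> 0) at_top"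
  shows "omega_limit \<sigma> F \<omega>\<^sub>0 x\<^sub>0 = {(\<omega>, c \<omega>) | \<omega>. True}"
proof -
  have to_c: "(\<lambda>n. u \<sigma> F (t n) \<omega>\<^sub>0 x\<^sub>0) \<longlonglongrightarrow> c \<omega>"
    if t: "filterlim t at_top sequentially" "(\<lambda>n. \<sigma> (t n) \<omega>\<^sub>0) \<longlonglongrightarrow> \<omega>" for t :: "nat \<Rightarrow> real" and \<omega>
  proof -
    have 1: "(\<lambda>n. dist (u \<sigma> F (t n) \<omega>\<^sub>0 x\<^sub>0) (c (\<sigma> (t n) \<omega>\<^sub>0))) \<longlonglongrightarrow> 0"
      by (rule filterlim_compose[OF conv t(1)])
    have "(\<lambda>n. c (\<sigma> (t n) \<omega>\<^sub>0)) \<longlonglongrightarrow> c \<omega>"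
      by (rule continuous_on_tendsto_compose[OF c_cont t(2)]) auto
    then have 2: "(\<lambda>n. dist (c (\<sigma> (t n) \<omega>\<^sub>0)) (c \<omega>)) \<longlonglongrightarrow> 0"
      by (rule iffD1[OF tendsto_dist_iff])
    have "(\<lambda>n. dist (u \<sigma> F (t n) \<omega>\<^sub>0 x\<^sub>0) (c \<omega>)) \<longlonglongrightarrow> 0"
    proof (rule Lim_null_comparison[OF _ tendsto_add_zero[OF 1 2]])
      show "\<forall>\<^sub>F n in sequentially. norm (dist (u \<sigma> F (t n) \<omega>\<^sub>0 x\<^sub>0) (c \<omega>)) \<le>
          dist (u \<sigma> F (t n) \<omega>\<^sub>0 x\<^sub>0) (c (\<sigma> (t n) \<omega>\<^sub>0)) + dist (c (\<sigma> (t n) \<omega>\<^sub>0)) (c \<omega>)"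
        by (intro always_eventually allI) (simp add: dist_triangle)
    qed
    then show ?thesis
      by (rule iffD2[OF tendsto_dist_iff])
  qed
  show ?thesis
  proof (intro equalityI subsetI)
    fix w assume "w \<in> omega_limit \<sigma> F \<omega>\<^sub>0 x\<^sub>0"
    then obtain \<omega> x t where w: "w = (\<omega>, x)" and t: "filterlim t at_top sequentially"
      "(\<lambda>n. \<sigma> (t n) \<omega>\<^sub>0) \<longlonglongrightarrow> \<omega>" "(\<lambda>n. dist (u \<sigma> F (t n) \<omega>\<^sub>0 x\<^sub>0) x) \<longlonglongrightarrow> 0"
      unfolding omega_limit_def by blast
    have "x = c \<omega>"
      by (rule LIMSEQ_unique[OF iffD2[OF tendsto_dist_iff, OF t(3)] to_c[OF t(1,2)]])
    then show "w \<in> {(\<omega>, c \<omega>) | \<omega>. True}"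
      using w by blast
  next
    fix w assume "w \<in> {(\<omega>, c \<omega>) | \<omega>. True}"
    then obtain \<omega> where w: "w = (\<omega>, c \<omega>)" by blast
    \<comment> \<open>\<open>omega_limit\<close> asks for a nondecreasing sequence of times, so each
      time is chosen beyond the previous one.\<close>
    have "\<exists>t. \<forall>n :: nat. (real n \<le> t n \<and> dist (\<sigma> (t n) \<omega>\<^sub>0) \<omega> < inverse (real (Suc n))) \<and> t n \<le> t (Suc n)"
    proof (rule dependent_nat_choice)
      show "\<exists>t. real 0 \<le> t \<and> dist (\<sigma> t \<omega>\<^sub>0) \<omega> < inverse (real (Suc 0))"
        using minimal_flow_recurrent[OF compact_base minimal, of "inverse (real (Suc 0))" "real 0"] by simp
      show "\<exists>t'. (real (Suc n) \<le> t' \<and> dist (\<sigma> t' \<omega>\<^sub>0) \<omega> < inverse (real (Suc (Suc n)))) \<and> t \<le> t'"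
        for t and n :: nat
        using minimal_flow_recurrent[OF compact_base minimal, of "inverse (real (Suc (Suc n)))" "max (real (Suc n)) t" \<omega>\<^sub>0 \<omega>]
        by (auto simp del: of_nat_Suc)
    qed
    then obtain t where t: "\<And>n :: nat. real n \<le> t n" "\<And>n. dist (\<sigma> (t n) \<omega>\<^sub>0) \<omega> < inverse (real (Suc n))"
      "\<And>n. t n \<le> t (Suc n)"
      by blast
    have t_top: "filterlim t at_top sequentially"
      by (rule filterlim_at_top_mono[OF filterlim_real_sequentially]) (simp add: t(1))
    have "(\<lambda>n. dist (\<sigma> (t n) \<omega>\<^sub>0) \<omega>) \<longlonglongrightarrow> 0"
      by (rule Lim_null_comparison[OF _ LIMSEQ_inverse_real_of_nat])
        (use t(2) in \<open>auto intro!: always_eventually less_imp_le simp del: of_nat_Suc\<close>)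
    then have base: "(\<lambda>n. \<sigma> (t n) \<omega>\<^sub>0) \<longlonglongrightarrow> \<omega>"
      by (rule iffD2[OF tendsto_dist_iff])
    have "(\<lambda>n. dist (u \<sigma> F (t n) \<omega>\<^sub>0 x\<^sub>0) (c \<omega>)) \<longlonglongrightarrow> 0"
      using to_c[OF t_top base] by (rule iffD1[OF tendsto_dist_iff])
    moreover have "0 \<le> t n" for n
      using t(1)[of n] by (meson of_nat_0_le_iff order_trans)
    moreover have "incseq t"
      using t(3) by (rule incseq_SucI)
    ultimately show "w \<in> omega_limit \<sigma> F \<omega>\<^sub>0 x\<^sub>0"
      unfolding omega_limit_def w using t_top base lifetime_infinite[OF x0] by blast
  qed
qed

end

theorem theorem3p11:
  fixes \<sigma> :: "real \<Rightarrow> 'o::metric_space \<Rightarrow> 'o"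
    and A :: "real ^ 'm ^ 'm"
    and F :: "'o \<Rightarrow> 'm hist \<Rightarrow> real ^ 'm"
    and \<omega>\<^sub>0 :: 'o and x\<^sub>0 :: "'m hist"
  assumes compact: "compact (UNIV :: 'o set)"
    and minimal: "minimal_flow \<sigma>"
    and A_diagonal: "\<And>i j. i \<noteq> j \<Longrightarrow> A $ i $ j = 0"
    and A_negative: "\<And>i. A $ i $ i < 0"
    and H1: "norm_continuous F" "locally_lipschitz F"
    and H2: "\<And>r. r > 0 \<Longrightarrow> continuous_on (UNIV \<times> B r) (\<lambda>(\<omega>, x). F \<omega> x)"
    and H3: "\<And>\<omega> x y. x \<in> BC \<Longrightarrow> y \<in> BC \<Longrightarrow> le_A A x y \<Longrightarrow>
          F \<omega> y - F \<omega> x \<ge> A *v (hist_fun y 0 - hist_fun x 0)"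
    and H4: "\<And>\<omega> x y J. x \<in> BC \<Longrightarrow> y \<in> BC \<Longrightarrow>
          backward_extension \<sigma> F \<omega> x \<Longrightarrow> backward_extension \<sigma> F \<omega> y \<Longrightarrow> le_A A x y \<Longrightarrow>
          (\<forall>i. i \<notin> J \<longrightarrow> (\<forall>s\<le>0. hist_fun x s $ i = hist_fun y s $ i)) \<Longrightarrow>
          (\<forall>i\<in>J. \<forall>s\<le>0. hist_fun x s $ i < hist_fun y s $ i) \<Longrightarrow>
          (\<forall>i\<in>J. F \<omega> y $ i - F \<omega> x $ i - (A *v (hist_fun y 0 - hist_fun x 0)) $ i > 0)"
    and H5: "\<And>k :: nat. uniformly_stable \<sigma> F A (B (real k))"
    and x0_BC: "x\<^sub>0 \<in> BC"
    and x0_BV: "\<And>i k. k \<ge> (1 :: nat) \<Longrightarrow>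
          total_variation (\<lambda>s. hist_fun x\<^sub>0 s $ i) (- real k) (- real k + 1) < \<infinity>"
    and x0_BV_sup: "(SUP (i, k) \<in> UNIV \<times> {1 :: nat..}.
          total_variation (\<lambda>s. hist_fun x\<^sub>0 s $ i) (- real k) (- real k + 1)) < \<infinity>"
    and bounded_solution:
          "bounded (solution \<sigma> F \<omega>\<^sub>0 x\<^sub>0 ` {t. ereal t < lifetime \<sigma> F \<omega>\<^sub>0 x\<^sub>0})"
  shows "\<exists>c :: 'o \<Rightarrow> 'm hist. (\<forall>\<omega>. c \<omega> \<in> BU) \<and> continuous_on UNIV c \<and> equilibrium \<sigma> F c \<and>
           omega_limit \<sigma> F \<omega>\<^sub>0 x\<^sub>0 = {(\<omega>, c \<omega>) | \<omega>. True} \<and>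
           ((\<lambda>t. dist (u \<sigma> F t \<omega>\<^sub>0 x\<^sub>0) (c (\<sigma> t \<omega>\<^sub>0))) \<longlongrightarrow> 0) at_top"
proof -
  interpret delay_system A \<sigma> F
    by standard (fact A_diagonal A_negative compact minimal H1 H2 H3 H4 H5)+
  obtain r where r: "x\<^sub>0 \<in> B r" by (rule in_BC_E[OF x0_BC])
  define S where "S = (SUP (i, k) \<in> UNIV \<times> {1 :: nat..}.
      total_variation (\<lambda>s. hist_fun x\<^sub>0 s $ i) (- real k) (- real k + 1))"
  have "S \<noteq> \<infinity>"
    using x0_BV_sup by (simp add: S_def)
  then obtain V :: nat where V: "S < ereal (real V)"
    using less_PInf_Ex_of_nat[of S] by blast
  have "total_variation (\<lambda>s. hist_fun x\<^sub>0 s $ i) (- real n) (- real n + 1) \<le> ereal (real V)" if "n \<ge> 1" for i n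
    unfolding S_def[symmetric]
    by (rule order_trans[OF _ less_imp_le[OF V]], unfold S_def, rule SUP_upper2[of "(i, n)"]) (use that in auto)
  then obtain h where h: "h \<in> BC" "le_A A h x\<^sub>0" "le_A A h (const_hist 0)"
    by (rule bounded_variation_lower_bound[OF r]) blast
  \<comment> \<open>All solutions are global, so boundedness on the lifetime is boundedness on the
    whole line.\<close>
  have "ereal t < lifetime \<sigma> F \<omega>\<^sub>0 x\<^sub>0" for t
    by (rule le_less_trans[OF _ lifetime_infinite[OF x0_BC, of "max t 0"]]) auto
  then have "bounded (range (sol \<omega>\<^sub>0 x\<^sub>0))"
    using bounded_solution by simp
  then obtain c where c: "\<And>\<omega>. c \<omega> \<in> BU" "continuous_on UNIV c" "\<And>t \<omega>. u \<sigma> F t \<omega> (c \<omega>) = c (\<sigma> t \<omega>)"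
    "((\<lambda>t. dist (u \<sigma> F t \<omega>\<^sub>0 x\<^sub>0) (c (\<sigma> t \<omega>\<^sub>0))) \<longlongrightarrow> 0) at_top"
    by (rule convergence_to_equilibrium[OF x0_BC h]) blast
  have "equilibrium \<sigma> F c"
    unfolding equilibrium_def using c(1,3) lifetime_infinite by (auto simp: BU_def)
  with c omega_limit_eq_graph[OF x0_BC c(2,4)] show ?thesis
    by blast
qed

end
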